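(* Let $k\geq 2$ and $s\geq 1$ be integers and let $\alpha\in[\frac{ks+1}{ks+s},1]$ be rational. Let $\ell$ be the smallest positive integer such that $\frac{\ell}{(2k+1)s}$ and $\frac{\alpha\ell}{(2k+1)s}$ are integers. There exist integers $t_0,q_0$ such that for every integer $t\geq t_0$ and every prime power $q\geq q_0$ there exists a bipartite graph $G$ with parts $M,N$, $|M|=q^{\alpha\ell}$, $|N|=q^{\ell}$, such that $G$ is $K_{s,t}^{(2k+1)}$-free and \[e(G)\geq \frac12 |M|^{1-\frac{k}{2k+1}}|N|^{1-\frac{k}{2k+1}-\frac{1}{(2k+1)s}}.\]
   Context: For a graph $H$ and a positive integer $k$, $H^{(k)}$ is obtained from $H$ by replacing each edge $uv$ by a path of length $k$ from $u$ to $v$, these paths being pairwise internally vertex-disjoint. $K_{s,t}$ is the complete bipartite graph with parts of sizes $s$ and $t$. *)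

theory Defs
  imports Complex_Main "HOL-Number_Theory.Prime_Powers"
begin

type_synonym 'a ugraph = "'a set \<times> 'a set set"

abbreviation verts :: "'a ugraph \<Rightarrow> 'a set" where "verts \<equiv> fst"
abbreviation edges :: "'a ugraph \<Rightarrow> 'a set set" where "edges \<equiv> snd"

definition simple_graph :: "'a ugraph \<Rightarrow> bool" where
  "simple_graph G \<longleftrightarrow> finite (verts G) \<and> (\<forall>e \<in> edges G. e \<subseteq> verts G \<and> card e = 2)"

definition bipartite_graph :: "'a ugraph \<Rightarrow> 'a set \<Rightarrow> 'a set \<Rightarrow> bool" where
  "bipartite_graph G M N \<longleftrightarrow> simple_graph G \<and> verts G = M \<union> N \<and> M \<inter> N = {} \<and>
     (\<forall>e \<in> edges G. \<exists>u \<in> M. \<exists>v \<in> N. e = {u, v})"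

definition complete_bipartite :: "nat \<Rightarrow> nat \<Rightarrow> nat ugraph" where
  "complete_bipartite s t = ({..<s + t}, {{i, j} | i j. i < s \<and> s \<le> j \<and> j < s + t})"

datatype 'a subdiv_vertex = Branch 'a | Inner 'a 'a nat

text \<open>
  The \<open>i\<close>-th vertex, \<open>0 \<le> i \<le> k\<close>, of the path of length \<open>k\<close> that replaces the edge \<open>uv\<close>.
\<close>

definition subdiv_point :: "nat \<Rightarrow> 'a \<Rightarrow> 'a \<Rightarrow> nat \<Rightarrow> 'a subdiv_vertex" where
  "subdiv_point k u v i = (if i = 0 then Branch u else if i = k then Branch v else Inner u v i)"

text \<open>
  \<open>subdivision k H\<close> is the graph \<open>H\<^sup>(\<^sup>k\<^sup>)\<close>, meaningful for \<open>k \<ge> 1\<close>. The linear order on the vertices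
  of \<open>H\<close> only serves to traverse every edge in one of its two directions, so that each edge
  is replaced by a single path; up to isomorphism the result does not depend on it.
\<close>

definition subdivision :: "nat \<Rightarrow> ('a::linorder) ugraph \<Rightarrow> 'a subdiv_vertex ugraph" where
  "subdivision k H =
     (Branch ` verts H \<union> {Inner u v i | u v i. u < v \<and> {u, v} \<in> edges H \<and> 0 < i \<and> i < k},
      {{subdiv_point k u v i, subdiv_point k u v (Suc i)} | u v i.
         u < v \<and> {u, v} \<in> edges H \<and> i < k})"

text \<open>Subgraph containment: copies need not be induced.\<close>

definition contains_copy :: "'b ugraph \<Rightarrow> 'a ugraph \<Rightarrow> bool" where
  "contains_copy G F \<longleftrightarrow>
     (\<exists>\<phi>. inj_on \<phi> (verts F) \<and> \<phi> ` verts F \<subseteq> verts G \<and> (\<forall>e \<in> edges F. \<phi> ` e \<in> edges G))"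

definition graph_free :: "'b ugraph \<Rightarrow> 'a ugraph \<Rightarrow> bool" where
  "graph_free G F \<longleftrightarrow> \<not> contains_copy G F"

end

theory Submission
  imports Defs "HOL-Algebra.Algebraic_Closure_Type" "HOL-Library.Z2"
begin

text \<open>
  Take random polynomials \<open>f\<^sub>1, \<dots>, f\<^sub>r\<close> over a finite field of size comparable to \<open>q\<close> and join \<open>x\<close> to \<open>y\<close> when
  \<open>(f\<^sub>1(x, y), \<dots>, f\<^sub>r(x, y))\<close> lies in a fixed set of \<open>2\<^sup>r\<close> values. A copy of the subdivision contains \<open>t\<close> spiders
  with the same \<open>s\<close> roots that are otherwise disjoint, and each of them solves one of boundedly many polynomial systems.
  Boundedly many of these solutions are nonsingular, by an elementary form of Bezout's theorem. The
  singular ones are controlled by probability: values and derivatives of the \<open>f\<^sub>i\<close> at distinct points are independent,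
  and a solution is singular with probability \<open>O(1/q)\<close> because the spider is balanced, so a union bound over all roots
  excludes \<open>T\<close> disjoint singular solutions for a constant \<open>T\<close>. No dichotomy of Lang-Weil type is needed.

  The field is taken in characteristic 2, inside one fixed algebraically closed type. Its order is then only within
  a factor 2 of \<open>q\<close>, which the \<open>2\<^sup>r\<close> allowed values compensate.
\<close>

section \<open>Polynomial functions over a finite subfield\<close>

text \<open>The number \<open>r\<close> of equations is forced by the exponents: q^(dm + dn - r)
  edges are wanted. A spider with centre in N then has exactly as many free coordinates as
  equations, and one with centre in M has at most as many. The lower bound on \<alpha> says r \<le>
  dm, which keeps every part of a spider from having more coordinates than there are equations
  touching it. The support of a kernel vector is such a part, so up to scaling the vector has fewer
  degrees of freedom than the equations imposed on it. The obstacle is the size of the union bound.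
  It runs over up to |F|^(s dn) choices of roots, and the failure probability must also beat the
  edge density, of order |F|^(-r), so that the bad choices hold at most half of the expected edges.
  Hence T = s dn + r + 1 singular spiders are treated jointly, each saving one factor |F|, and the
  degree of the polynomials must be large enough for independence on all edges of T spiders at
  once.\<close>

locale finite_subfield =
  fixes F :: "'k::field set"
  assumes infinite_UNIV_k: "infinite (UNIV :: 'k set)"
    and finite_F [simp]: "finite F"
    and zero_in [simp]: "0 \<in> F"
    and one_in [simp]: "1 \<in> F"
    and add_in [simp]: "x \<in> F \<Longrightarrow> y \<in> F \<Longrightarrow> x + y \<in> F"
    and minus_in [simp]: "x \<in> F \<Longrightarrow> - x \<in> F"
    and mult_in [simp]: "x \<in> F \<Longrightarrow> y \<in> F \<Longrightarrow> x * y \<in> F"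
    and inverse_in [simp]: "x \<in> F \<Longrightarrow> inverse x \<in> F"
begin

lemma diff_in [simp]: "x \<in> F \<Longrightarrow> y \<in> F \<Longrightarrow> x - y \<in> F"
  using add_in[of x "- y"] by simp

lemma divide_in [simp]: "x \<in> F \<Longrightarrow> y \<in> F \<Longrightarrow> x / y \<in> F"
  by (simp add: divide_inverse)

lemma sum_in: "(\<And>i. i \<in> A \<Longrightarrow> f i \<in> F) \<Longrightarrow> sum f A \<in> F"
  by (induction A rule: infinite_finite_induct) auto

lemma card_F_gt_1: "card F > 1"
proof -
  have "card {0, 1 :: 'k} \<le> card F" by (intro card_mono) auto
  then show ?thesis by simp
qed

text \<open>
  Polynomial functions of total degree at most \<open>d\<close> in the variables \<open>V\<close> with coefficients in \<open>F\<close>. They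
  are functions on the whole infinite field, so that they determine their restrictions to lines as
  formal univariate polynomials although \<open>F\<close> is finite.
\<close>

inductive polyf :: "'v set \<Rightarrow> nat \<Rightarrow> (('v \<Rightarrow> 'k) \<Rightarrow> 'k) \<Rightarrow> bool" for V where
  const: "c \<in> F \<Longrightarrow> polyf V d (\<lambda>x. c)"
| var: "i \<in> V \<Longrightarrow> d \<ge> 1 \<Longrightarrow> polyf V d (\<lambda>x. x i)"
| add: "polyf V d g \<Longrightarrow> polyf V d h \<Longrightarrow> polyf V d (\<lambda>x. g x + h x)"
| mult: "polyf V d g \<Longrightarrow> polyf V e h \<Longrightarrow> d + e \<le> d' \<Longrightarrow> polyf V d' (\<lambda>x. g x * h x)"

lemma polyf_mono: "polyf V d g \<Longrightarrow> d \<le> d' \<Longrightarrow> polyf V d' g"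
proof (induction arbitrary: d' rule: polyf.induct)
  case (mult d g e h d'' d')
  show ?case by (rule polyf.mult[OF mult(1,2)]) (use mult in linarith)
qed (auto intro: polyf.intros)

lemma polyf_sum: "(\<And>i. i \<in> A \<Longrightarrow> polyf V d (g i)) \<Longrightarrow> polyf V d (\<lambda>x. \<Sum>i\<in>A. g i x)"
  by (induction A rule: infinite_finite_induct) (auto intro: polyf.intros)

lemma polyf_prod: "(\<And>i. i \<in> A \<Longrightarrow> polyf V (d i) (g i)) \<Longrightarrow> polyf V (\<Sum>i\<in>A. d i) (\<lambda>x. \<Prod>i\<in>A. g i x)"
  by (induction A rule: infinite_finite_induct) (auto intro: polyf.const polyf.mult[OF _ _ order_refl])

lemma polyf_power: "polyf V d g \<Longrightarrow> polyf V (n * d) (\<lambda>x. g x ^ n)"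
  by (induction n) (auto intro: polyf.const polyf.mult[OF _ _ order_refl])

lemma polyf_scale: "polyf V d g \<Longrightarrow> c \<in> F \<Longrightarrow> polyf V d (\<lambda>x. c * g x)"
  by (rule polyf.mult[where d = 0]) (auto intro: polyf.intros)

lemma polyf_diff: "polyf V d g \<Longrightarrow> polyf V d h \<Longrightarrow> polyf V d (\<lambda>x. g x - h x)"
  using polyf.add[of V d g "\<lambda>x. (- 1) * h x"] polyf_scale[of V d h "- 1"] by simp

lemma polyf_cong: "polyf V d g \<Longrightarrow> (\<And>i. i \<in> V \<Longrightarrow> x i = y i) \<Longrightarrow> g x = g y"
  by (induction rule: polyf.induct) auto

lemma polyf_in: "polyf V d g \<Longrightarrow> (\<And>i. i \<in> V \<Longrightarrow> x i \<in> F) \<Longrightarrow> g x \<in> F"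
  by (induction rule: polyf.induct) auto

text \<open>Fixing the roots of a spider replaces some variables by constants. Substituting only
  variables and constants keeps the degree bound.\<close>

lemma polyf_subst:
  assumes "polyf W d g"
    and "\<And>w. w \<in> W \<Longrightarrow> (\<exists>i\<in>V. \<sigma> w = (\<lambda>x. x i)) \<or> (\<exists>c\<in>F. \<sigma> w = (\<lambda>x. c))"
  shows "polyf V d (\<lambda>x. g (\<lambda>w. \<sigma> w x))"
  using assms(1)
proof (induction rule: polyf.induct)
  case (var i d)
  then show ?case using assms(2)[of i] polyf.var[of _ V d] polyf.const[of _ V d] by auto
qed (auto intro: polyf.intros)

section \<open>Monomial expansion and the number of polynomial functions\<close>

abbreviation exps :: "'v set \<Rightarrow> nat \<Rightarrow> ('v \<Rightarrow> nat) set" where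
  "exps V d \<equiv> PiE V (\<lambda>_. {..d})"

text \<open>Exponents are bounded separately by d instead of in total, so that the monomials form a
  product set with \<open>(d + 1) ^ card V\<close> elements. Coefficient families live in a
  \<open>PiE\<close> so that they can be counted.\<close>

lemma polyf_monomials:
  fixes V :: "'v set"
  assumes V: "finite V" and "polyf V d g"
  shows "\<exists>c \<in> PiE (exps V d) (\<lambda>_. F). g = (\<lambda>x. \<Sum>a\<in>exps V d. c a * (\<Prod>i\<in>V. x i ^ a i))"
proof -
  have fin: "finite (exps V e)" for e by (intro finite_PiE V) auto
  define M where "M = (\<lambda>(a :: 'v \<Rightarrow> nat) (x :: 'v \<Rightarrow> 'k). \<Prod>i\<in>V. x i ^ a i)"
  define R where "R = (\<lambda>e h. \<exists>c. (\<forall>a\<in>exps V e. c a \<in> F) \<and> h = (\<lambda>x. \<Sum>a\<in>exps V e. c a * M a x))"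
  have R_single: "R e (\<lambda>x. c * M a x)" if "c \<in> F" "a \<in> exps V e" for c a e
    unfolding R_def
    by (rule exI[of _ "\<lambda>a'. if a' = a then c else 0"])
       (use that fin in \<open>auto intro!: ext simp: if_distrib[of "\<lambda>t. t * _"] sum.delta cong: if_cong\<close>)
  have R_add: "R e (\<lambda>x. g x + h x)" if "R e g" "R e h" for e g h
  proof -
    from that obtain c c' where "\<forall>a\<in>exps V e. c a \<in> F" "g = (\<lambda>x. \<Sum>a\<in>exps V e. c a * M a x)"
      "\<forall>a\<in>exps V e. c' a \<in> F" "h = (\<lambda>x. \<Sum>a\<in>exps V e. c' a * M a x)"
      unfolding R_def by blast
    then show ?thesis unfolding R_def
      by (intro exI[of _ "\<lambda>a. c a + c' a"]) (auto simp: sum.distrib ring_distribs)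
  qed
  have R_0: "R e (\<lambda>x. 0)" for e
    unfolding R_def by (rule exI[of _ "\<lambda>_. 0"]) auto
  have R_sum: "R e (\<lambda>x. \<Sum>i\<in>A. h i x)" if "\<And>i. i \<in> A \<Longrightarrow> R e (h i)" for e h and A :: "'z set"
    using that by (induction A rule: infinite_finite_induct) (auto intro: R_add R_0)
  have "R d g" using assms(2)
  proof (induction rule: polyf.induct)
    case (const c d)
    have "M (\<lambda>i\<in>V. 0) x = 1" for x by (simp add: M_def)
    with R_single[OF const, of "\<lambda>i\<in>V. 0" d] show ?case by auto
  next
    case (var j d)
    have "M (\<lambda>i\<in>V. if i = j then 1 else 0) x = x j" for x
    proof -
      have "M (\<lambda>i\<in>V. if i = j then 1 else 0) x = (\<Prod>i\<in>V. if i = j then x i else 1)"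
        unfolding M_def by (rule prod.cong) auto
      then show ?thesis using V var by simp
    qed
    with R_single[of 1 "\<lambda>i\<in>V. if i = j then 1 else 0" d] var show ?case by auto
  next
    case (add d g h)
    then show ?case by (intro R_add)
  next
    case (mult d g e h d')
    then obtain c c' where c: "\<forall>a\<in>exps V d. c a \<in> F" "g = (\<lambda>x. \<Sum>a\<in>exps V d. c a * M a x)"
      "\<forall>a\<in>exps V e. c' a \<in> F" "h = (\<lambda>x. \<Sum>a\<in>exps V e. c' a * M a x)"
      unfolding R_def by blast
    have "(\<lambda>x. g x * h x) = (\<lambda>x. \<Sum>a\<in>exps V d. \<Sum>b\<in>exps V e. (c a * c' b) * M (\<lambda>i\<in>V. a i + b i) x)"
    proof
      fix x
      have "M (\<lambda>i\<in>V. a i + b i) x = M a x * M b x" for a b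
        unfolding M_def prod.distrib[symmetric] by (rule prod.cong) (auto simp: power_add)
      then show "g x * h x = (\<Sum>a\<in>exps V d. \<Sum>b\<in>exps V e. (c a * c' b) * M (\<lambda>i\<in>V. a i + b i) x)"
        unfolding c(2,4) sum_product by (intro sum.cong refl) (simp add: mult_ac)
    qed
    moreover have "R d' (\<lambda>x. (c a * c' b) * M (\<lambda>i\<in>V. a i + b i) x)" if "a \<in> exps V d" "b \<in> exps V e" for a b
    proof (rule R_single)
      show "c a * c' b \<in> F" using c that by auto
      have "a i \<le> d" "b i \<le> e" if "i \<in> V" for i using \<open>a \<in> _\<close> \<open>b \<in> _\<close> that by (auto dest: PiE_mem)
      then show "(\<lambda>i\<in>V. a i + b i) \<in> exps V d'" using mult(3) by (fastforce intro: order_trans)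
    qed
    ultimately show ?case by (auto intro!: R_sum)
  qed
  then obtain c where c: "\<forall>a\<in>exps V d. c a \<in> F" "g = (\<lambda>x. \<Sum>a\<in>exps V d. c a * M a x)"
    unfolding R_def by blast
  show ?thesis
    by (rule bexI[of _ "restrict c (exps V d)"]) (use c in \<open>auto simp: M_def fun_eq_iff\<close>)
qed

definition PF :: "'v set \<Rightarrow> nat \<Rightarrow> (('v \<Rightarrow> 'k) \<Rightarrow> 'k) set" where
  "PF V d = {g. polyf V d g}"

lemma PF_bound:
  assumes V: "finite V"
  shows "finite (PF V d)" "card (PF V d) \<le> card F ^ ((d + 1) ^ card V)"
proof -
  let ?C = "PiE (exps V d) (\<lambda>_. F)"
  let ?f = "\<lambda>c x. \<Sum>a\<in>exps V d. c a * (\<Prod>i\<in>V. x i ^ a i)"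
  have fin: "finite (exps V d)" by (intro finite_PiE V) auto
  have sub: "PF V d \<subseteq> ?f ` ?C"
    unfolding PF_def using polyf_monomials[OF V] by blast
  have finC: "finite ?C" by (intro finite_PiE fin) auto
  show "finite (PF V d)" using sub finC by (meson finite_imageI finite_subset)
  have "card (PF V d) \<le> card (?f ` ?C)" using sub finC by (intro card_mono) auto
  also have "\<dots> \<le> card ?C" by (rule card_image_le[OF finC])
  also have "\<dots> = card F ^ ((d + 1) ^ card V)"
    using V fin by (simp add: card_PiE)
  finally show "card (PF V d) \<le> card F ^ ((d + 1) ^ card V)" .
qed

text \<open>The linear coefficient of a polynomial function of one variable; junk for other functions.\<close>

definition dline :: "('k \<Rightarrow> 'k) \<Rightarrow> 'k" where
  "dline \<phi> = Polynomial.coeff (THE \<pi>. \<forall>\<tau>. poly \<pi> \<tau> = \<phi> \<tau>) 1"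

abbreviation lin :: "(('v \<Rightarrow> 'k) \<Rightarrow> 'k) \<Rightarrow> ('v \<Rightarrow> 'k) \<Rightarrow> ('v \<Rightarrow> 'k) \<Rightarrow> 'k" where
  "lin g p v \<equiv> dline (\<lambda>\<tau>. g (\<lambda>i. p i + \<tau> * v i))"

section \<open>Restriction to lines and gradients\<close>

lemma poly_fun_unique:
  fixes \<pi> \<pi>' :: "'k poly"
  assumes "\<And>\<tau>. poly \<pi> \<tau> = poly \<pi>' \<tau>"
  shows "\<pi> = \<pi>'"
proof (rule ccontr)
  assume "\<pi> \<noteq> \<pi>'"
  then have "finite {x. poly (\<pi> - \<pi>') x = 0}" by (intro poly_roots_finite) auto
  moreover have "{x. poly (\<pi> - \<pi>') x = 0} = UNIV" using assms by auto
  ultimately show False using infinite_UNIV_k by simp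
qed

lemma dline_eq:
  assumes "\<And>\<tau>. \<phi> \<tau> = poly \<pi> \<tau>"
  shows "dline \<phi> = Polynomial.coeff \<pi> 1"
proof -
  have "(THE \<pi>. \<forall>\<tau>. poly \<pi> \<tau> = \<phi> \<tau>) = \<pi>"
    by (rule the_equality) (use assms in \<open>auto intro: poly_fun_unique\<close>)
  then show ?thesis by (simp add: dline_def)
qed

text \<open>The sum and product rules build the gradient along the inductive definition. The
  polynomial along the line is carried through the induction because \<open>dline\<close> is
  meaningful only when it exists. The derivative is formal, so characteristic 2 does no
  harm.\<close>

lemma polyf_gradient:
  assumes V: "finite V" and "polyf V d g" and p: "\<And>i. i \<in> V \<Longrightarrow> p i \<in> F"
  shows "\<exists>\<gamma>. (\<forall>i\<in>V. \<gamma> i \<in> F) \<and> (\<forall>v. \<exists>\<pi>. (\<forall>\<tau>. g (\<lambda>i. p i + \<tau> * v i) = poly \<pi> \<tau>) \<and>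
                  Polynomial.coeff \<pi> 1 = (\<Sum>i\<in>V. \<gamma> i * v i))"
  using assms(2)
proof (induction rule: polyf.induct)
  case (const c d)
  show ?case
    by (rule exI[of _ "\<lambda>_. 0"]) (auto intro!: exI[of _ "[:c:]"])
next
  case (var j d)
  have "\<exists>\<pi>. (\<forall>\<tau>. p j + \<tau> * v j = poly \<pi> \<tau>) \<and>
      Polynomial.coeff \<pi> 1 = (\<Sum>i\<in>V. (if i = j then 1 else 0) * v i)" for v
    by (rule exI[of _ "[:p j, v j:]"]) (use V var in \<open>auto simp: if_distrib[of "\<lambda>t. t * _"] sum.delta cong: if_cong\<close>)
  then show ?case by (intro exI[of _ "\<lambda>i. if i = j then 1 else 0"]) auto
next
  case (add d g h)
  then obtain \<gamma> \<gamma>' where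
    g: "\<forall>i\<in>V. \<gamma> i \<in> F" "\<And>v. \<exists>\<pi>. (\<forall>\<tau>. g (\<lambda>i. p i + \<tau> * v i) = poly \<pi> \<tau>) \<and> Polynomial.coeff \<pi> 1 = (\<Sum>i\<in>V. \<gamma> i * v i)" and
    h: "\<forall>i\<in>V. \<gamma>' i \<in> F" "\<And>v. \<exists>\<pi>. (\<forall>\<tau>. h (\<lambda>i. p i + \<tau> * v i) = poly \<pi> \<tau>) \<and> Polynomial.coeff \<pi> 1 = (\<Sum>i\<in>V. \<gamma>' i * v i)"
    by blast
  show ?case
  proof (intro exI[of _ "\<lambda>i. \<gamma> i + \<gamma>' i"] conjI allI)
    fix v
    from g(2)[of v] h(2)[of v] obtain \<pi> \<pi>' where
      "\<forall>\<tau>. g (\<lambda>i. p i + \<tau> * v i) = poly \<pi> \<tau>" "Polynomial.coeff \<pi> 1 = (\<Sum>i\<in>V. \<gamma> i * v i)"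
      "\<forall>\<tau>. h (\<lambda>i. p i + \<tau> * v i) = poly \<pi>' \<tau>" "Polynomial.coeff \<pi>' 1 = (\<Sum>i\<in>V. \<gamma>' i * v i)" by blast
    then show "\<exists>\<pi>. (\<forall>\<tau>. g (\<lambda>i. p i + \<tau> * v i) + h (\<lambda>i. p i + \<tau> * v i) = poly \<pi> \<tau>) \<and>
      Polynomial.coeff \<pi> 1 = (\<Sum>i\<in>V. (\<gamma> i + \<gamma>' i) * v i)"
      by (intro exI[of _ "\<pi> + \<pi>'"]) (auto simp: sum.distrib ring_distribs)
  qed (use g h in auto)
next
  case (mult d g e h d')
  then obtain \<gamma> \<gamma>' where
    g: "\<forall>i\<in>V. \<gamma> i \<in> F" "\<And>v. \<exists>\<pi>. (\<forall>\<tau>. g (\<lambda>i. p i + \<tau> * v i) = poly \<pi> \<tau>) \<and> Polynomial.coeff \<pi> 1 = (\<Sum>i\<in>V. \<gamma> i * v i)" and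
    h: "\<forall>i\<in>V. \<gamma>' i \<in> F" "\<And>v. \<exists>\<pi>. (\<forall>\<tau>. h (\<lambda>i. p i + \<tau> * v i) = poly \<pi> \<tau>) \<and> Polynomial.coeff \<pi> 1 = (\<Sum>i\<in>V. \<gamma>' i * v i)"
    by blast
  have gp: "g p \<in> F" "h p \<in> F"
    using polyf_in[OF mult(1), of p] polyf_in[OF mult(2), of p] p by auto
  show ?case
  proof (intro exI[of _ "\<lambda>i. g p * \<gamma>' i + h p * \<gamma> i"] conjI allI)
    fix v
    from g(2)[of v] h(2)[of v] obtain \<pi> \<pi>' where
      \<pi>: "\<forall>\<tau>. g (\<lambda>i. p i + \<tau> * v i) = poly \<pi> \<tau>" "Polynomial.coeff \<pi> 1 = (\<Sum>i\<in>V. \<gamma> i * v i)"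
      "\<forall>\<tau>. h (\<lambda>i. p i + \<tau> * v i) = poly \<pi>' \<tau>" "Polynomial.coeff \<pi>' 1 = (\<Sum>i\<in>V. \<gamma>' i * v i)" by blast
    have "Polynomial.coeff \<pi> 0 = g p" "Polynomial.coeff \<pi>' 0 = h p"
      using \<pi>(1)[rule_format, of 0] \<pi>(3)[rule_format, of 0] by (auto simp: poly_0_coeff_0)
    then have "Polynomial.coeff (\<pi> * \<pi>') 1 = (\<Sum>i\<in>V. (g p * \<gamma>' i + h p * \<gamma> i) * v i)"
      using \<pi>(2,4) by (simp add: coeff_mult sum_distrib_left sum.distrib ring_distribs mult_ac)
    then show "\<exists>\<pi>. (\<forall>\<tau>. g (\<lambda>i. p i + \<tau> * v i) * h (\<lambda>i. p i + \<tau> * v i) = poly \<pi> \<tau>) \<and>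
      Polynomial.coeff \<pi> 1 = (\<Sum>i\<in>V. (g p * \<gamma>' i + h p * \<gamma> i) * v i)"
      using \<pi> by (intro exI[of _ "\<pi> * \<pi>'"]) auto
  qed (use g h gp in auto)
qed

lemma polyf_line:
  assumes V: "finite V" and g: "polyf V d g" and p: "\<And>i. i \<in> V \<Longrightarrow> p i \<in> F"
  obtains \<pi> where "\<And>\<tau>. g (\<lambda>i. p i + \<tau> * v i) = poly \<pi> \<tau>"
    "Polynomial.coeff \<pi> 0 = g p" "Polynomial.coeff \<pi> 1 = lin g p v"
proof -
  obtain \<pi> where \<pi>: "\<And>\<tau>. g (\<lambda>i. p i + \<tau> * v i) = poly \<pi> \<tau>"
    using polyf_gradient[OF V g, of p] p by metis
  show ?thesis
    by (rule that[OF \<pi>]) (use \<pi>[of 0] dline_eq[OF \<pi>] in \<open>auto simp: poly_0_coeff_0\<close>)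
qed

text \<open>The derivative is linear in the direction with coefficients in F, so common kernels of
  such forms over F can be counted.\<close>

lemma lin_gradient:
  assumes V: "finite V" and g: "polyf V d g" and p: "\<And>i. i \<in> V \<Longrightarrow> p i \<in> F"
  obtains \<gamma> where "\<And>i. i \<in> V \<Longrightarrow> \<gamma> i \<in> F" "\<And>v. lin g p v = (\<Sum>i\<in>V. \<gamma> i * v i)"
proof -
  obtain \<gamma> where \<gamma>: "\<forall>i\<in>V. \<gamma> i \<in> F" "\<And>v. \<exists>\<pi>. (\<forall>\<tau>. g (\<lambda>i. p i + \<tau> * v i) = poly \<pi> \<tau>) \<and>
     Polynomial.coeff \<pi> 1 = (\<Sum>i\<in>V. \<gamma> i * v i)"
    using polyf_gradient[OF V g, of p] p by metis
  have "lin g p v = (\<Sum>i\<in>V. \<gamma> i * v i)" for v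
    using \<gamma>(2)[of v] dline_eq by metis
  with \<gamma>(1) show ?thesis using that by blast
qed

lemma lin_add:
  assumes V: "finite V" and g: "polyf V d g" and h: "polyf V e h" and p: "\<And>i. i \<in> V \<Longrightarrow> p i \<in> F"
  shows "lin (\<lambda>x. g x + h x) p v = lin g p v + lin h p v"
proof -
  obtain \<pi> where 1: "\<And>\<tau>. g (\<lambda>i. p i + \<tau> * v i) = poly \<pi> \<tau>" "Polynomial.coeff \<pi> 0 = g p" "Polynomial.coeff \<pi> 1 = lin g p v"
    by (rule polyf_line[OF V g, of p v]) (use p in auto)
  obtain \<pi>' where 2: "\<And>\<tau>. h (\<lambda>i. p i + \<tau> * v i) = poly \<pi>' \<tau>" "Polynomial.coeff \<pi>' 0 = h p" "Polynomial.coeff \<pi>' 1 = lin h p v"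
    by (rule polyf_line[OF V h, of p v]) (use p in auto)
  from 1 2 show ?thesis by (subst dline_eq[of _ "\<pi> + \<pi>'"]) auto
qed

lemma lin_mult:
  assumes V: "finite V" and g: "polyf V d g" and h: "polyf V e h" and p: "\<And>i. i \<in> V \<Longrightarrow> p i \<in> F"
  shows "lin (\<lambda>x. g x * h x) p v = g p * lin h p v + h p * lin g p v"
proof -
  obtain \<pi> where 1: "\<And>\<tau>. g (\<lambda>i. p i + \<tau> * v i) = poly \<pi> \<tau>" "Polynomial.coeff \<pi> 0 = g p" "Polynomial.coeff \<pi> 1 = lin g p v"
    by (rule polyf_line[OF V g, of p v]) (use p in auto)
  obtain \<pi>' where 2: "\<And>\<tau>. h (\<lambda>i. p i + \<tau> * v i) = poly \<pi>' \<tau>" "Polynomial.coeff \<pi>' 0 = h p" "Polynomial.coeff \<pi>' 1 = lin h p v"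
    by (rule polyf_line[OF V h, of p v]) (use p in auto)
  from 1 2 show ?thesis by (subst dline_eq[of _ "\<pi> * \<pi>'"]) (auto simp: coeff_mult mult_ac)
qed

lemma lin_const: "lin (\<lambda>x. c) p v = 0"
  by (subst dline_eq[of _ "[:c:]"]) auto

lemma lin_cong:
  assumes g: "polyf V d g" and "\<And>i. i \<in> V \<Longrightarrow> p i = p' i" "\<And>i. i \<in> V \<Longrightarrow> v i = v' i"
  shows "lin g p v = lin g p' v'"
proof -
  have "g (\<lambda>i. p i + \<tau> * v i) = g (\<lambda>i. p' i + \<tau> * v' i)" for \<tau>
    by (rule polyf_cong[OF g]) (use assms in auto)
  then show ?thesis by simp
qed

end

section \<open>Fields of order a power of two\<close>

lemma CHAR_bit: "CHAR(bit) = 2"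
proof (rule CHAR_eqI)
  have "(of_nat x :: bit) = of_bool (odd x)" for x
    by (induction x) auto
  then show "2 dvd x" if "of_nat x = (0 :: bit)" for x
    using that by (auto split: if_splits)
qed auto

text \<open>The polynomial X^Q - X splits into linear factors over the closure. Since Q = 0 in
  characteristic 2, its derivative is the constant -1, so no root is repeated and there are exactly
  Q of them.\<close>

lemma card_fixed_points_frobenius:
  fixes e :: nat
  assumes "e > 0"
  shows "card {x :: bit alg_closure. x ^ (2 ^ e) = x} = 2 ^ e"
proof -
  define Q :: nat where "Q = 2 ^ e"
  have Q1: "Q > 1" using assms one_less_power[of "2::nat" e] by (simp add: Q_def)
  define p :: "bit alg_closure poly" where "p = Polynomial.monom 1 Q + Polynomial.monom (-1) 1"
  have degp: "Polynomial.degree p = Q"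
    unfolding p_def using Q1 by (subst degree_add_eq_left) (auto simp: degree_monom_eq)
  then have p0: "p \<noteq> 0" using Q1 by auto
  have lc: "lead_coeff p = 1"
    using Q1 by (subst degp) (simp add: p_def)
  obtain A where A': "size A = Polynomial.degree p" "p = Polynomial.smult (lead_coeff p) (\<Prod>x\<in>#A. [:-x, 1:])"
    using alg_closed_imp_factorization[OF p0] by blast
  have A: "size A = Q" "p = (\<Prod>x\<in>#A. [:-x, 1:])"
    using A'(1) degp A'(2)[unfolded lc] by simp_all
  have "(of_nat Q :: bit alg_closure) = 0"
    using assms by (simp only: of_nat_eq_0_iff_char_dvd CHAR_alg_closure CHAR_bit Q_def) simp
  then have pd: "pderiv p = [:-1:]"
    by (simp add: p_def pderiv_add pderiv_monom monom_0)
  have cnt: "count A x \<le> 1" for x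
  proof (rule ccontr)
    assume "\<not> count A x \<le> 1"
    then have "{#x, x#} \<subseteq># A"
      by (auto simp: subseteq_mset_def)
    then obtain B where "A = {#x, x#} + B"
      by (metis subset_mset.add_diff_inverse)
    then have "p = [:-x,1:] * ([:-x,1:] * (\<Prod>x\<in>#B. [:-x, 1:]))"
      by (simp add: A)
    then have "poly (pderiv p) x = 0"
      by (simp add: pderiv_mult del: mult_pCons_left)
    then show False by (simp add: pd)
  qed
  have "A = mset_set (set_mset A)"
  proof (rule multiset_eqI)
    fix x show "count A x = count (mset_set (set_mset A)) x"
      using cnt[of x] by (cases "x \<in># A") (auto simp: not_in_iff count_mset_set' intro: antisym)
  qed
  then have "card (set_mset A) = Q"
    by (metis A(1) size_mset_set)
  moreover have "set_mset A = {x. poly p x = 0}"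
    by (auto simp: A(2) poly_prod_mset prod_mset_zero_iff)
  moreover have "{x. poly p x = 0} = {x. x ^ Q = x}"
    by (simp add: p_def poly_monom)
  ultimately show ?thesis by (simp add: Q_def)
qed

text \<open>A closure with n elements could not hold the 2^(n+1) fixed points of a power of
  Frobenius.\<close>

lemma infinite_bit_alg_closure: "infinite (UNIV :: bit alg_closure set)"
proof
  assume fin: "finite (UNIV :: bit alg_closure set)"
  let ?n = "card (UNIV :: bit alg_closure set)"
  have "card {x :: bit alg_closure. x ^ (2 ^ Suc ?n) = x} \<le> ?n"
    by (intro card_mono fin) auto
  then have "(2::nat) ^ Suc ?n \<le> ?n"
    by (subst (asm) card_fixed_points_frobenius) auto
  then show False
    using less_exp[of "Suc ?n"] by linarith
qed

lemma finite_subfield_fixed_points: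
  assumes "e > 0"
  shows "finite_subfield {x :: bit alg_closure. x ^ (2 ^ e) = x}"
proof
  have "Factorial_Ring.prime CHAR(bit alg_closure)" by (simp add: CHAR_bit)
  note add = freshmans_dream'[OF this, of "2 ^ e" e, simplified CHAR_alg_closure CHAR_bit, OF refl]
  show "infinite (UNIV :: bit alg_closure set)" by (rule infinite_bit_alg_closure)
  show "finite {x :: bit alg_closure. x ^ (2 ^ e) = x}"
    by (rule card_ge_0_finite) (simp add: card_fixed_points_frobenius[OF assms])
  show "x + y \<in> {x. x ^ (2 ^ e) = x}" if "x \<in> {x. x ^ (2 ^ e) = x}" "y \<in> {x. x ^ (2 ^ e) = x}"
    for x y :: "bit alg_closure" using that by (simp add: add)
  show "- x \<in> {x. x ^ (2 ^ e) = x}" if "x \<in> {x. x ^ (2 ^ e) = x}" for x :: "bit alg_closure"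
  proof -
    have "of_nat CHAR(bit alg_closure) = (0 :: bit alg_closure)" by (rule of_nat_CHAR)
    then have "(2 :: bit alg_closure) = 0" by (simp add: CHAR_bit)
    then have "- x = x" by (metis add_eq_0_iff mult_2 mult_zero_left)
    then show ?thesis using that by (simp only:)
  qed
qed (auto simp: power_mult_distrib power_inverse power_0_left)

section \<open>Nonsingular zeros of polynomial systems\<close>

context finite_subfield
begin

lemma power_sum_vanish:
  fixes c :: "nat \<Rightarrow> 'k"
  assumes "card Y > \<delta>" and "\<And>y. y \<in> Y \<Longrightarrow> (\<Sum>i\<le>\<delta>. c i * y ^ i) = 0" and "i \<le> \<delta>"
  shows "c i = 0"
proof -
  define p where "p = (\<Sum>i\<le>\<delta>. Polynomial.monom (c i) i)"
  have coeffp: "Polynomial.coeff p i = (if i \<le> \<delta> then c i else 0)" for i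
    by (simp add: p_def coeff_sum)
  then have "Polynomial.degree p \<le> \<delta>" by (intro degree_le) auto
  then have "p = 0"
    by (intro poly_eqI_degree[of Y]) (use assms in \<open>auto simp: p_def poly_sum poly_monom\<close>)
  then show ?thesis using coeffp[of i] assms(3) by simp
qed

text \<open>Induction on the variables: with the others fixed, the sum is a polynomial of degree at
  most \<delta> in one variable with more than \<delta> roots, and each of its coefficients is again
  a vanishing sum of the same kind.\<close>

lemma monomial_sum_vanish:
  fixes C :: "('j \<Rightarrow> nat) \<Rightarrow> 'k"
  assumes "finite J" and "card F > \<delta>"
    and "\<And>y. y \<in> PiE J (\<lambda>_. F) \<Longrightarrow> (\<Sum>a\<in>exps J \<delta>. C a * (\<Prod>j\<in>J. y j ^ a j)) = 0"
    and "a \<in> exps J \<delta>"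
  shows "C a = 0"
  using assms(1,3,4)
proof (induction J arbitrary: C a rule: finite_induct)
  case empty
  then show ?case by simp
next
  case (insert j J)
  have inj: "inj_on (\<lambda>(i, b). b(j := i)) ({..\<delta>} \<times> exps J \<delta>)"
    using insert(2) by (auto simp: inj_on_def fun_eq_iff PiE_def extensional_def)
  have fin: "finite (exps J \<delta>)" using insert by (intro finite_PiE) auto
  have key: "(\<Sum>i\<le>\<delta>. (\<Sum>b\<in>exps J \<delta>. C (b(j := i)) * (\<Prod>k\<in>J. y k ^ b k)) * t ^ i) = 0"
    if y: "y \<in> PiE J (\<lambda>_. F)" and t: "t \<in> F" for y t
  proof -
    have "0 = (\<Sum>a\<in>exps (insert j J) \<delta>. C a * (\<Prod>k\<in>insert j J. (y(j := t)) k ^ a k))"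
      by (rule insert(4)[symmetric], rule PiE_fun_upd) (use y t in auto)
    also have "\<dots> = (\<Sum>(i, b)\<in>{..\<delta>} \<times> exps J \<delta>. C (b(j := i)) * (\<Prod>k\<in>insert j J. (y(j := t)) k ^ (b(j := i)) k))"
      unfolding PiE_insert_eq by (subst sum.reindex[OF inj]) (simp add: case_prod_unfold)
    also have "\<dots> = (\<Sum>(i, b)\<in>{..\<delta>} \<times> exps J \<delta>. C (b(j := i)) * (t ^ i * (\<Prod>k\<in>J. y k ^ b k)))"
    proof (intro sum.cong refl, clarify)
      fix i b
      have "(\<Prod>k\<in>J. (y(j := t)) k ^ (b(j := i)) k) = (\<Prod>k\<in>J. y k ^ b k)"
        using insert(2) by (intro prod.cong) auto
      then show "C (b(j := i)) * (\<Prod>k\<in>insert j J. (y(j := t)) k ^ (b(j := i)) k) = C (b(j := i)) * (t ^ i * (\<Prod>k\<in>J. y k ^ b k))"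
        using insert(1,2) by simp
    qed
    also have "\<dots> = (\<Sum>i\<le>\<delta>. (\<Sum>b\<in>exps J \<delta>. C (b(j := i)) * (\<Prod>k\<in>J. y k ^ b k)) * t ^ i)"
      unfolding sum.cartesian_product[symmetric] sum_distrib_right
      by (intro sum.cong refl) (simp add: mult_ac)
    finally show ?thesis by simp
  qed
  have "(\<Sum>b\<in>exps J \<delta>. C (b(j := a j)) * (\<Prod>k\<in>J. y k ^ b k)) = 0" if y: "y \<in> PiE J (\<lambda>_. F)" for y
    by (rule power_sum_vanish[OF assms(2) key[OF y]]) (use insert(5) in \<open>auto dest: PiE_mem\<close>)
  from insert(3)[of "\<lambda>b. C (b(j := a j))" "a(j := undefined)", OF this] 
  have "C ((a(j := undefined))(j := a j)) = 0"
    using fun_upd_in_PiE[OF insert(2,5)] by blast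
  then show ?case by simp
qed

text \<open>
  A relation \<open>P(x\<^sub>i, g) = 0\<close> of degree at most \<open>\<delta>\<close> in \<open>x\<^sub>i\<close> exists by counting coefficients. Its part
  of lowest degree in \<open>g\<close>, restricted to lines through a nonsingular zero \<open>p\<close> of \<open>g\<close>, vanishes
  identically, so the \<open>i\<close>-th coordinate of \<open>p\<close> is a root of a fixed polynomial of degree at most \<open>\<delta>\<close>.
\<close>

lemma nonsingular_zeros_square:
  fixes V :: "'v set" and J :: "'j set"
  assumes V: "finite V" and J: "finite J" "card J = card V"
    and g: "\<And>j. j \<in> J \<Longrightarrow> polyf V d (g j)"
    and \<delta>: "\<delta> = (card V * d + 1) ^ card V" "card F > \<delta>"
    and S: "S \<subseteq> PiE V (\<lambda>_. F)"
    and zero: "\<And>p j. p \<in> S \<Longrightarrow> j \<in> J \<Longrightarrow> g j p = 0"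
    and nonsing: "\<And>p v. p \<in> S \<Longrightarrow> v \<in> PiE V (\<lambda>_. F) \<Longrightarrow> (\<And>j. j \<in> J \<Longrightarrow> lin (g j) p v = 0)
                    \<Longrightarrow> \<forall>i\<in>V. v i = 0"
  shows "card S \<le> \<delta> ^ card V"
proof (rule ccontr)
  define n where "n = card V"
  assume big: "\<not> card S \<le> \<delta> ^ card V"
  have finS: "finite S" using S V by (meson finite_PiE finite_F finite_subset)
  \<comment> \<open>Otherwise S lies in a box with at most \<delta> values per coordinate.\<close>
  have "\<exists>i\<in>V. card ((\<lambda>p. p i) ` S) > \<delta>"
  proof (rule ccontr)
    assume "\<not> (\<exists>i\<in>V. card ((\<lambda>p. p i) ` S) > \<delta>)"
    then have le: "\<And>i. i \<in> V \<Longrightarrow> card ((\<lambda>p. p i) ` S) \<le> \<delta>" by force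
    have "S \<subseteq> PiE V (\<lambda>i. (\<lambda>p. p i) ` S)" using S by (auto simp: PiE_def)
    then have "card S \<le> card (PiE V (\<lambda>i. (\<lambda>p. p i) ` S))"
      using V finS by (intro card_mono finite_PiE) auto
    also have "\<dots> \<le> \<delta> ^ card V"
      using V le prod_mono[of V "\<lambda>i. card ((\<lambda>p. p i) ` S)" "\<lambda>_. \<delta>"] by (simp add: card_PiE)
    finally show False using big by simp
  qed
  then obtain i0 where i0: "i0 \<in> V" "card ((\<lambda>p. p i0) ` S) > \<delta>" by blast

  let ?I = "{..\<delta>} \<times> exps J \<delta>"
  have finE: "finite (exps J \<delta>)" using J by (intro finite_PiE) auto
  then have finI: "finite ?I" by simp
  define \<Theta> where "\<Theta> = (\<lambda>(c :: nat \<times> ('j \<Rightarrow> nat) \<Rightarrow> 'k) x. \<Sum>(i, a)\<in>?I. c (i, a) * (x i0 ^ i * (\<Prod>j\<in>J. g j x ^ a j)))"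
  \<comment> \<open>Degree bound for all products in \<open>\<Theta>\<close>: at most \<delta> from
    the coordinate and at most \<open>d * \<delta>\<close> from each of the n polynomials.\<close>
  define e where "e = \<delta> + n * d * \<delta>"
  have \<Theta>_in: "\<Theta> c \<in> PF V e" if "c \<in> PiE ?I (\<lambda>_. F)" for c
    unfolding \<Theta>_def PF_def mem_Collect_eq case_prod_unfold
  proof (intro polyf_sum polyf_scale)
    fix q assume q: "q \<in> ?I"
    show "c (fst q, snd q) \<in> F" using that q by (auto dest: PiE_mem)
    have "polyf V (fst q * 1) (\<lambda>x. x i0 ^ fst q)" using i0 by (intro polyf_power polyf.var) auto
    then have 1: "polyf V \<delta> (\<lambda>x. x i0 ^ fst q)" using q by (auto elim: polyf_mono)
    have "polyf V (\<Sum>j\<in>J. snd q j * d) (\<lambda>x. \<Prod>j\<in>J. g j x ^ snd q j)"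
      by (intro polyf_prod polyf_power g)
    moreover have "(\<Sum>j\<in>J. snd q j * d) \<le> (\<Sum>j\<in>J. \<delta> * d)"
      using q by (intro sum_mono mult_right_mono) (auto dest: PiE_mem)
    ultimately have 2: "polyf V (n * d * \<delta>) (\<lambda>x. \<Prod>j\<in>J. g j x ^ snd q j)"
      using J by (auto simp: n_def mult_ac elim: polyf_mono)
    show "polyf V e (\<lambda>x. x i0 ^ fst q * (\<Prod>j\<in>J. g j x ^ snd q j))"
      by (rule polyf.mult[OF 1 2]) (simp add: e_def)
  qed
  \<comment> \<open>The origin of \<delta> = (nd + 1)^n: as e + 1 \<le> (nd + 1)(\<delta> + 1), the
    target has at most \<delta>(\<delta> + 1)^n coefficients, fewer than the (\<delta> + 1)^(n + 1)
    of the relation.\<close>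
  have "card (PF V e) < card (PiE ?I (\<lambda>_. F))"
  proof -
    have "(e + 1) ^ n \<le> ((n * d + 1) * (\<delta> + 1)) ^ n"
      by (intro power_mono) (auto simp: e_def algebra_simps)
    also have "\<dots> = \<delta> * (\<delta> + 1) ^ n" unfolding power_mult_distrib using \<delta>(1) by (simp only: n_def)
    also have "\<dots> < (\<delta> + 1) * (\<delta> + 1) ^ n" by simp
    also have "\<dots> = card ?I" using J by (simp add: card_cartesian_product card_PiE n_def)
    finally have lt: "(e + 1) ^ n < card ?I" .
    have "card (PF V e) \<le> card F ^ ((e + 1) ^ n)" using PF_bound[OF V] by (simp add: n_def)
    also have "\<dots> < card F ^ card ?I" using lt card_F_gt_1 by (intro power_strict_increasing) auto
    also have "\<dots> = card (PiE ?I (\<lambda>_. F))" using finI by (subst card_PiE) auto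
    finally show ?thesis .
  qed
  then have "card (\<Theta> ` PiE ?I (\<lambda>_. F)) < card (PiE ?I (\<lambda>_. F))"
    using \<Theta>_in PF_bound(1)[OF V] by (meson card_mono image_subsetI le_less_trans)
  then have "\<not> inj_on \<Theta> (PiE ?I (\<lambda>_. F))" using card_image by fastforce
  then obtain c1 c2 where c12: "c1 \<in> PiE ?I (\<lambda>_. F)" "c2 \<in> PiE ?I (\<lambda>_. F)" "c1 \<noteq> c2" "\<Theta> c1 = \<Theta> c2"
    by (auto simp: inj_on_def)
  \<comment> \<open>Two coefficient families with the same image differ by a nontrivial
    relation.\<close>
  define c where "c = (\<lambda>q. c1 q - c2 q)"
  have c0: "(\<Sum>(i, a)\<in>?I. c (i, a) * (x i0 ^ i * (\<Prod>j\<in>J. g j x ^ a j))) = 0" for x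
    using fun_cong[OF c12(4), of x] by (simp add: \<Theta>_def c_def case_prod_unfold left_diff_distrib sum_subtractf)
  have "\<exists>q\<in>?I. c q \<noteq> 0"
    using c12(1-3) PiE_ext[OF c12(1,2)] by (auto simp: c_def)
  then obtain i1 a1 where q1: "i1 \<le> \<delta>" "a1 \<in> exps J \<delta>" "c (i1, a1) \<noteq> 0" by auto
  define deg where "deg = (\<lambda>a :: 'j \<Rightarrow> nat. \<Sum>j\<in>J. a j)"
  define P where "P = (\<lambda>k. \<exists>(i, a)\<in>?I. c (i, a) \<noteq> 0 \<and> deg a = k)"
  have "P (deg a1)" using q1 by (auto simp: P_def)
  define m where "m = (LEAST k. P k)"
  have "P m" unfolding m_def by (rule LeastI) fact
  then obtain i2 a2 where q2: "i2 \<le> \<delta>" "a2 \<in> exps J \<delta>" "c (i2, a2) \<noteq> 0" "deg a2 = m"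
    by (auto simp: P_def)
  have min: "m \<le> deg a" if "i \<le> \<delta>" "a \<in> exps J \<delta>" "c (i, a) \<noteq> 0" for i a
    unfolding m_def by (rule Least_le) (use that in \<open>auto simp: P_def\<close>)

  have lowest: "(\<Sum>(i, a)\<in>?I. (if deg a = m then c (i, a) else 0) * (p i0 ^ i * (\<Prod>j\<in>J. lin (g j) p v ^ a j))) = 0"
    if p: "p \<in> S" for p v
  proof -
    have pF: "\<And>i. i \<in> V \<Longrightarrow> p i \<in> F" using p S by (auto dest: PiE_mem)
    have "\<forall>j\<in>J. \<exists>\<pi>. (\<forall>\<tau>. g j (\<lambda>i. p i + \<tau> * v i) = poly \<pi> \<tau>) \<and> Polynomial.coeff \<pi> 0 = 0 \<and>
         Polynomial.coeff \<pi> 1 = lin (g j) p v"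
    proof
      fix j assume j: "j \<in> J"
      obtain \<pi> where "\<And>\<tau>. g j (\<lambda>i. p i + \<tau> * v i) = poly \<pi> \<tau>" "Polynomial.coeff \<pi> 0 = g j p"
        "Polynomial.coeff \<pi> 1 = lin (g j) p v"
        by (rule polyf_line[OF V g[OF j], of p v]) (use pF in auto)
      then show "\<exists>\<pi>. (\<forall>\<tau>. g j (\<lambda>i. p i + \<tau> * v i) = poly \<pi> \<tau>) \<and> Polynomial.coeff \<pi> 0 = 0 \<and>
         Polynomial.coeff \<pi> 1 = lin (g j) p v"
        using zero[OF p j] by auto
    qed
    from bchoice[OF this] obtain \<pi> where \<pi>': "\<forall>j\<in>J. (\<forall>\<tau>. g j (\<lambda>i. p i + \<tau> * v i) = poly (\<pi> j) \<tau>) \<and>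
        Polynomial.coeff (\<pi> j) 0 = 0 \<and> Polynomial.coeff (\<pi> j) 1 = lin (g j) p v" by blast
    have \<pi>: "\<And>j \<tau>. j \<in> J \<Longrightarrow> g j (\<lambda>i. p i + \<tau> * v i) = poly (\<pi> j) \<tau>"
      "\<And>j. j \<in> J \<Longrightarrow> Polynomial.coeff (\<pi> j) 0 = 0" "\<And>j. j \<in> J \<Longrightarrow> Polynomial.coeff (\<pi> j) 1 = lin (g j) p v"
      using \<pi>' by blast+
    \<comment> \<open>\<open>poly_shift 1\<close> divides by the line parameter; the constant term
      is zero because p is a zero of every \<open>g j\<close>. The value of
      \<open>\<sigma> j\<close> at 0 is then the directional derivative.\<close>
    define \<sigma> where "\<sigma> j = poly_shift 1 (\<pi> j)" for j
    have \<pi>\<sigma>: "\<pi> j = Polynomial.monom 1 1 * \<sigma> j" if "j \<in> J" for j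
      by (rule poly_eqI) (use \<pi>(2)[OF that] in \<open>auto simp: \<sigma>_def coeff_monom_mult coeff_poly_shift\<close>)
    define A where "A = (\<lambda>i a. [:p i0, v i0:] ^ i * (\<Prod>j\<in>J. \<sigma> j ^ a j))"
    define \<Psi> where "\<Psi> = (\<Sum>(i, a)\<in>?I. Polynomial.smult (c (i, a)) (Polynomial.monom 1 (deg a) * A i a))"
    have "\<Psi> = 0"
    proof (rule poly_fun_unique)
      fix \<tau>
      have "poly (Polynomial.monom 1 (deg a) * A i a) \<tau> = (p i0 + \<tau> * v i0) ^ i * (\<Prod>j\<in>J. g j (\<lambda>i. p i + \<tau> * v i) ^ a j)" for i a
      proof -
        have "(\<Prod>j\<in>J. g j (\<lambda>i. p i + \<tau> * v i) ^ a j) = (\<Prod>j\<in>J. \<tau> ^ a j * poly (\<sigma> j) \<tau> ^ a j)"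
          by (intro prod.cong refl) (simp add: \<pi>(1) \<pi>\<sigma> poly_monom power_mult_distrib)
        also have "\<dots> = \<tau> ^ deg a * (\<Prod>j\<in>J. poly (\<sigma> j) \<tau> ^ a j)"
          by (simp add: prod.distrib power_sum deg_def)
        finally show ?thesis by (simp add: A_def poly_monom poly_prod)
      qed
      then have "poly \<Psi> \<tau> = (\<Sum>(i, a)\<in>?I. c (i, a) * ((p i0 + \<tau> * v i0) ^ i * (\<Prod>j\<in>J. g j (\<lambda>i. p i + \<tau> * v i) ^ a j)))"
        by (simp add: \<Psi>_def poly_sum case_prod_unfold)
      then show "poly \<Psi> \<tau> = poly 0 \<tau>" using c0[of "\<lambda>i. p i + \<tau> * v i"] by simp
    qed
    then have "0 = Polynomial.coeff \<Psi> m" by simp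
    also have "\<dots> = (\<Sum>(i, a)\<in>?I. (if deg a = m then c (i, a) else 0) * (p i0 ^ i * (\<Prod>j\<in>J. lin (g j) p v ^ a j)))"
      unfolding \<Psi>_def coeff_sum
    proof (rule sum.cong[OF refl])
      fix q assume "q \<in> ?I"
      then obtain i a where ia: "q = (i, a)" "i \<in> {..\<delta>}" "a \<in> exps J \<delta>" by blast
      have "Polynomial.coeff (A i a) 0 = p i0 ^ i * (\<Prod>j\<in>J. lin (g j) p v ^ a j)"
      proof -
        have "poly (\<sigma> j) 0 = lin (g j) p v" if "j \<in> J" for j
          using \<pi>(3)[OF that] by (simp add: \<sigma>_def poly_0_coeff_0 coeff_poly_shift)
        then show ?thesis by (simp add: A_def poly_0_coeff_0[symmetric] poly_prod)
      qed
      \<comment> \<open>Terms of degree below m are absent by minimality, and those above m are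
        divisible by a higher power of the parameter, so only degree m contributes.\<close>
      moreover have "c (i, a) = 0" if "deg a < m" using min[of i a] ia that by force
      ultimately show "Polynomial.coeff (case q of (i, a) \<Rightarrow> Polynomial.smult (c (i, a)) (Polynomial.monom 1 (deg a) * A i a)) m =
          (case q of (i, a) \<Rightarrow> (if deg a = m then c (i, a) else 0) * (p i0 ^ i * (\<Prod>j\<in>J. lin (g j) p v ^ a j)))"
        by (auto simp: coeff_monom_mult ia(1))
    qed
    finally show ?thesis by simp
  qed

  have "(\<Sum>i\<le>\<delta>. c (i, a2) * y ^ i) = 0" if "y \<in> (\<lambda>p. p i0) ` S" for y
  proof -
    from that obtain p where p: "p \<in> S" "y = p i0" by blast
    have pF: "\<And>i. i \<in> V \<Longrightarrow> p i \<in> F" using p S by (auto dest: PiE_mem)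
    let ?L = "\<lambda>v. \<lambda>j\<in>J. lin (g j) p v"
    have "\<forall>j\<in>J. \<exists>\<gamma>. (\<forall>i\<in>V. \<gamma> i \<in> F) \<and> (\<forall>v. lin (g j) p v = (\<Sum>i\<in>V. \<gamma> i * v i))"
    proof
      fix j assume j: "j \<in> J"
      obtain \<gamma> where "\<And>i. i \<in> V \<Longrightarrow> \<gamma> i \<in> F" "\<And>v. lin (g j) p v = (\<Sum>i\<in>V. \<gamma> i * v i)"
        by (rule lin_gradient[OF V g[OF j], of p]) (use pF in auto)
      then show "\<exists>\<gamma>. (\<forall>i\<in>V. \<gamma> i \<in> F) \<and> (\<forall>v. lin (g j) p v = (\<Sum>i\<in>V. \<gamma> i * v i))" by blast
    qed
    from bchoice[OF this] obtain \<gamma> where \<gamma>': "\<forall>j\<in>J. (\<forall>i\<in>V. \<gamma> j i \<in> F) \<and> (\<forall>v. lin (g j) p v = (\<Sum>i\<in>V. \<gamma> j i * v i))"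
      by (elim exE)
    have \<gamma>: "i \<in> V \<Longrightarrow> \<gamma> j i \<in> F" "lin (g j) p v = (\<Sum>i\<in>V. \<gamma> j i * v i)" if "j \<in> J" for i j v
      using bspec[OF \<gamma>' that] by (simp_all only:)
    have "?L ` PiE V (\<lambda>_. F) \<subseteq> PiE J (\<lambda>_. F)"
      using \<gamma> by (auto intro!: sum_in mult_in dest: PiE_mem)
    moreover have "inj_on ?L (PiE V (\<lambda>_. F))"
    proof (rule inj_onI)
      fix v w assume vw: "v \<in> PiE V (\<lambda>_. F)" "w \<in> PiE V (\<lambda>_. F)" "?L v = ?L w"
      have l0: "lin (g j) p (\<lambda>i\<in>V. v i - w i) = 0" if "j \<in> J" for j
        using fun_cong[OF vw(3), of j] that by (simp add: \<gamma>(2) right_diff_distrib sum_subtractf)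
      have "(\<lambda>i\<in>V. v i - w i) \<in> PiE V (\<lambda>_. F)" using vw(1,2) by (auto intro!: diff_in dest: PiE_mem)
      from nonsing[OF p(1) this l0] have "\<forall>i\<in>V. (\<lambda>i\<in>V. v i - w i) i = 0" .
      then show "v = w" using vw by (intro PiE_ext[OF vw(1,2)]) auto
    qed
    \<comment> \<open>Nonsingularity makes the linear map injective, and equal dimensions make it
      onto. The derivatives thus take all values in F^J, so the coefficient of each monomial in them
      must vanish.\<close>
    ultimately have surj: "?L ` PiE V (\<lambda>_. F) = PiE J (\<lambda>_. F)"
      using V J by (intro card_subset_eq finite_PiE) (auto simp: card_image card_PiE)
    define C where "C a = (if deg a = m then \<Sum>i\<le>\<delta>. c (i, a) * p i0 ^ i else 0)" for a
    have "C a2 = 0"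
    proof (rule monomial_sum_vanish[OF J(1) \<delta>(2) _ q2(2)])
      fix y assume "y \<in> PiE J (\<lambda>_. F)"
      then obtain v where v: "y = ?L v" using surj by blast
      have "(\<Sum>a\<in>exps J \<delta>. C a * (\<Prod>j\<in>J. y j ^ a j)) =
         (\<Sum>a\<in>exps J \<delta>. \<Sum>i\<le>\<delta>. (if deg a = m then c (i, a) else 0) * (p i0 ^ i * (\<Prod>j\<in>J. lin (g j) p v ^ a j)))"
        unfolding v C_def by (intro sum.cong refl) (auto simp: sum_distrib_right mult_ac)
      also have "\<dots> = 0"
        using lowest[OF p(1), of v] by (subst sum.swap) (simp add: sum.cartesian_product)
      finally show "(\<Sum>a\<in>exps J \<delta>. C a * (\<Prod>j\<in>J. y j ^ a j)) = 0" .
    qed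
    then show ?thesis using q2 p by (simp add: C_def)
  qed
  from power_sum_vanish[OF i0(2) this q2(1)] q2(3) show False by simp
qed

text \<open>Rank-nullity by counting. A further row either vanishes on the present kernel and is
  dropped, or it shrinks the kernel by exactly the factor |F|.\<close>

lemma kernel_rows:
  fixes \<gamma> :: "'j \<Rightarrow> 'v \<Rightarrow> 'k"
  assumes V: "finite V" and "finite J" and \<gamma>: "\<And>i j. j \<in> J \<Longrightarrow> i \<in> V \<Longrightarrow> \<gamma> j i \<in> F"
  defines "K \<equiv> \<lambda>J. {v \<in> PiE V (\<lambda>_. F). \<forall>j\<in>J. (\<Sum>i\<in>V. \<gamma> j i * v i) = 0}"
  shows "\<exists>J'\<subseteq>J. K J' = K J \<and> card (K J') * card F ^ card J' = card F ^ card V"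
  using assms(2) \<gamma>
proof (induction J rule: finite_induct)
  case empty
  then show ?case using V by (auto simp: K_def card_PiE)
next
  case (insert j J)
  then obtain J' where J': "J' \<subseteq> J" "K J' = K J" "card (K J') * card F ^ card J' = card F ^ card V"
    by (metis insertI2)
  let ?l = "\<lambda>v. \<Sum>i\<in>V. \<gamma> j i * v i"
  have KI: "K (insert j A) = {v \<in> K A. ?l v = 0}" for A by (auto simp: K_def)
  have finK: "finite (K A)" for A
    unfolding K_def using V by (intro finite_subset[OF _ finite_PiE[OF V, of "\<lambda>_. F"]]) auto
  show ?case
  proof (cases "\<forall>v\<in>K J'. ?l v = 0")
    case True
    then have "K (insert j J) = K J'" using J' by (auto simp: KI)
    then show ?thesis using J' by (intro exI[of _ J']) auto
  next
    case False
    then obtain u where u: "u \<in> K J'" "?l u \<noteq> 0" by blast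
    have uF: "\<And>i. i \<in> V \<Longrightarrow> u i \<in> F" using u by (auto simp: K_def dest: PiE_mem)
    have luF: "?l u \<in> F" using uF insert(4) by (intro sum_in) auto
    let ?sh = "\<lambda>(v :: 'v \<Rightarrow> 'k) t. \<lambda>i\<in>V. v i + t * u i"
    have lsh: "(\<Sum>i\<in>V. \<beta> i * ?sh v t i) = (\<Sum>i\<in>V. \<beta> i * v i) + t * (\<Sum>i\<in>V. \<beta> i * u i)" for \<beta> v t
      by (simp add: ring_distribs sum.distrib sum_distrib_left mult_ac)
    have shK: "?sh v t \<in> K J'" if "v \<in> K J'" "t \<in> F" for v t
    proof -
      have "?sh v t \<in> PiE V (\<lambda>_. F)" using that uF by (auto simp: K_def dest: PiE_mem)
      moreover have "\<forall>j\<in>J'. (\<Sum>i\<in>V. \<gamma> j i * ?sh v t i) = 0"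
        using that u unfolding lsh by (auto simp: K_def)
      ultimately show ?thesis by (simp add: K_def)
    qed
    \<comment> \<open>Every vector of the old kernel is uniquely a vector of the new kernel plus a
      multiple of u; the inverse subtracts the multiple of u that accounts for the value of the new
      row.\<close>
    have "bij_betw (\<lambda>(v, t). ?sh v t) (K (insert j J') \<times> F) (K J')"
    proof (rule bij_betwI[where g = "\<lambda>v. (?sh v (- ?l v / ?l u), ?l v / ?l u)"])
      show "(\<lambda>(v, t). ?sh v t) \<in> K (insert j J') \<times> F \<rightarrow> K J'"
        using shK by (auto simp: KI)
      have lF: "?l v \<in> F" if "v \<in> K J'" for v
        using that insert(4) by (intro sum_in mult_in) (auto simp: K_def dest: PiE_mem)
      show "(\<lambda>v. (?sh v (- ?l v / ?l u), ?l v / ?l u)) \<in> K J' \<rightarrow> K (insert j J') \<times> F"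
      proof
        fix v assume v: "v \<in> K J'"
        have "- ?l v / ?l u \<in> F" using lF[OF v] luF by simp
        moreover have "?l (?sh v (- ?l v / ?l u)) = 0"
          unfolding lsh using u(2) by simp
        ultimately show "(?sh v (- ?l v / ?l u), ?l v / ?l u) \<in> K (insert j J') \<times> F"
          using shK[OF v, of "- ?l v / ?l u"] lF[OF v] luF
          unfolding KI mem_Times_iff mem_Collect_eq fst_conv snd_conv by (metis divide_in)
      qed
      show "(\<lambda>v. (?sh v (- ?l v / ?l u), ?l v / ?l u)) ((\<lambda>(v, t). ?sh v t) x) = x"
        if "x \<in> K (insert j J') \<times> F" for x
      proof -
        obtain v t where x: "x = (v, t)" "v \<in> K J'" "?l v = 0" using \<open>x \<in> _\<close> by (auto simp: KI)
        have "?l (?sh v t) = t * ?l u" using lsh[of "\<gamma> j"] x by simp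
        moreover have "?sh (?sh v t) (- t) = v"
          using x(2) by (auto simp: fun_eq_iff K_def PiE_def extensional_def)
        ultimately show ?thesis using u(2) x by simp
      qed
      show "(\<lambda>(v, t). ?sh v t) (?sh y (- ?l y / ?l u), ?l y / ?l u) = y" if "y \<in> K J'" for y
        using that by (auto simp: fun_eq_iff K_def PiE_def extensional_def)
    qed
    from bij_betw_same_card[OF this] have card: "card (K J') = card (K (insert j J')) * card F"
      by (simp only: card_cartesian_product)
    have "j \<notin> J'" using insert J' by auto
    moreover have "finite J'" using J' insert by (auto intro: finite_subset)
    ultimately have "card (K (insert j J')) * card F ^ card (insert j J') = card F ^ card V"
      using card J'(3) by (simp add: mult_ac)
    moreover have "K (insert j J') = K (insert j J)" using J' by (simp add: KI)
    ultimately show ?thesis using J' by (intro exI[of _ "insert j J'"]) auto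
  qed
qed

text \<open>At a nonsingular zero of an overdetermined system, some \<open>card V\<close> of the
  equations already have trivial common kernel, so the zero is nonsingular for a square subsystem.
  The factor \<open>2 ^ card J\<close> counts the possible subsystems.\<close>

lemma nonsingular_zeros:
  fixes V :: "'v set" and J :: "'j set"
  assumes V: "finite V" and J: "finite J"
    and g: "\<And>j. j \<in> J \<Longrightarrow> polyf V d (g j)"
    and \<delta>: "\<delta> = (card V * d + 1) ^ card V" "card F > \<delta>"
    and S: "S \<subseteq> PiE V (\<lambda>_. F)"
    and zero: "\<And>p j. p \<in> S \<Longrightarrow> j \<in> J \<Longrightarrow> g j p = 0"
    and nonsing: "\<And>p v. p \<in> S \<Longrightarrow> v \<in> PiE V (\<lambda>_. F) \<Longrightarrow> (\<And>j. j \<in> J \<Longrightarrow> lin (g j) p v = 0)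
                    \<Longrightarrow> \<forall>i\<in>V. v i = 0"
  shows "card S \<le> 2 ^ card J * \<delta> ^ card V"
proof -
  define SS where "SS J' = {p \<in> S. \<forall>v \<in> PiE V (\<lambda>_. F). (\<forall>j\<in>J'. lin (g j) p v = 0) \<longrightarrow> (\<forall>i\<in>V. v i = 0)}" for J'
  define JJ where "JJ = {J'. J' \<subseteq> J \<and> card J' = card V}"
  have finJJ: "finite JJ" "card JJ \<le> 2 ^ card J"
    using J card_mono[of "Pow J" JJ] by (auto simp: JJ_def card_Pow)
  have cov: "S \<subseteq> (\<Union>J'\<in>JJ. SS J')"
  proof
    fix p assume p: "p \<in> S"
    have pF: "\<And>i. i \<in> V \<Longrightarrow> p i \<in> F" using p S by (auto dest: PiE_mem)
    have "\<forall>j\<in>J. \<exists>\<gamma>. (\<forall>i\<in>V. \<gamma> i \<in> F) \<and> (\<forall>v. lin (g j) p v = (\<Sum>i\<in>V. \<gamma> i * v i))"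
    proof
      fix j assume j: "j \<in> J"
      obtain \<gamma> where "\<And>i. i \<in> V \<Longrightarrow> \<gamma> i \<in> F" "\<And>v. lin (g j) p v = (\<Sum>i\<in>V. \<gamma> i * v i)"
        by (rule lin_gradient[OF V g[OF j], of p]) (use pF in auto)
      then show "\<exists>\<gamma>. (\<forall>i\<in>V. \<gamma> i \<in> F) \<and> (\<forall>v. lin (g j) p v = (\<Sum>i\<in>V. \<gamma> i * v i))" by blast
    qed
    from bchoice[OF this] obtain \<gamma> where \<gamma>': "\<forall>j\<in>J. (\<forall>i\<in>V. \<gamma> j i \<in> F) \<and> (\<forall>v. lin (g j) p v = (\<Sum>i\<in>V. \<gamma> j i * v i))"
      by (elim exE)
    have \<gamma>: "i \<in> V \<Longrightarrow> \<gamma> j i \<in> F" "lin (g j) p v = (\<Sum>i\<in>V. \<gamma> j i * v i)" if "j \<in> J" for i j v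
      using bspec[OF \<gamma>' that] by (simp_all only:)
    define K where "K = (\<lambda>J. {v \<in> PiE V (\<lambda>_. F). \<forall>j\<in>J. (\<Sum>i\<in>V. \<gamma> j i * v i) = 0})"
    have "\<exists>J'\<subseteq>J. K J' = K J \<and> card (K J') * card F ^ card J' = card F ^ card V"
      unfolding K_def by (rule kernel_rows[OF V J]) (use \<gamma>(1) in auto)
    then obtain J' where J': "J' \<subseteq> J" "K J' = K J" "card (K J') * card F ^ card J' = card F ^ card V"
      by blast
    have KJ: "v = (\<lambda>i\<in>V. 0)" if "v \<in> K J" for v
    proof -
      have v: "v \<in> PiE V (\<lambda>_. F)" using that by (simp add: K_def)
      have "\<forall>i\<in>V. v i = 0"
        by (rule nonsing[OF p v]) (use that \<gamma>(2) in \<open>simp add: K_def\<close>)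
      then show ?thesis by (intro PiE_ext[OF v, of "\<lambda>i\<in>V. 0"]) auto
    qed
    moreover have "(\<lambda>i\<in>V. 0) \<in> K J" by (auto simp: K_def)
    ultimately have "K J = {\<lambda>i\<in>V. 0}" by blast
    \<comment> \<open>The kernel has a single element, so the counting identity compares two powers
      of |F|.\<close>
    then have "card J' = card V" using J'(2,3) card_F_gt_1 by (simp add: power_inject_exp)
    moreover have "p \<in> SS J'"
    proof -
      have "\<forall>i\<in>V. v i = 0" if "v \<in> PiE V (\<lambda>_. F)" "\<forall>j\<in>J'. lin (g j) p v = 0" for v
      proof -
        have "(\<Sum>i\<in>V. \<gamma> j i * v i) = 0" if "j \<in> J'" for j
          using \<gamma>(2)[of j v] \<open>\<forall>j\<in>J'. lin (g j) p v = 0\<close> that J'(1) by auto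
        then have "v \<in> K J'" using that(1) by (simp add: K_def)
        then have "v = (\<lambda>i\<in>V. 0)" using KJ J'(2) by blast
        then show ?thesis by simp
      qed
      then show ?thesis using p by (simp add: SS_def)
    qed
    ultimately show "p \<in> (\<Union>J'\<in>JJ. SS J')" using J'(1) by (auto simp: JJ_def)
  qed
  have SSb: "card (SS J') \<le> \<delta> ^ card V" if "J' \<in> JJ" for J'
  proof (rule nonsingular_zeros_square[OF V _ _ _ \<delta>, of J' g])
    show "finite J'" using that J by (auto simp: JJ_def intro: finite_subset)
    show "card J' = card V" using that by (simp add: JJ_def)
  qed (use that g zero S in \<open>auto simp: JJ_def SS_def\<close>)
  have finS: "finite S" using S V by (meson finite_PiE finite_F finite_subset)
  have "card S \<le> card (\<Union>J'\<in>JJ. SS J')"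
    using cov finJJ finS by (intro card_mono) (auto simp: SS_def)
  also have "\<dots> \<le> (\<Sum>J'\<in>JJ. card (SS J'))" by (rule card_UN_le[OF finJJ(1)])
  also have "\<dots> \<le> (\<Sum>J'\<in>JJ. \<delta> ^ card V)" by (intro sum_mono SSb)
  also have "\<dots> \<le> 2 ^ card J * \<delta> ^ card V" using finJJ(2) by simp
  finally show ?thesis .
qed

end

section \<open>Values and derivatives of random polynomials\<close>

context finite_subfield
begin

text \<open>Hermite interpolation with one direction per point. \<open>L a\<close> is a product of
  squares, so its value and derivative vanish at all other points; the linear factor
  \<open>M a\<close> then adjusts value and derivative at its own point.\<close>

lemma interpolation:
  fixes W :: "'w set" and A :: "'a set" and P v :: "'a \<Rightarrow> 'w \<Rightarrow> 'k"
  assumes W: "finite W" and A: "finite A" and B: "B \<subseteq> A" and d: "d \<ge> 2 * card A"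
    and P: "\<And>a w. a \<in> A \<Longrightarrow> w \<in> W \<Longrightarrow> P a w \<in> F"
    and v: "\<And>a w. a \<in> B \<Longrightarrow> w \<in> W \<Longrightarrow> v a w \<in> F"
    and dist: "\<And>a b. a \<in> A \<Longrightarrow> b \<in> A \<Longrightarrow> a \<noteq> b \<Longrightarrow> \<exists>w\<in>W. P a w \<noteq> P b w"
    and nz: "\<And>a. a \<in> B \<Longrightarrow> \<exists>w\<in>W. v a w \<noteq> 0"
    and t: "\<And>a. a \<in> A \<Longrightarrow> t a \<in> F" and u: "\<And>a. a \<in> B \<Longrightarrow> u a \<in> F"
  shows "\<exists>g. polyf W d g \<and> (\<forall>a\<in>A. g (P a) = t a) \<and> (\<forall>a\<in>B. lin g (P a) (v a) = u a)"
proof -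
  have "\<exists>L. polyf W (2 * (card A - 1)) L \<and> L (P a) = 1 \<and> (\<forall>b\<in>A - {a}. L (P b) = 0 \<and> lin L (P b) (v b) = 0)"
    if a: "a \<in> A" for a
  proof -
    have "\<forall>b\<in>A - {a}. \<exists>w\<in>W. P a w \<noteq> P b w" using dist a by auto
    then obtain \<omega> where \<omega>: "\<And>b. b \<in> A - {a} \<Longrightarrow> \<omega> b \<in> W \<and> P a (\<omega> b) \<noteq> P b (\<omega> b)"
      by metis
    \<comment> \<open>An affine function of a separating coordinate with value 1 at
      \<open>P a\<close> and 0 at \<open>P b\<close>.\<close>
    define \<mu> where "\<mu> b = (\<lambda>x :: 'w \<Rightarrow> 'k. (x (\<omega> b) - P b (\<omega> b)) * (1 / (P a (\<omega> b) - P b (\<omega> b))))" for b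
    have pl: "polyf W 1 (\<mu> b)" if b: "b \<in> A - {a}" for b
      unfolding \<mu>_def
      by (rule polyf.mult[where d = 1 and e = 0, OF polyf_diff[OF polyf.var polyf.const] polyf.const])
         (use \<omega>[OF b] P a b in auto)
    define L where "L = (\<lambda>x. \<Prod>b\<in>A - {a}. \<mu> b x ^ 2)"
    have "polyf W (\<Sum>b\<in>A - {a}. 2 * 1) L"
      unfolding L_def by (intro polyf_prod polyf_power pl)
    then have 1: "polyf W (2 * (card A - 1)) L" using a A by (simp add: mult.commute)
    have 2: "L (P a) = 1"
      unfolding L_def \<mu>_def using \<omega> by (intro prod.neutral) auto
    have 3: "L (P b) = 0 \<and> lin L (P b) (v b) = 0" if b: "b \<in> A - {a}" for b
    proof -
      define R where "R = (\<lambda>x. \<mu> b x * (\<Prod>b\<in>A - {a} - {b}. \<mu> b x ^ 2))"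
      have "L x = \<mu> b x * R x" for x
        unfolding L_def R_def using A b by (subst prod.remove[of _ b]) (auto simp: power2_eq_square)
      then have L: "L = (\<lambda>x. \<mu> b x * R x)" by auto
      have "polyf W (\<Sum>b\<in>A - {a} - {b}. 2 * 1) (\<lambda>x. \<Prod>b\<in>A - {a} - {b}. \<mu> b x ^ 2)"
        by (intro polyf_prod polyf_power pl) auto
      from polyf.mult[OF pl[OF b] this order_refl]
      have R: "polyf W (1 + (\<Sum>b\<in>A - {a} - {b}. 2 * 1)) R" by (simp add: R_def)
      have z: "\<mu> b (P b) = 0" by (simp add: \<mu>_def)
      then have Rz: "R (P b) = 0" by (simp add: R_def)
      have "lin L (P b) (v b) = 0"
        unfolding L by (subst lin_mult[OF W pl[OF b] R]) (use z Rz P b in auto)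
      then show ?thesis using z by (simp add: L)
    qed
    from 1 2 3 show ?thesis by blast
  qed
  then have "\<forall>a\<in>A. \<exists>L. polyf W (2 * (card A - 1)) L \<and> L (P a) = 1 \<and> (\<forall>b\<in>A - {a}. L (P b) = 0 \<and> lin L (P b) (v b) = 0)"
    by blast
  from bchoice[OF this] obtain L where L': "\<forall>a\<in>A. polyf W (2 * (card A - 1)) (L a) \<and> L a (P a) = 1 \<and>
      (\<forall>b\<in>A - {a}. L a (P b) = 0 \<and> lin (L a) (P b) (v b) = 0)" by (elim exE)
  have L: "polyf W (2 * (card A - 1)) (L a)" "L a (P a) = 1"
    "b \<in> A - {a} \<Longrightarrow> L a (P b) = 0 \<and> lin (L a) (P b) (v b) = 0" if "a \<in> A" for a b
    using bspec[OF L' that] by (simp_all only:)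
  have "\<forall>a\<in>B. \<exists>w\<in>W. v a w \<noteq> 0" using nz by blast
  then obtain \<omega> where \<omega>: "\<And>a. a \<in> B \<Longrightarrow> \<omega> a \<in> W \<and> v a (\<omega> a) \<noteq> 0" by metis
  \<comment> \<open>The slope solves the product rule for \<open>L a * M a\<close>; the derivative
    of \<open>L a\<close> at its own point is not normalised and has to be subtracted.\<close>
  define \<eta> where "\<eta> a = (if a \<in> B then (u a - t a * lin (L a) (P a) (v a)) / v a (\<omega> a) else 0)" for a
  define M where "M a = (\<lambda>x :: 'w \<Rightarrow> 'k. t a + (if a \<in> B then \<eta> a * (x (\<omega> a) - P a (\<omega> a)) else 0))" for a
  have linL: "lin (L a) (P a) (v a) \<in> F" if a: "a \<in> B" for a
  proof -
    have a': "a \<in> A" using a B by auto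
    obtain \<gamma> where \<gamma>: "\<And>i. i \<in> W \<Longrightarrow> \<gamma> i \<in> F" "\<And>w. lin (L a) (P a) w = (\<Sum>i\<in>W. \<gamma> i * w i)"
      by (rule lin_gradient[OF W L(1)[OF a'], of "P a"]) (use P a' in auto)
    show ?thesis unfolding \<gamma>(2) by (intro sum_in mult_in \<gamma>(1) v[OF a]) auto
  qed
  have M: "polyf W 1 (M a)" if a: "a \<in> A" for a
  proof (cases "a \<in> B")
    case True
    have "\<eta> a \<in> F" using linL[OF True] t[OF a] u[OF True] v[OF True] \<omega>[OF True] True by (auto simp: \<eta>_def)
    then have "polyf W 1 (\<lambda>x. t a + \<eta> a * (x (\<omega> a) - P a (\<omega> a)))"
      using \<omega>[OF True] P[OF a] t[OF a]
      by (intro polyf.add polyf.const polyf_scale polyf_diff polyf.var) auto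
    then show ?thesis using True by (simp add: M_def)
  next
    case False
    then show ?thesis using t[OF a] by (auto simp: M_def intro: polyf.const)
  qed
  have MP: "M a (P a) = t a" for a by (simp add: M_def)
  have linM: "lin (M a) (P a) (v a) = \<eta> a * v a (\<omega> a)" if "a \<in> B" for a
    by (subst dline_eq[of _ "[:t a, \<eta> a * v a (\<omega> a):]"]) (use that in \<open>auto simp: M_def\<close>)
  define g where "g = (\<lambda>x. \<Sum>a\<in>A. L a x * M a x)"
  have LM: "polyf W d (\<lambda>x. L a x * M a x)" if "a \<in> A" for a
  proof (rule polyf.mult[OF L(1)[OF that] M[OF that]])
    have "card A > 0" using that A card_gt_0_iff by blast
    then show "2 * (card A - 1) + 1 \<le> d" using d by linarith
  qed
  have linsum: "lin (\<lambda>x. \<Sum>a\<in>C. L a x * M a x) (P b) w = (\<Sum>a\<in>C. lin (\<lambda>x. L a x * M a x) (P b) w)"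
    if "C \<subseteq> A" "b \<in> A" for C b w
    using finite_subset[OF that(1) A] that(1)
  proof (induction C rule: finite_induct)
    case empty
    then show ?case by (simp add: lin_const)
  next
    case (insert c C)
    have "lin (\<lambda>x. L c x * M c x + (\<Sum>a\<in>C. L a x * M a x)) (P b) w =
      lin (\<lambda>x. L c x * M c x) (P b) w + lin (\<lambda>x. \<Sum>a\<in>C. L a x * M a x) (P b) w"
      by (rule lin_add[OF W LM polyf_sum[OF LM]]) (use insert P that in auto)
    then show ?case using insert by simp
  qed
  have "polyf W d g" unfolding g_def by (intro polyf_sum LM)
  moreover have "g (P b) = t b" if b: "b \<in> A" for b
  proof -
    have "g (P b) = (\<Sum>a\<in>A. if a = b then t b else 0)"
      unfolding g_def using L(2,3) b MP by (intro sum.cong) auto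
    then show ?thesis using b A by simp
  qed
  moreover have "lin g (P b) (v b) = u b" if b: "b \<in> B" for b
  proof -
    have bA: "b \<in> A" using b B by auto
    have "lin (\<lambda>x. L a x * M a x) (P b) (v b) = (if a = b then u b else 0)" if a: "a \<in> A" for a
    proof -
      have "lin (\<lambda>x. L a x * M a x) (P b) (v b) = L a (P b) * lin (M a) (P b) (v b) + M a (P b) * lin (L a) (P b) (v b)"
        by (rule lin_mult[OF W L(1)[OF a] M[OF a]]) (use P bA in auto)
      also have "\<dots> = (if a = b then u b else 0)"
        using L(3)[OF a, of b] bA L(2)[OF bA] MP linM[OF b] \<omega>[OF b] b by (auto simp: \<eta>_def)
      finally show ?thesis .
    qed
    then have "lin g (P b) (v b) = (\<Sum>a\<in>A. if a = b then u b else 0)"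
      unfolding g_def using linsum[OF order_refl bA] by simp
    then show ?thesis using bA A by simp
  qed
  ultimately show ?thesis by blast
qed

text \<open>
  The values and directional derivatives of a uniformly random polynomial are thus independent and
  uniform.
\<close>

lemma card_constrained:
  fixes W :: "'w set" and A :: "'a set" and P v :: "'a \<Rightarrow> 'w \<Rightarrow> 'k"
  assumes W: "finite W" and A: "finite A" and B: "B \<subseteq> A" and d: "d \<ge> 2 * card A"
    and P: "\<And>a w. a \<in> A \<Longrightarrow> w \<in> W \<Longrightarrow> P a w \<in> F"
    and v: "\<And>a w. a \<in> B \<Longrightarrow> w \<in> W \<Longrightarrow> v a w \<in> F"
    and dist: "\<And>a b. a \<in> A \<Longrightarrow> b \<in> A \<Longrightarrow> a \<noteq> b \<Longrightarrow> \<exists>w\<in>W. P a w \<noteq> P b w"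
    and nz: "\<And>a. a \<in> B \<Longrightarrow> \<exists>w\<in>W. v a w \<noteq> 0"
    and z: "\<And>a. a \<in> A \<Longrightarrow> z a \<in> F"
  shows "card {g \<in> PF W d. (\<forall>a\<in>A. g (P a) = z a) \<and> (\<forall>a\<in>B. lin g (P a) (v a) = 0)}
           * card F ^ (card A + card B) = card (PF W d)"
proof -
  let ?T = "PiE A (\<lambda>_. F) \<times> PiE B (\<lambda>_. F)"
  let ?Z = "{g \<in> PF W d. (\<forall>a\<in>A. g (P a) = z a) \<and> (\<forall>a\<in>B. lin g (P a) (v a) = 0)}"
  have finB: "finite B" using A B finite_subset by blast
  have "\<forall>q\<in>?T. \<exists>g. polyf W d g \<and> (\<forall>a\<in>A. g (P a) = fst q a) \<and> (\<forall>a\<in>B. lin g (P a) (v a) = snd q a)"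
  proof
    fix q assume "q \<in> ?T"
    then have q: "\<And>a. a \<in> A \<Longrightarrow> fst q a \<in> F" "\<And>a. a \<in> B \<Longrightarrow> snd q a \<in> F" by (auto dest: PiE_mem)
    show "\<exists>g. polyf W d g \<and> (\<forall>a\<in>A. g (P a) = fst q a) \<and> (\<forall>a\<in>B. lin g (P a) (v a) = snd q a)"
      by (rule interpolation[OF W A B d P v dist nz q])
  qed
  from bchoice[OF this] obtain h where h': "\<forall>q\<in>?T. polyf W d (h q) \<and> (\<forall>a\<in>A. h q (P a) = fst q a) \<and>
     (\<forall>a\<in>B. lin (h q) (P a) (v a) = snd q a)" by (elim exE)
  have h: "polyf W d (h q)"
    "a \<in> A \<Longrightarrow> h q (P a) = fst q a"
    "a \<in> B \<Longrightarrow> lin (h q) (P a) (v a) = snd q a" if "q \<in> ?T" for q a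
    using bspec[OF h' that] by (simp_all only:)
  have lin_sum: "lin (\<lambda>x. g x + g' x) (P a) (v a) = lin g (P a) (v a) + lin g' (P a) (v a)"
    if "polyf W d g" "polyf W d g'" "a \<in> B" for g g' a
    by (rule lin_add[OF W that(1,2)]) (use P B that in auto)
  \<comment> \<open>Each polynomial function is uniquely a constrained one plus the chosen
    interpolant of its deviations, so all classes have the same size.\<close>
  have "bij_betw (\<lambda>(g, q). \<lambda>x. g x + h q x) (?Z \<times> ?T) (PF W d)"
    unfolding bij_betw_def
  proof (intro conjI equalityI subsetI)
    show "inj_on (\<lambda>(g, q). \<lambda>x. g x + h q x) (?Z \<times> ?T)"
    proof (rule inj_onI)
      fix r r' assume r: "r \<in> ?Z \<times> ?T" "r' \<in> ?Z \<times> ?T"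
        "(\<lambda>(g, q). \<lambda>x. g x + h q x) r = (\<lambda>(g, q). \<lambda>x. g x + h q x) r'"
      obtain g q where gq: "r = (g, q)" by (cases r)
      obtain g' q' where gq': "r' = (g', q')" by (cases r')
      have eq: "(\<lambda>x. g x + h q x) = (\<lambda>x. g' x + h q' x)" using r gq gq' by simp
      have Z: "g \<in> ?Z" "g' \<in> ?Z" "q \<in> ?T" "q' \<in> ?T" using r gq gq' by auto
      have "fst q a = fst q' a" if "a \<in> A" for a
        using fun_cong[OF eq, of "P a"] h(2) Z that by simp
      then have 1: "fst q = fst q'" using Z by (intro PiE_ext[of _ A "\<lambda>_. F"]) auto
      have "snd q a = snd q' a" if "a \<in> B" for a
      proof -
        have "lin g (P a) (v a) + lin (h q) (P a) (v a) = lin g' (P a) (v a) + lin (h q') (P a) (v a)"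
          using lin_sum[of g "h q" a] lin_sum[of g' "h q'" a] Z h(1) that eq by (simp add: PF_def fun_eq_iff)
        then show ?thesis using Z h(3) that by simp
      qed
      then have 2: "snd q = snd q'" using Z by (intro PiE_ext[of _ B "\<lambda>_. F"]) auto
      have "q = q'" using 1 2 by (simp add: prod_eq_iff)
      moreover from this have "g = g'" using eq by (simp add: fun_eq_iff)
      ultimately show "r = r'" using gq gq' by simp
    qed
  next
    fix g assume "g \<in> (\<lambda>(g, q). \<lambda>x. g x + h q x) ` (?Z \<times> ?T)"
    then show "g \<in> PF W d" using h(1) by (auto simp: PF_def intro: polyf.add)
  next
    fix g assume "g \<in> PF W d"
    then have g: "polyf W d g" by (simp add: PF_def)
    define q where "q = (\<lambda>a\<in>A. g (P a) - z a, \<lambda>a\<in>B. lin g (P a) (v a))"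
    have "lin g (P a) (v a) \<in> F" if a: "a \<in> B" for a
    proof -
      obtain \<gamma> where \<gamma>: "\<And>i. i \<in> W \<Longrightarrow> \<gamma> i \<in> F" "\<And>w. lin g (P a) w = (\<Sum>i\<in>W. \<gamma> i * w i)"
        by (rule lin_gradient[OF W g, of "P a"]) (use P a B in auto)
      show ?thesis unfolding \<gamma>(2) by (intro sum_in mult_in \<gamma>(1) v[OF a]) auto
    qed
    moreover have "g (P a) \<in> F" if "a \<in> A" for a by (rule polyf_in[OF g]) (use P that in auto)
    ultimately have q: "q \<in> ?T" using z by (auto simp: q_def)
    define g' where "g' = (\<lambda>x. g x - h q x)"
    have g': "polyf W d g'" unfolding g'_def by (intro polyf_diff g h(1) q)
    have "lin g' (P a) (v a) = 0" if a: "a \<in> B" for a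
      using lin_sum[OF g' h(1)[OF q] a] h(3)[OF q a] a by (simp add: g'_def q_def)
    then have "g' \<in> ?Z" using g' h(2)[OF q] by (auto simp: PF_def g'_def q_def)
    then have "(\<lambda>(g, q). \<lambda>x. g x + h q x) (g', q) \<in> (\<lambda>(g, q). \<lambda>x. g x + h q x) ` (?Z \<times> ?T)"
      using q by blast
    then show "g \<in> (\<lambda>(g, q). \<lambda>x. g x + h q x) ` (?Z \<times> ?T)" by (simp add: g'_def)
  qed
  from bij_betw_same_card[OF this] show ?thesis
    using A finB by (simp add: card_cartesian_product card_PiE power_add)
qed

end

section \<open>Balance of the subdivided star\<close>

text \<open>
  The spider is \<open>K\<^sub>s\<^sub>,\<^sub>1\<close> with every edge subdivided into a path of length \<open>2k + 1\<close>: \<open>(i, p)\<close> is the \<open>p\<close>-th vertex of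
  the \<open>i\<close>-th path, \<open>(i, 0)\<close> are the fixed roots, and all paths share the centre \<open>(0, 2k + 1)\<close>.
  Vertices of \<open>M\<close> and \<open>N\<close> are points of dimension \<open>dm = \<alpha>\<ell>\<close> and \<open>dn = \<ell>\<close>, and an edge imposes \<open>r\<close> equations.
  In \<open>side c p\<close>, \<open>c\<close> tells whether the roots lie in \<open>M\<close>; the value tells whether position \<open>p\<close> does.
\<close>

locale spider =
  fixes k s a b :: nat
  assumes s: "s \<ge> 1" and a: "a \<ge> 1" and ba: "b \<le> a" and ratio: "a * (k * s + 1) \<le> b * ((k + 1) * s)"
begin

definition dm :: nat where "dm = (2 * k + 1) * s * b"
definition dn :: nat where "dn = (2 * k + 1) * s * a"
text \<open>This is k(dm + dn)/(2k + 1) + dn/((2k + 1)s), so q^(dm + dn - r) is the required order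
  of the number of edges, and (2k + 1)s r = sk(dm + dn) + dn is the number of free coordinates of a
  spider with centre in N.\<close>

definition r :: nat where "r = k * s * (a + b) + a"
definition dimn :: "bool \<Rightarrow> nat" where "dimn c = (if c then dm else dn)"
definition side :: "bool \<Rightarrow> nat \<Rightarrow> bool" where "side o' p \<longleftrightarrow> (even p \<longleftrightarrow> o')"
definition inner :: "(nat \<times> nat) set" where
  "inner = ({..<s} \<times> {1..2 * k}) \<union> {(0, 2 * k + 1)}"
definition spider_edges :: "(nat \<times> nat) set" where "spider_edges = {..<s} \<times> {..<2 * k + 1}"
definition node :: "nat \<Rightarrow> nat \<Rightarrow> nat \<times> nat" where "node i p = (if p = 2 * k + 1 then 0 else i, p)"
definition touch :: "(nat \<times> nat) set \<Rightarrow> (nat \<times> nat) set" where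
  "touch S = {(i, p) \<in> spider_edges. node i p \<in> S \<or> node i (Suc p) \<in> S}"

text \<open>The condition \<open>ratio\<close>, that is, the lower bound on \<alpha>, in the form in
  which it enters the balance argument.\<close>

lemma r_le_dm: "r \<le> dm"
  using ratio by (simp add: r_def dm_def algebra_simps)

lemma dm_le_dn: "dm \<le> dn"
  using ba by (simp add: dm_def dn_def)

text \<open>One leg of the spider. All s legs share the centre, so each is charged a fraction 1/s of
  its dimension; multiplying by s keeps the inequality integral.\<close>

lemma path_balanced:
  assumes "\<not> U 0"
  shows "int s * (\<Sum>p\<in>{p\<in>{1..2 * k}. U p}. int (dimn (side c p))) + (if U (2 * k + 1) then int (dimn (side c (2 * k + 1))) else 0)
     \<le> int s * (int r * int (card {p. p < 2 * k + 1 \<and> (U p \<or> U (Suc p))}))"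
proof -
  define w where "w p = int (dimn (side c p))" for p
  \<comment> \<open>This equals dm + dn - 2r, the loss when two consecutive positions are chosen
    against two edges.\<close>
  define \<gamma> where "\<gamma> = int s * (int a + int b) - 2 * int a"
  have rw: "int r \<le> w p" for p using r_le_dm dm_le_dn by (simp add: w_def dimn_def)
  have wdn: "w p \<le> int dn" for p using dm_le_dn by (simp add: w_def dimn_def)
  have ww: "w p + w (Suc p) = 2 * int r + \<gamma>" for p
  proof -
    have "w p + w (Suc p) = int dm + int dn" by (auto simp: w_def dimn_def side_def)
    also have "\<dots> = 2 * int r + \<gamma>" by (simp add: dm_def dn_def r_def \<gamma>_def algebra_simps)
    finally show ?thesis .
  qed
  have \<gamma>0: "\<gamma> \<ge> 0"
    using ww[of 0] rw[of 0] rw[of 1] by simp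
  \<comment> \<open>After k losses of \<gamma>, this much of r is left on each leg. Over s legs it
    is exactly dn, the dimension of a centre in N: the tight case.\<close>
  have rk: "int r - \<gamma> * int k = (2 * int k + 1) * int a"
    by (simp add: r_def \<gamma>_def algebra_simps)
  have \<gamma>m: "\<gamma> * int m \<le> \<gamma> * int k" if "m \<le> k" for m
    using that \<gamma>0 by (intro mult_left_mono) auto
  \<comment> \<open>For a run of chosen positions that ends at position 2m + 1: the two edges around
    it supply 2r, and what \<open>w p\<close> leaves covers the losses of m earlier pairs.\<close>
  have close_odd: "2 * int r - w p \<ge> \<gamma> * int m" if "Suc m \<le> k" for m p
  proof -
    have "\<gamma> * int (Suc m) \<le> \<gamma> * int k" by (rule \<gamma>m[OF that])
    then have m: "\<gamma> * int m \<le> \<gamma> * int k - \<gamma>" by (simp add: algebra_simps)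
    have "2 * int r + \<gamma> = int dm + int dn" using ww[of 0] by (cases c) (simp_all add: w_def dimn_def side_def)
    then have "2 * int r - w p \<ge> int dm - \<gamma>" using wdn[of p] by linarith
    moreover have "int dm \<ge> int r" using r_le_dm by simp
    moreover have "int r \<ge> \<gamma> * int k" using rk by (smt (verit) mult_nonneg_nonneg of_nat_0_le_iff)
    ultimately show ?thesis using m by linarith
  qed
  \<comment> \<open>\<open>\<Phi> n\<close> is the surplus of equations over dimensions in the first \<open>n\<close> steps of the path.\<close>
  define \<phi> where "\<phi> p = (if U p \<or> U (Suc p) then int r else 0) - (if U (Suc p) then w (Suc p) else 0)" for p
  define \<Phi> where "\<Phi> n = (\<Sum>p<n. \<phi> p)" for n
  \<comment> \<open>Inside a run of chosen positions, each pair loses at most \<gamma>, and an odd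
    position additionally carries its excess over r. At an unchosen position all losses are
    recovered, because the edge leaving the run supplies r without a new dimension.\<close>
  have inv: "(\<not> U n \<longrightarrow> \<Phi> n \<ge> 0) \<and> (U n \<and> even n \<longrightarrow> \<Phi> n \<ge> - (\<gamma> * int (n div 2))) \<and>
        (U n \<and> odd n \<longrightarrow> \<Phi> n \<ge> int r - w n - \<gamma> * int (n div 2))" if "n \<le> 2 * k + 1" for n
    using that
  proof (induction n)
    case 0
    then show ?case using assms by (simp add: \<Phi>_def)
  next
    case (Suc n)
    have step: "\<Phi> (Suc n) = \<Phi> n + \<phi> n" by (simp add: \<Phi>_def)
    have IH: "\<not> U n \<Longrightarrow> \<Phi> n \<ge> 0" "U n \<Longrightarrow> even n \<Longrightarrow> \<Phi> n \<ge> - (\<gamma> * int (n div 2))"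
      "U n \<Longrightarrow> odd n \<Longrightarrow> \<Phi> n \<ge> int r - w n - \<gamma> * int (n div 2)" using Suc by auto
    show ?case
    proof (cases "even n")
      case True
      then obtain m where m: "n = 2 * m" by blast
      have mk: "m \<le> k" using Suc m by linarith
      have "int r \<ge> \<gamma> * int m" using \<gamma>m[OF mk] rk by (smt (verit) mult_nonneg_nonneg of_nat_0_le_iff)
      moreover have "\<gamma> * int m \<ge> 0" using \<gamma>0 by simp
      moreover have "Suc n div 2 = m" "n div 2 = m" using m by auto
      ultimately show ?thesis using IH True by (auto simp: step \<phi>_def)
    next
      case False
      then obtain m where m: "n = 2 * m + 1" using oddE by blast
      have mk: "Suc m \<le> k" using Suc m by linarith
      have "\<gamma> * int m \<ge> 0" using \<gamma>0 by simp
      moreover have "\<gamma> * int (Suc m) = \<gamma> * int m + \<gamma>" by (simp add: algebra_simps)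
      moreover have "Suc n div 2 = Suc m" "n div 2 = m" using m by auto
      ultimately show ?thesis using IH False close_odd[OF mk, of n] ww[of n] rw[of n] by (auto simp: step \<phi>_def)
    qed
  qed
  define L where "L = 2 * k + 1"
  have card: "int r * int (card {p. p < L \<and> (U p \<or> U (Suc p))}) = (\<Sum>p<L. if U p \<or> U (Suc p) then int r else 0)"
  proof -
    have "(\<Sum>p<L. if U p \<or> U (Suc p) then int r else 0) = (\<Sum>p\<in>{..<L} \<inter> {p. U p \<or> U (Suc p)}. int r)"
      by (subst sum.inter_restrict) auto
    also have "{..<L} \<inter> {p. U p \<or> U (Suc p)} = {p. p < L \<and> (U p \<or> U (Suc p))}" by auto
    finally show ?thesis by simp
  qed
  have sumw: "(\<Sum>p<L. if U (Suc p) then w (Suc p) else 0) =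
      (\<Sum>p\<in>{p\<in>{1..2 * k}. U p}. w p) + (if U L then w L else 0)"
  proof -
    have "(\<Sum>p<L. if U (Suc p) then w (Suc p) else 0) = (\<Sum>p\<in>{1..L}. if U p then w p else 0)"
      by (rule sum.reindex_bij_witness[of _ "\<lambda>p. p - 1" Suc]) auto
    also have "\<dots> = (\<Sum>p\<in>{1..2 * k}. if U p then w p else 0) + (if U L then w L else 0)"
      by (simp add: L_def)
    also have "(\<Sum>p\<in>{1..2 * k}. if U p then w p else 0) = (\<Sum>p\<in>{p\<in>{1..2 * k}. U p}. w p)"
      by (subst sum.inter_filter) auto
    finally show ?thesis .
  qed
  have \<Phi>L: "\<Phi> L = int r * int (card {p. p < L \<and> (U p \<or> U (Suc p))}) -
        ((\<Sum>p\<in>{p\<in>{1..2 * k}. U p}. w p) + (if U L then w L else 0))"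
    unfolding \<Phi>_def \<phi>_def sum_subtractf card sumw ..
  have "int s * (\<Phi> L + (if U L then w L else 0)) \<ge> (if U L then w L else 0)"
  proof (cases "U L")
    case True
    have "\<Phi> L \<ge> int r - w L - \<gamma> * int k" using inv[of L] True by (simp add: L_def)
    then have "int s * (int r - \<gamma> * int k) \<le> int s * (\<Phi> L + w L)"
      by (intro mult_left_mono) auto
    moreover have "int s * (int r - \<gamma> * int k) = int dn" unfolding rk by (simp add: dn_def algebra_simps)
    ultimately show ?thesis using wdn[of L] True by simp
  next
    case False
    then show ?thesis using inv[of L] by (simp add: L_def)
  qed
  then show ?thesis
    unfolding \<Phi>L unfolding w_def[symmetric] L_def[symmetric] by (cases "U L") (simp_all add: algebra_simps)
qed

text \<open>Summing over the legs charges the centre once in total. Applied to all free vertices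
  this pays for the points of a spider, and applied to the support of a kernel vector it pays for
  that vector.\<close>

lemma balanced:
  assumes S: "S \<subseteq> inner"
  shows "(\<Sum>w\<in>S. dimn (side c (snd w))) \<le> r * card (touch S)"
proof -
  define U where "U i p \<longleftrightarrow> node i p \<in> S" for i p
  define L where "L = 2 * k + 1"
  define A where "A i = {p\<in>{1..2 * k}. U i p}" for i
  define w where "w p = int (dimn (side c p))" for p
  have X0: "\<not> U i 0" for i using S by (auto simp: U_def node_def inner_def)
  have XL: "U i L \<longleftrightarrow> (0, L) \<in> S" for i by (auto simp: U_def node_def L_def)
  have Sdec: "S = Sigma {..<s} A \<union> (if (0, L) \<in> S then {(0, L)} else {})"
    using S by (auto simp: A_def U_def node_def inner_def L_def)
  have "(\<Sum>x\<in>S. w (snd x)) = (\<Sum>x\<in>Sigma {..<s} A. w (snd x)) + (if (0, L) \<in> S then w L else 0)"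
  proof -
    have "(0, L) \<notin> Sigma {..<s} A" by (auto simp: A_def L_def)
    moreover have "finite (Sigma {..<s} A)" by (auto simp: A_def)
    ultimately show ?thesis by (subst Sdec) auto
  qed
  also have "(\<Sum>x\<in>Sigma {..<s} A. w (snd x)) = (\<Sum>i<s. \<Sum>p\<in>A i. w p)"
    by (subst sum.Sigma) (auto simp: A_def case_prod_unfold)
  finally have tot: "(\<Sum>x\<in>S. w (snd x)) = (\<Sum>i<s. \<Sum>p\<in>A i. w p) + (if (0, L) \<in> S then w L else 0)" .
  have "touch S = Sigma {..<s} (\<lambda>i. {p. p < L \<and> (U i p \<or> U i (Suc p))})"
    by (auto simp: touch_def spider_edges_def U_def L_def)
  then have ct: "int (card (touch S)) = (\<Sum>i<s. int (card {p. p < L \<and> (U i p \<or> U i (Suc p))}))"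
    by (simp add: card_SigmaI)
  have "int s * (\<Sum>x\<in>S. w (snd x)) = (\<Sum>i<s. int s * (\<Sum>p\<in>A i. w p) + (if U i L then w L else 0))"
    unfolding tot by (simp add: sum.distrib XL sum_distrib_left distrib_left)
  also have "\<dots> \<le> (\<Sum>i<s. int s * (int r * int (card {p. p < L \<and> (U i p \<or> U i (Suc p))})))"
    unfolding A_def L_def w_def by (intro sum_mono path_balanced X0)
  also have "\<dots> = int s * (int r * int (card (touch S)))"
    unfolding ct by (simp add: sum_distrib_left)
  finally have "(\<Sum>x\<in>S. w (snd x)) \<le> int r * int (card (touch S))"
    using s by simp
  then have "int (\<Sum>x\<in>S. dimn (side c (snd x))) \<le> int (r * card (touch S))" by (simp add: w_def)
  then show ?thesis by linarith
qed

end

section \<open>Singular spiders are rare\<close>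

text \<open>The degree allows values and derivatives to be prescribed on all edges of T spiders at
  once; \<open>d \<ge> 2\<close> does the same for the single point behind the edge density.\<close>

locale random_construction = finite_subfield F + spider k s a b
  for F :: "'k::field set" and k s a b :: nat +
  fixes T d :: nat and Z :: "(nat \<Rightarrow> 'k) set"
  assumes T: "T > 0" and d: "d \<ge> 2 * (T * card spider_edges)" "d \<ge> 2"
    and Z: "Z \<subseteq> PiE {..<r} (\<lambda>_. F)"
begin

definition W :: "(bool \<times> nat) set" where "W = (SIGMA e:UNIV. {..<dimn e})"
definition coords :: "bool \<Rightarrow> (nat \<times> nat) set \<Rightarrow> ((nat \<times> nat) \<times> nat) set" where
  "coords c A = (SIGMA w:A. {..<dimn (side c (snd w))})"
abbreviation V :: "bool \<Rightarrow> ((nat \<times> nat) \<times> nat) set" where "V c \<equiv> coords c inner"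
abbreviation R :: "bool \<Rightarrow> ((nat \<times> nat) \<times> nat) set" where "R c \<equiv> coords c ({..<s} \<times> {0})"

text \<open>
  Random polynomials have the variables \<open>W\<close>, with first component \<open>True\<close> for the coordinates of the
  endpoint in \<open>M\<close>. An assignment of points to the spider is a function on \<open>R c \<union> V c\<close>, and \<open>edge_pt\<close> extracts
  the pair of endpoints of an edge.
\<close>

definition edge_pt :: "bool \<Rightarrow> ((nat \<times> nat) \<times> nat \<Rightarrow> 'k) \<Rightarrow> nat \<times> nat \<Rightarrow> bool \<times> nat \<Rightarrow> 'k" where
  "edge_pt c Y e = (\<lambda>(h, m). Y (node (fst e) (if h = side c (snd e) then snd e else Suc (snd e)), m))"

text \<open>Directions are extended by zero to the roots, since only the free vertices vary.\<close>

definition ext0 :: "bool \<Rightarrow> ((nat \<times> nat) \<times> nat \<Rightarrow> 'k) \<Rightarrow> (nat \<times> nat) \<times> nat \<Rightarrow> 'k" where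
  "ext0 c v = (\<lambda>w. if w \<in> V c then v w else 0)"

definition val :: "(nat \<Rightarrow> (bool \<times> nat \<Rightarrow> 'k) \<Rightarrow> 'k) \<Rightarrow> (bool \<times> nat \<Rightarrow> 'k) \<Rightarrow> nat \<Rightarrow> 'k" where
  "val f x = (\<lambda>\<rho>\<in>{..<r}. f \<rho> x)"

definition singular :: "bool \<Rightarrow> (nat \<Rightarrow> (bool \<times> nat \<Rightarrow> 'k) \<Rightarrow> 'k) \<Rightarrow> ((nat \<times> nat) \<times> nat \<Rightarrow> 'k) \<Rightarrow> bool" where
  "singular c f y \<longleftrightarrow> (\<exists>v \<in> PiE (V c) (\<lambda>_. F). (\<exists>w\<in>V c. v w \<noteq> 0) \<and>
     (\<forall>e\<in>spider_edges. \<forall>\<rho><r. lin (f \<rho>) (edge_pt c y e) (edge_pt c (ext0 c v) e) = 0))"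

definition slots :: "(nat \<times> nat \<times> nat) set" where "slots = {..<T} \<times> spider_edges"

text \<open>The distinctness that \<open>interpolation\<close> needs for the constraints on all
  edges of all T spiders to be independent.\<close>

definition separated :: "bool \<Rightarrow> (nat \<Rightarrow> (nat \<times> nat) \<times> nat \<Rightarrow> 'k) \<Rightarrow> bool" where
  "separated c Y \<longleftrightarrow> (\<forall>x\<in>slots. \<forall>y\<in>slots. x \<noteq> y \<longrightarrow>
      (\<exists>w\<in>W. edge_pt c (Y (fst x)) (snd x) w \<noteq> edge_pt c (Y (fst y)) (snd y) w))"

definition bad :: "bool \<Rightarrow> (nat \<Rightarrow> (bool \<times> nat \<Rightarrow> 'k) \<Rightarrow> 'k) \<Rightarrow> bool" where
  "bad c f \<longleftrightarrow> (\<exists>Y. (\<forall>j<T. \<forall>w\<in>R c \<union> V c. Y j w \<in> F) \<and> (\<forall>j<T. \<forall>w\<in>R c. Y j w = Y 0 w) \<and>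
      separated c Y \<and> (\<forall>x\<in>slots. val f (edge_pt c (Y (fst x)) (snd x)) \<in> Z) \<and>
      (\<forall>j<T. singular c f (Y j)))"

abbreviation polys :: "(nat \<Rightarrow> (bool \<times> nat \<Rightarrow> 'k) \<Rightarrow> 'k) set" where
  "polys \<equiv> PiE {..<r} (\<lambda>_. PF W d)"

lemma finite_W [simp]: "finite W"
  by (auto simp: W_def)

lemma finite_coords: "finite A \<Longrightarrow> finite (coords c A)"
  by (auto simp: coords_def)

lemma finite_inner [simp]: "finite inner"
  by (simp add: inner_def)

lemma finite_spider_edges [simp]: "finite spider_edges"
  by (simp add: spider_edges_def)

lemma finite_slots [simp]: "finite slots"
  by (simp add: slots_def)

lemma card_coords: "finite A \<Longrightarrow> card (coords c A) = (\<Sum>w\<in>A. dimn (side c (snd w)))"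
  by (simp add: coords_def card_SigmaI)

lemma finite_polys [simp]: "finite polys"
  by (intro finite_PiE) (auto simp: PF_bound)

lemma node_inner: "e \<in> spider_edges \<Longrightarrow> node (fst e) (Suc (snd e)) \<in> inner"
  using s by (auto simp: spider_edges_def node_def inner_def)

lemma node_root_or_inner:
  "e \<in> spider_edges \<Longrightarrow> node (fst e) (snd e) \<in> {..<s} \<times> {0} \<or> node (fst e) (snd e) \<in> inner"
  by (auto simp: spider_edges_def node_def inner_def)

lemma edge_pt_coord:
  assumes "e \<in> spider_edges" "w \<in> W"
  obtains u where "u \<in> R c \<union> V c" "\<And>Y. edge_pt c Y e w = Y u"
proof -
  obtain h m where w: "w = (h, m)" "m < dimn h" using assms(2) by (auto simp: W_def)
  define p where "p = (if h = side c (snd e) then snd e else Suc (snd e))"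
  have "side c p = h" by (auto simp: p_def side_def)
  moreover have "node (fst e) p \<in> {..<s} \<times> {0} \<or> node (fst e) p \<in> inner"
    using node_inner[OF assms(1)] node_root_or_inner[OF assms(1)] by (auto simp: p_def)
  ultimately have "(node (fst e) p, m) \<in> R c \<union> V c"
    using w by (auto simp: coords_def node_def)
  moreover have "edge_pt c Y e w = Y (node (fst e) p, m)" for Y by (simp add: edge_pt_def w p_def)
  ultimately show ?thesis using that by blast
qed

lemma edge_pt_in:
  assumes "e \<in> spider_edges" "w \<in> W" "\<And>u. u \<in> R c \<union> V c \<Longrightarrow> Y u \<in> F"
  shows "edge_pt c Y e w \<in> F"
  using edge_pt_coord[OF assms(1,2)] assms(3) by metis

lemma edge_pt_cong:
  assumes "e \<in> spider_edges" "w \<in> W" "\<And>u. u \<in> R c \<union> V c \<Longrightarrow> Y u = Y' u"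
  shows "edge_pt c Y e w = edge_pt c Y' e w"
  using edge_pt_coord[OF assms(1,2)] assms(3) by metis

text \<open>A derivative constraint in direction zero would be void. On an edge meeting the support
  of the kernel vector the direction is nonzero, so the constraint costs a full factor |F|.\<close>

lemma edge_pt_touch:
  assumes e: "e \<in> touch S" and S: "\<And>u. u \<in> S \<Longrightarrow> \<exists>m. (u, m) \<in> V c \<and> Y (u, m) \<noteq> 0"
  shows "\<exists>w\<in>W. edge_pt c Y e w \<noteq> 0"
proof -
  have "node (fst e) (snd e) \<in> S \<or> node (fst e) (Suc (snd e)) \<in> S"
    using e by (auto simp: touch_def)
  then obtain p where p: "p = snd e \<or> p = Suc (snd e)" "node (fst e) p \<in> S" by blast
  obtain m where m: "(node (fst e) p, m) \<in> V c" "Y (node (fst e) p, m) \<noteq> 0" using S[OF p(2)] by blast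
  have "(side c p, m) \<in> W" using m by (auto simp: W_def coords_def node_def)
  moreover have "(if side c p = side c (snd e) then snd e else Suc (snd e)) = p"
    using p by (auto simp: side_def)
  then have "edge_pt c Y e (side c p, m) = Y (node (fst e) p, m)" by (simp add: edge_pt_def)
  ultimately show ?thesis using m by force
qed

lemma lin_scale:
  assumes "g \<in> PF W d" "\<And>w. w \<in> W \<Longrightarrow> p w \<in> F"
  shows "lin g p (\<lambda>w. t * v w) = t * lin g p v"
proof -
  obtain \<gamma> where \<gamma>: "\<And>w. lin g p w = (\<Sum>i\<in>W. \<gamma> i * w i)"
    by (rule lin_gradient[of W d g p]) (use assms in \<open>auto simp: PF_def\<close>)
  show ?thesis unfolding \<gamma> by (simp add: sum_distrib_left mult_ac)
qed

section \<open>Encoding T singular spiders for the union bound\<close>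

context
  fixes c :: bool
begin

definition glue :: "((nat \<times> nat) \<times> nat \<Rightarrow> 'k) \<Rightarrow> (nat \<times> (nat \<times> nat) \<times> nat \<Rightarrow> 'k) \<Rightarrow> nat \<Rightarrow> (nat \<times> nat) \<times> nat \<Rightarrow> 'k" where
  "glue y x j w = (if w \<in> V c then x (j, w) else y w)"

definition dirs :: "(nat \<times> (nat \<times> nat) \<times> nat \<Rightarrow> 'k) \<Rightarrow> nat \<Rightarrow> (nat \<times> nat) \<times> nat \<Rightarrow> 'k" where
  "dirs v j = ext0 c (\<lambda>w. v (j, w))"

text \<open>For each spider, the vertices supporting its kernel vector and a coordinate at which the
  vector is scaled to 1. The number of patterns does not depend on F.\<close>

definition patterns :: "(nat \<Rightarrow> (nat \<times> nat) set \<times> ((nat \<times> nat) \<times> nat)) set" where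
  "patterns = PiE {..<T} (\<lambda>_. {q \<in> Pow inner \<times> V c. fst (snd q) \<in> fst q})"

definition touched :: "(nat \<Rightarrow> (nat \<times> nat) set \<times> ((nat \<times> nat) \<times> nat)) \<Rightarrow> (nat \<times> nat \<times> nat) set" where
  "touched ps = (SIGMA j:{..<T}. touch (fst (ps j)))"

definition dirset :: "(nat \<Rightarrow> (nat \<times> nat) set \<times> ((nat \<times> nat) \<times> nat)) \<Rightarrow> (nat \<times> (nat \<times> nat) \<times> nat \<Rightarrow> 'k) set" where
  "dirset ps = PiE ({..<T} \<times> V c) (\<lambda>q. if snd q = snd (ps (fst q)) then {1}
       else if fst (snd q) \<in> fst (ps (fst q)) then F else {0})"

definition cfgs where
  "cfgs ps = PiE (R c) (\<lambda>_. F) \<times> PiE ({..<T} \<times> V c) (\<lambda>_. F) \<times> PiE slots (\<lambda>_. Z) \<times> dirset ps"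

text \<open>Degenerate configurations get the empty set, so \<open>card_constrained\<close> applies
  to all the others.\<close>

definition solset where
  "solset ps q = (case q of (y, x, z, v) \<Rightarrow>
     if separated c (glue y x) \<and> (\<forall>t\<in>touched ps. \<exists>w\<in>W. edge_pt c (dirs v (fst t)) (snd t) w \<noteq> 0)
     then PiE {..<r} (\<lambda>\<rho>. {g \<in> PF W d. (\<forall>t\<in>slots. g (edge_pt c (glue y x (fst t)) (snd t)) = z t \<rho>) \<and>
        (\<forall>t\<in>touched ps. lin g (edge_pt c (glue y x (fst t)) (snd t)) (edge_pt c (dirs v (fst t)) (snd t)) = 0)})
     else {})"

lemma touched_slots: "touched ps \<subseteq> slots"
  by (auto simp: touched_def slots_def touch_def)

lemma finite_V [simp]: "finite (V c)" "finite (R c)"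
  by (auto intro!: finite_coords)

lemma card_solset:
  assumes q: "q \<in> cfgs ps"
  shows "card (solset ps q) * card F ^ (r * (card slots + card (touched ps))) \<le> card (PF W d) ^ r"
proof -
  obtain y x z v where qq: "q = (y, x, z, v)" by (cases q)
  have y: "\<And>w. w \<in> R c \<Longrightarrow> y w \<in> F" and x: "\<And>j w. j < T \<Longrightarrow> w \<in> V c \<Longrightarrow> x (j, w) \<in> F"
    and z: "\<And>t. t \<in> slots \<Longrightarrow> z t \<in> Z" and v: "v \<in> dirset ps"
    using q by (auto simp: cfgs_def qq dest: PiE_mem)
  have vF: "v (j, w) \<in> F" if "j < T" "w \<in> V c" for j w
    using PiE_mem[OF v[unfolded dirset_def], of "(j, w)"] that by (auto split: if_splits)
  show ?thesis
  proof (cases "separated c (glue y x) \<and> (\<forall>t\<in>touched ps. \<exists>w\<in>W. edge_pt c (dirs v (fst t)) (snd t) w \<noteq> 0)")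
    case True
    define C where "C = (\<lambda>\<rho>. {g \<in> PF W d. (\<forall>t\<in>slots. g (edge_pt c (glue y x (fst t)) (snd t)) = z t \<rho>) \<and>
        (\<forall>t\<in>touched ps. lin g (edge_pt c (glue y x (fst t)) (snd t)) (edge_pt c (dirs v (fst t)) (snd t)) = 0)})"
    have C: "card (C \<rho>) * card F ^ (card slots + card (touched ps)) = card (PF W d)" if \<rho>: "\<rho> < r" for \<rho>
      unfolding C_def
    proof (rule card_constrained)
      show "2 * card slots \<le> d" using d by (simp add: slots_def card_cartesian_product)
      show "edge_pt c (glue y x (fst t)) (snd t) w \<in> F" if "t \<in> slots" "w \<in> W" for t w
        by (rule edge_pt_in) (use that x y in \<open>auto simp: slots_def glue_def\<close>)
      show "edge_pt c (dirs v (fst t)) (snd t) w \<in> F" if "t \<in> touched ps" "w \<in> W" for t w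
        by (rule edge_pt_in) (use that touched_slots[of ps] vF in \<open>auto simp: slots_def dirs_def ext0_def\<close>)
      show "\<exists>w\<in>W. edge_pt c (glue y x (fst t)) (snd t) w \<noteq> edge_pt c (glue y x (fst t')) (snd t') w"
        if "t \<in> slots" "t' \<in> slots" "t \<noteq> t'" for t t'
        using True that by (simp add: separated_def)
      show "z t \<rho> \<in> F" if "t \<in> slots" for t
        using z[OF that] Z \<rho> by (auto dest: PiE_mem)
    qed (use True touched_slots in auto)
    have "solset ps q = PiE {..<r} C" using True by (simp add: solset_def qq C_def)
    then have "card (solset ps q) * card F ^ (r * (card slots + card (touched ps))) =
        (\<Prod>\<rho><r. card (C \<rho>)) * (card F ^ (card slots + card (touched ps))) ^ r"
      by (simp add: card_PiE flip: power_mult) (simp add: mult.commute)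
    also have "\<dots> = (\<Prod>\<rho><r. card (C \<rho>) * card F ^ (card slots + card (touched ps)))"
      by (simp add: prod.distrib)
    also have "\<dots> = (\<Prod>\<rho><r. card (PF W d))" by (intro prod.cong refl C) auto
    finally show ?thesis by simp
  next
    case False
    then have "solset ps q = {}" unfolding solset_def qq by (simp only: prod.case if_False)
    then show ?thesis by simp
  qed
qed

lemma card_dirset:
  assumes ps: "ps \<in> patterns"
  shows "card (dirset ps) * card F ^ T = card F ^ (\<Sum>j<T. \<Sum>u\<in>fst (ps j). dimn (side c (snd u)))"
proof -
  let ?f = "\<lambda>j w. card (if w = snd (ps j) then {1 :: 'k} else if fst w \<in> fst (ps j) then F else {0})"
  have row: "(\<Prod>w\<in>V c. ?f j w) * card F = card F ^ (\<Sum>u\<in>fst (ps j). dimn (side c (snd u)))" if j: "j < T" for j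
  proof -
    have p: "fst (ps j) \<subseteq> inner" "snd (ps j) \<in> V c" "fst (snd (ps j)) \<in> fst (ps j)"
      using ps j by (auto simp: patterns_def dest!: PiE_mem)
    have "(\<Prod>w\<in>V c. ?f j w) = (\<Prod>w\<in>V c - {snd (ps j)}. ?f j w)"
      using p by (subst prod.remove[of _ "snd (ps j)"]) auto
    also have "\<dots> = (\<Prod>w\<in>V c - {snd (ps j)}. if fst w \<in> fst (ps j) then card F else 1)"
      by (intro prod.cong) auto
    also have "\<dots> * card F = (\<Prod>w\<in>V c. if fst w \<in> fst (ps j) then card F else 1)"
      using p by (subst (2) prod.remove[of _ "snd (ps j)"]) auto
    also have "\<dots> = (\<Prod>w\<in>{w\<in>V c. fst w \<in> fst (ps j)}. card F)"
      by (rule prod.inter_filter[symmetric]) auto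
    also have "\<dots> = card F ^ card {w\<in>V c. fst w \<in> fst (ps j)}" by simp
    also have "{w\<in>V c. fst w \<in> fst (ps j)} = coords c (fst (ps j))" using p by (auto simp: coords_def)
    also have "card (coords c (fst (ps j))) = (\<Sum>u\<in>fst (ps j). dimn (side c (snd u)))"
      using p by (intro card_coords) (auto intro: finite_subset)
    finally show ?thesis .
  qed
  have "card (dirset ps) = (\<Prod>q\<in>{..<T} \<times> V c. ?f (fst q) (snd q))"
    unfolding dirset_def by (subst card_PiE) auto
  also have "\<dots> = (\<Prod>j<T. \<Prod>w\<in>V c. ?f j w)"
    by (simp add: prod.cartesian_product case_prod_unfold)
  finally have "card (dirset ps) * card F ^ T = (\<Prod>j<T. (\<Prod>w\<in>V c. ?f j w) * card F)"
    by (simp add: prod.distrib)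
  also have "\<dots> = (\<Prod>j<T. card F ^ (\<Sum>u\<in>fst (ps j). dimn (side c (snd u))))"
    by (intro prod.cong refl row) auto
  finally show ?thesis by (simp add: power_sum)
qed

text \<open>The value equations pay for the free points and the derivative equations on touched
  edges pay for the kernel vectors, both by \<open>balanced\<close>. The roots remain unpaid, while
  the T coordinates pinned to 1 are a net gain.\<close>

lemma card_pattern:
  assumes ps: "ps \<in> patterns"
  shows "card (\<Union>q\<in>cfgs ps. solset ps q) * card F ^ T \<le>
    card F ^ card (R c) * card Z ^ card slots * card (PF W d) ^ r"
proof -
  define E where "E = r * (card slots + card (touched ps))"
  have finZ: "finite Z" using Z by (rule finite_subset) (intro finite_PiE, auto)
  have fin: "finite (cfgs ps)"
    unfolding cfgs_def dirset_def by (intro finite_cartesian_product finite_PiE) (auto simp: finZ)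
  have "card (\<Union>q\<in>cfgs ps. solset ps q) * card F ^ E \<le> (\<Sum>q\<in>cfgs ps. card (solset ps q)) * card F ^ E"
    by (intro mult_right_mono card_UN_le fin) auto
  also have "\<dots> = (\<Sum>q\<in>cfgs ps. card (solset ps q) * card F ^ E)" by (simp add: sum_distrib_right)
  also have "\<dots> \<le> (\<Sum>q\<in>cfgs ps. card (PF W d) ^ r)"
    unfolding E_def by (intro sum_mono card_solset)
  finally have 1: "card (\<Union>q\<in>cfgs ps. solset ps q) * card F ^ E \<le> card (cfgs ps) * card (PF W d) ^ r" by simp
  have "card (cfgs ps) = card F ^ card (R c) * (card F ^ (T * card (V c)) * (card Z ^ card slots * card (dirset ps)))"
    unfolding cfgs_def by (simp add: card_cartesian_product card_PiE)
  then have "card (cfgs ps) * card F ^ T = card F ^ card (R c) * card Z ^ card slots * (card F ^ (T * card (V c)) * (card (dirset ps) * card F ^ T))"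
    by (simp only: mult_ac)
  also have "\<dots> = card F ^ card (R c) * card Z ^ card slots * card F ^ (T * card (V c) + (\<Sum>j<T. \<Sum>u\<in>fst (ps j). dimn (side c (snd u))))"
    unfolding card_dirset[OF ps] power_add by simp
  also have "\<dots> \<le> card F ^ card (R c) * card Z ^ card slots * card F ^ E"
  proof (intro mult_left_mono power_increasing)
    \<comment> \<open>The upper end of every edge is free, so for the whole spider all edges
      count.\<close>
    have "touch inner = spider_edges" using node_inner by (auto simp: touch_def)
    then have "card (V c) \<le> r * card spider_edges"
      using balanced[of inner c] by (simp add: card_coords)
    then have "T * card (V c) \<le> r * card slots"
      by (simp add: slots_def card_cartesian_product mult.left_commute)
    moreover have "(\<Sum>j<T. \<Sum>u\<in>fst (ps j). dimn (side c (snd u))) \<le> (\<Sum>j<T. r * card (touch (fst (ps j))))"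
      using ps by (intro sum_mono balanced) (auto simp: patterns_def dest!: PiE_mem)
    moreover have "card (touched ps) = (\<Sum>j<T. card (touch (fst (ps j))))"
      unfolding touched_def by (rule card_SigmaI) (auto simp: touch_def intro: finite_subset[OF _ finite_spider_edges])
    ultimately show "T * card (V c) + (\<Sum>j<T. \<Sum>u\<in>fst (ps j). dimn (side c (snd u))) \<le> E"
      by (simp add: E_def sum_distrib_left add_mult_distrib2)
  qed (use card_F_gt_1 in auto)
  finally have 2: "card (cfgs ps) * card F ^ T \<le> card F ^ card (R c) * card Z ^ card slots * card F ^ E" .
  have "(card (\<Union>q\<in>cfgs ps. solset ps q) * card F ^ T) * card F ^ E \<le> (card (cfgs ps) * card F ^ T) * card (PF W d) ^ r"
    using mult_right_mono[OF 1, of "card F ^ T"] by (simp add: mult_ac)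
  also have "\<dots> \<le> (card F ^ card (R c) * card Z ^ card slots * card F ^ E) * card (PF W d) ^ r"
    by (intro mult_right_mono 2) auto
  finally have "(card (\<Union>q\<in>cfgs ps. solset ps q) * card F ^ T) * card F ^ E \<le>
     (card F ^ card (R c) * card Z ^ card slots * card (PF W d) ^ r) * card F ^ E" by (simp only: mult_ac)
  then show ?thesis using card_F_gt_1 by simp
qed

lemma bad_covered: "{f \<in> polys. bad c f} \<subseteq> (\<Union>ps\<in>patterns. \<Union>q\<in>cfgs ps. solset ps q)"
proof
  fix f assume "f \<in> {f \<in> polys. bad c f}"
  then have f: "f \<in> polys" and "bad c f" by auto
  then obtain Y where Y: "\<And>j w. j < T \<Longrightarrow> w \<in> R c \<union> V c \<Longrightarrow> Y j w \<in> F"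
    "\<And>j w. j < T \<Longrightarrow> w \<in> R c \<Longrightarrow> Y j w = Y 0 w" "separated c Y"
    "\<And>x. x \<in> slots \<Longrightarrow> val f (edge_pt c (Y (fst x)) (snd x)) \<in> Z"
    "\<forall>j<T. singular c f (Y j)"
    unfolding bad_def by blast
  have fPF: "f \<rho> \<in> PF W d" if "\<rho> < r" for \<rho> using f that by (auto dest: PiE_mem)
  have fpoly: "polyf W d (f \<rho>)" if "\<rho> < r" for \<rho> using fPF[OF that] by (simp add: PF_def)
  have "\<forall>j\<in>{..<T}. \<exists>v. (v \<in> PiE (V c) (\<lambda>_. F) \<and> (\<exists>w\<in>V c. v w = 1) \<and>
     (\<forall>e\<in>spider_edges. \<forall>\<rho><r. lin (f \<rho>) (edge_pt c (Y j) e) (edge_pt c (ext0 c v) e) = 0))"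
  proof
    fix j assume "j \<in> {..<T}"
    then have j: "j < T" by simp
    then obtain v w where v: "v \<in> PiE (V c) (\<lambda>_. F)" "w \<in> V c" "v w \<noteq> 0"
      "\<And>e \<rho>. e \<in> spider_edges \<Longrightarrow> \<rho> < r \<Longrightarrow> lin (f \<rho>) (edge_pt c (Y j) e) (edge_pt c (ext0 c v) e) = 0"
      using Y(5) unfolding singular_def by blast
    define v' where "v' = (\<lambda>u\<in>V c. inverse (v w) * v u)"
    have vF: "v u \<in> F" if "u \<in> V c" for u using v(1) that by (auto dest: PiE_mem)
    have "v' \<in> PiE (V c) (\<lambda>_. F)" using vF v(2) by (auto simp: v'_def)
    moreover have "v' w = 1" using v by (simp add: v'_def)
    moreover have "lin (f \<rho>) (edge_pt c (Y j) e) (edge_pt c (ext0 c v') e) = 0"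
      if "e \<in> spider_edges" "\<rho> < r" for e \<rho>
    proof -
      have "edge_pt c (ext0 c v') e = (\<lambda>u. inverse (v w) * edge_pt c (ext0 c v) e u)"
        by (auto simp: fun_eq_iff edge_pt_def ext0_def v'_def)
      then show ?thesis
        using lin_scale[OF fPF[OF that(2)], of "edge_pt c (Y j) e"] edge_pt_in[OF that(1)] Y(1)[OF j] v(4)[OF that]
        by simp
    qed
    ultimately show "\<exists>v. (v \<in> PiE (V c) (\<lambda>_. F) \<and> (\<exists>w\<in>V c. v w = 1) \<and>
     (\<forall>e\<in>spider_edges. \<forall>\<rho><r. lin (f \<rho>) (edge_pt c (Y j) e) (edge_pt c (ext0 c v) e) = 0))"
      using v(2) by blast
  qed
  from bchoice[OF this] obtain vv where vv: "\<forall>j\<in>{..<T}. (vv j \<in> PiE (V c) (\<lambda>_. F) \<and> (\<exists>w\<in>V c. vv j w = 1) \<and>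
     (\<forall>e\<in>spider_edges. \<forall>\<rho><r. lin (f \<rho>) (edge_pt c (Y j) e) (edge_pt c (ext0 c (vv j)) e) = 0))"
    by (elim exE)
  have "\<forall>j\<in>{..<T}. \<exists>w. w \<in> V c \<and> vv j w = 1" using vv by blast
  from bchoice[OF this] obtain ww where ww: "\<forall>j\<in>{..<T}. ww j \<in> V c \<and> vv j (ww j) = 1" by (elim exE)
  have vvF: "vv j u \<in> F" if "j < T" "u \<in> V c" for j u using vv that by (auto dest: PiE_mem)
  \<comment> \<open>The support is recorded by vertices rather than coordinates, because
    \<open>touch\<close> and \<open>balanced\<close> speak of vertices.\<close>
  define SS where "SS j = {u\<in>inner. \<exists>m. (u, m) \<in> V c \<and> vv j (u, m) \<noteq> 0}" for j
  define ps where "ps = (\<lambda>j\<in>{..<T}. (SS j, ww j))"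
  define y where "y = (\<lambda>w\<in>R c. Y 0 w)"
  define x where "x = (\<lambda>q\<in>{..<T} \<times> V c. Y (fst q) (snd q))"
  define z where "z = (\<lambda>t\<in>slots. val f (edge_pt c (Y (fst t)) (snd t)))"
  define v where "v = (\<lambda>q\<in>{..<T} \<times> V c. vv (fst q) (snd q))"
  have VR: "w \<notin> V c" if "w \<in> R c" for w using that by (auto simp: coords_def inner_def)
  have ps: "ps \<in> patterns"
  proof -
    have "fst (ww j) \<in> SS j" if j: "j < T" for j
    proof -
      have 1: "ww j \<in> V c" "vv j (ww j) = 1" using ww j by auto
      then have "fst (ww j) \<in> inner" by (auto simp: coords_def)
      moreover have "(fst (ww j), snd (ww j)) \<in> V c \<and> vv j (fst (ww j), snd (ww j)) \<noteq> 0" using 1 by simp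
      ultimately show ?thesis unfolding SS_def by blast
    qed
    then show ?thesis using ww by (auto simp: patterns_def ps_def SS_def)
  qed
  have q: "(y, x, z, v) \<in> cfgs ps"
  proof -
    have "y \<in> PiE (R c) (\<lambda>_. F)" using Y(1)[of 0] T by (auto simp: y_def)
    moreover have "x \<in> PiE ({..<T} \<times> V c) (\<lambda>_. F)" using Y(1) by (auto simp: x_def)
    moreover have "z \<in> PiE slots (\<lambda>_. Z)" using Y(4) by (auto simp: z_def)
    moreover have "v \<in> dirset ps"
      unfolding dirset_def
    proof (rule PiE_I)
      fix q assume q: "q \<in> {..<T} \<times> V c"
      then obtain j w where jw: "q = (j, w)" "j < T" "w \<in> V c" by auto
      have "vv j w = 0" if "fst w \<notin> SS j"
      proof (rule ccontr)
        assume "vv j w \<noteq> 0"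
        then have "(fst w, snd w) \<in> V c \<and> vv j (fst w, snd w) \<noteq> 0" using jw by simp
        moreover have "fst w \<in> inner" using jw by (auto simp: coords_def)
        ultimately show False using that unfolding SS_def by blast
      qed
      moreover have "vv j (ww j) = 1" using ww jw by auto
      ultimately show "v q \<in> (if snd q = snd (ps (fst q)) then {1} else if fst (snd q) \<in> fst (ps (fst q)) then F else {0})"
        using vvF[OF jw(2,3)] jw by (auto simp: v_def ps_def)
    qed (auto simp: v_def)
    ultimately show ?thesis by (simp add: cfgs_def)
  qed
  have gl: "edge_pt c (glue y x j) e w = edge_pt c (Y j) e w" if "j < T" "e \<in> spider_edges" "w \<in> W" for j e w
  proof (rule edge_pt_cong[OF that(2,3)])
    fix u assume "u \<in> R c \<union> V c"
    then show "glue y x j u = Y j u"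
      using VR[of u] Y(2)[OF that(1), of u] that(1) by (cases "u \<in> V c") (auto simp: glue_def y_def x_def)
  qed
  have di: "dirs v j = ext0 c (vv j)" if "j < T" for j
    using that by (auto simp: dirs_def ext0_def v_def)
  have "f \<in> solset ps (y, x, z, v)"
  proof -
    have "separated c (glue y x)"
      unfolding separated_def
    proof (intro ballI impI)
      fix t t' assume t: "t \<in> slots" "t' \<in> slots" "t \<noteq> t'"
      then obtain w where w: "w \<in> W" "edge_pt c (Y (fst t)) (snd t) w \<noteq> edge_pt c (Y (fst t')) (snd t') w"
        using Y(3) unfolding separated_def by blast
      have "edge_pt c (glue y x (fst t)) (snd t) w \<noteq> edge_pt c (glue y x (fst t')) (snd t') w"
        using w gl[of "fst t" "snd t" w] gl[of "fst t'" "snd t'" w] t by (auto simp: slots_def)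
      with w(1) show "\<exists>w\<in>W. edge_pt c (glue y x (fst t)) (snd t) w \<noteq> edge_pt c (glue y x (fst t')) (snd t') w" by blast
    qed
    moreover have "\<exists>w\<in>W. edge_pt c (dirs v (fst t)) (snd t) w \<noteq> 0" if t: "t \<in> touched ps" for t
    proof -
      have j: "fst t < T" "snd t \<in> touch (SS (fst t))" using t by (auto simp: touched_def ps_def)
      show ?thesis unfolding di[OF j(1)]
        by (rule edge_pt_touch[OF j(2)]) (auto simp: SS_def ext0_def)
    qed
    moreover have "f \<rho> (edge_pt c (glue y x (fst t)) (snd t)) = z t \<rho>" if "t \<in> slots" "\<rho> < r" for t \<rho>
    proof -
      have "f \<rho> (edge_pt c (glue y x (fst t)) (snd t)) = f \<rho> (edge_pt c (Y (fst t)) (snd t))"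
        by (rule polyf_cong[OF fpoly[OF that(2)]]) (use that gl in \<open>auto simp: slots_def\<close>)
      then show ?thesis using that by (simp add: z_def val_def)
    qed
    moreover have "lin (f \<rho>) (edge_pt c (glue y x (fst t)) (snd t)) (edge_pt c (dirs v (fst t)) (snd t)) = 0"
      if "t \<in> touched ps" "\<rho> < r" for t \<rho>
    proof -
      have t: "fst t < T" "snd t \<in> spider_edges" using subsetD[OF touched_slots that(1)] by (auto simp: slots_def)
      have "lin (f \<rho>) (edge_pt c (glue y x (fst t)) (snd t)) (edge_pt c (dirs v (fst t)) (snd t)) =
         lin (f \<rho>) (edge_pt c (Y (fst t)) (snd t)) (edge_pt c (ext0 c (vv (fst t))) (snd t))"
        by (rule lin_cong[OF fpoly[OF that(2)]]) (use t gl di in auto)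
      then show ?thesis using vv t that by auto
    qed
    ultimately show ?thesis using f fPF by (auto simp: solset_def PiE_iff)
  qed
  then show "f \<in> (\<Union>ps\<in>patterns. \<Union>q\<in>cfgs ps. solset ps q)" using ps q by blast
qed

text \<open>
  A nonzero kernel vector can be scaled to have an entry \<open>1\<close>; this saves a factor \<open>card F\<close> for each of the
  \<open>T\<close> singular spiders, because by \<open>balanced\<close> the remaining entries are paid for by the equations.
\<close>

lemma card_bad:
  "card {f \<in> polys. bad c f} * card F ^ T \<le>
    (2 ^ card inner * card (V c)) ^ T * card Z ^ card slots * card F ^ card (R c) * card (PF W d) ^ r"
proof -
  define N where "N = card F ^ card (R c) * card Z ^ card slots * card (PF W d) ^ r"
  have fin: "finite {q \<in> Pow inner \<times> V c. fst (snd q) \<in> fst q}"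
    by (rule finite_subset[of _ "Pow inner \<times> V c"]) auto
  have finp: "finite patterns" unfolding patterns_def by (intro finite_PiE fin) auto
  have "card {q \<in> Pow inner \<times> V c. fst (snd q) \<in> fst q} \<le> card (Pow inner \<times> V c)"
    by (intro card_mono) auto
  then have "card {q \<in> Pow inner \<times> V c. fst (snd q) \<in> fst q} \<le> 2 ^ card inner * card (V c)"
    by (simp add: card_cartesian_product card_Pow)
  then have cp: "card patterns \<le> (2 ^ card inner * card (V c)) ^ T"
    unfolding patterns_def by (simp add: card_PiE power_mono)
  have fins: "finite (\<Union>ps\<in>patterns. \<Union>q\<in>cfgs ps. solset ps q)"
  proof (rule finite_subset[OF _ finite_polys], rule subsetI)
    fix f assume "f \<in> (\<Union>ps\<in>patterns. \<Union>q\<in>cfgs ps. solset ps q)"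
    then obtain ps q where "f \<in> solset ps q" by blast
    then show "f \<in> polys" by (cases q) (auto simp: solset_def PiE_iff split: if_splits)
  qed
  have "card {f \<in> polys. bad c f} * card F ^ T \<le> card (\<Union>ps\<in>patterns. \<Union>q\<in>cfgs ps. solset ps q) * card F ^ T"
    by (intro mult_right_mono card_mono bad_covered fins) auto
  also have "\<dots> \<le> (\<Sum>ps\<in>patterns. card (\<Union>q\<in>cfgs ps. solset ps q)) * card F ^ T"
    by (intro mult_right_mono card_UN_le finp) auto
  also have "\<dots> = (\<Sum>ps\<in>patterns. card (\<Union>q\<in>cfgs ps. solset ps q) * card F ^ T)" by (simp add: sum_distrib_right)
  also have "\<dots> \<le> (\<Sum>ps\<in>patterns. N)" unfolding N_def by (intro sum_mono card_pattern)
  also have "\<dots> \<le> (2 ^ card inner * card (V c)) ^ T * N" using cp by simp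
  finally show ?thesis by (simp add: N_def mult_ac)
qed

end

end

section \<open>The graph\<close>

text \<open>Paths meet only at branch vertices: the far end forgets i and the near end forgets
  j.\<close>

lemma subdiv_point_inj:
  fixes i i' j j' s :: nat
  assumes "subdiv_point n i (s + j) p = subdiv_point n i' (s + j') p'" "i < s" "i' < s" "p \<le> n" "p' \<le> n" "n > 0"
  shows "p = p'" "p < n \<Longrightarrow> i = i'" "p > 0 \<Longrightarrow> j = j'"
  using assms by (auto simp: subdiv_point_def split: if_splits)

context random_construction
begin

lemma dline_diff_const:
  assumes "\<And>\<tau>. \<phi> \<tau> = poly \<pi> \<tau>"
  shows "dline (\<lambda>\<tau>. \<phi> \<tau> - e) = dline \<phi>"
  by (subst dline_eq[of _ "\<pi> - [:e:]"], use assms in simp) (use dline_eq[OF assms] in simp)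

text \<open>The values on the edges are only known to lie in Z. Sorting the spiders by their value
  patterns makes each class a set of nonsingular zeros of one system in the free coordinates, with
  the roots substituted.\<close>

lemma card_nonsingular:
  assumes f: "f \<in> polys" and J: "finite J"
    and YF: "\<And>j w. j \<in> J \<Longrightarrow> w \<in> R c \<union> V c \<Longrightarrow> Y j w \<in> F"
    and root: "\<And>j w. j \<in> J \<Longrightarrow> w \<in> R c \<Longrightarrow> Y j w = u w"
    and valZ: "\<And>j e. j \<in> J \<Longrightarrow> e \<in> spider_edges \<Longrightarrow> val f (edge_pt c (Y j) e) \<in> Z"
    and ns: "\<And>j. j \<in> J \<Longrightarrow> \<not> singular c f (Y j)"
    and inj: "inj_on (\<lambda>j. restrict (Y j) (V c)) J"
    and \<delta>: "\<delta> = (card (V c) * d + 1) ^ card (V c)" "card F > \<delta>"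
  shows "card J \<le> card Z ^ card spider_edges * (2 ^ (card spider_edges * r) * \<delta> ^ card (V c))"
proof -
  define pat where "pat j = (\<lambda>e\<in>spider_edges. val f (edge_pt c (Y j) e))" for j
  have finZ: "finite Z" using Z by (rule finite_subset) (intro finite_PiE, auto)
  have finP: "finite (PiE spider_edges (\<lambda>_. Z))" by (intro finite_PiE) (auto simp: finZ)
  have fpoly: "polyf W d (f \<rho>)" if "\<rho> < r" for \<rho> using f that by (auto simp: PF_def dest: PiE_mem)
  define mrg where "mrg x = (\<lambda>w. if w \<in> V c then x w else u w)" for x :: "(nat \<times> nat) \<times> nat \<Rightarrow> 'k"
  have group: "card {j\<in>J. pat j = z} \<le> 2 ^ (card spider_edges * r) * \<delta> ^ card (V c)"
    if z: "z \<in> PiE spider_edges (\<lambda>_. Z)" for z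
  proof (cases "{j\<in>J. pat j = z} = {}")
    case True
    then show ?thesis by (simp only: card.empty)
  next
    case False
    then obtain j0 where j0: "j0 \<in> J" by blast
    have uF: "u w \<in> F" if "w \<in> R c" for w using YF[OF j0, of w] root[OF j0 that] that by simp
    define S where "S = (\<lambda>j. restrict (Y j) (V c)) ` {j\<in>J. pat j = z}"
    define g where "g q x = f (snd q) (edge_pt c (mrg x) (fst q)) - z (fst q) (snd q)" for q x
    have zF: "z e \<rho> \<in> F" if "e \<in> spider_edges" "\<rho> < r" for e \<rho>
      using z Z that by (auto dest!: PiE_mem)
    \<comment> \<open>Moving the free coordinates along v moves each edge point along
      \<open>ext0 c v\<close>, so the derivative of the system is the one in
      \<open>singular\<close>.\<close>
    have line: "edge_pt c (mrg (\<lambda>w. p w + \<tau> * v w)) e = (\<lambda>w. edge_pt c (mrg p) e w + \<tau> * edge_pt c (ext0 c v) e w)"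
      for p \<tau> v e
      by (auto simp: fun_eq_iff edge_pt_def mrg_def ext0_def)
    have mY: "edge_pt c (mrg (restrict (Y j) (V c))) e w = edge_pt c (Y j) e w"
      if "j \<in> J" "e \<in> spider_edges" "w \<in> W" for j e w
    proof (rule edge_pt_cong[OF that(2,3)])
      fix x assume "x \<in> R c \<union> V c"
      then show "mrg (restrict (Y j) (V c)) x = Y j x"
        using root[OF that(1), of x] by (cases "x \<in> V c") (auto simp: mrg_def)
    qed
    have "card S \<le> 2 ^ card (spider_edges \<times> {..<r}) * \<delta> ^ card (V c)"
    proof (rule nonsingular_zeros[where g = g, OF _ _ _ \<delta>])
      fix q assume "q \<in> spider_edges \<times> {..<r}"
      then have q: "fst q \<in> spider_edges" "snd q < r" by auto
      have "polyf (V c) d (\<lambda>x. f (snd q) (\<lambda>w. (\<lambda>w x. edge_pt c (mrg x) (fst q) w) w x))"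
      proof (rule polyf_subst[OF fpoly[OF q(2)]])
        fix w assume w: "w \<in> W"
        obtain u' where u': "u' \<in> R c \<union> V c" "\<And>Y. edge_pt c Y (fst q) w = Y u'"
          by (rule edge_pt_coord[OF q(1) w, of c]) (rule that)
        show "(\<exists>i\<in>V c. (\<lambda>x. edge_pt c (mrg x) (fst q) w) = (\<lambda>x. x i)) \<or> (\<exists>e\<in>F. (\<lambda>x. edge_pt c (mrg x) (fst q) w) = (\<lambda>x. e))"
        proof (cases "u' \<in> V c")
          case True
          then have "(\<lambda>x. edge_pt c (mrg x) (fst q) w) = (\<lambda>x. x u')" by (simp add: u'(2) mrg_def)
          then show ?thesis using True by blast
        next
          case False
          then have "(\<lambda>x. edge_pt c (mrg x) (fst q) w) = (\<lambda>x. u u')" by (simp add: u'(2) mrg_def)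
          moreover have "u u' \<in> F" using uF u'(1) False by blast
          ultimately show ?thesis by blast
        qed
      qed
      then have "polyf (V c) d (\<lambda>x. f (snd q) (edge_pt c (mrg x) (fst q)))" by simp
      then show "polyf (V c) d (g q)"
        unfolding g_def using zF[OF q] by (intro polyf_diff polyf.const)
    next
      show "S \<subseteq> PiE (V c) (\<lambda>_. F)" using YF by (auto simp: S_def)
    next
      fix p q assume p: "p \<in> S" and "q \<in> spider_edges \<times> {..<r}"
      then have q: "fst q \<in> spider_edges" "snd q < r" by auto
      obtain j where j: "j \<in> J" "pat j = z" "p = restrict (Y j) (V c)" using p by (auto simp: S_def)
      have "f (snd q) (edge_pt c (mrg p) (fst q)) = f (snd q) (edge_pt c (Y j) (fst q))"
        by (rule polyf_cong[OF fpoly[OF q(2)]]) (use mY[OF j(1) q(1)] j(3) in auto)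
      also have "\<dots> = z (fst q) (snd q)"
        unfolding j(2)[symmetric] pat_def using q by (simp add: val_def)
      finally show "g q p = 0" by (simp add: g_def)
    next
      fix p v assume p: "p \<in> S" and v: "v \<in> PiE (V c) (\<lambda>_. F)"
        and l0: "\<And>q. q \<in> spider_edges \<times> {..<r} \<Longrightarrow> lin (g q) p v = 0"
      obtain j where j: "j \<in> J" "pat j = z" "p = restrict (Y j) (V c)" using p by (auto simp: S_def)
      have "lin (f \<rho>) (edge_pt c (Y j) e) (edge_pt c (ext0 c v) e) = 0" if e: "e \<in> spider_edges" "\<rho> < r" for e \<rho>
      proof -
        have pF: "edge_pt c (mrg p) e w \<in> F" if "w \<in> W" for w
          unfolding j(3) mY[OF j(1) e(1) that] using edge_pt_in[OF e(1) that, of c "Y j"] YF[OF j(1)] by blast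
        obtain \<pi> where \<pi>: "\<And>\<tau>. f \<rho> (\<lambda>w. edge_pt c (mrg p) e w + \<tau> * edge_pt c (ext0 c v) e w) = poly \<pi> \<tau>"
          by (rule polyf_line[OF finite_W fpoly[OF e(2)], of "edge_pt c (mrg p) e" "edge_pt c (ext0 c v) e"]) (use pF in auto)
        have "lin (f \<rho>) (edge_pt c (Y j) e) (edge_pt c (ext0 c v) e) = lin (f \<rho>) (edge_pt c (mrg p) e) (edge_pt c (ext0 c v) e)"
          by (rule lin_cong[OF fpoly[OF e(2)]]) (use mY[OF j(1) e(1)] j(3) in auto)
        also have "\<dots> = lin (g (e, \<rho>)) p v"
          unfolding g_def line fst_conv snd_conv by (rule dline_diff_const[OF \<pi>, symmetric])
        also have "\<dots> = 0" using l0 e by auto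
        finally show ?thesis .
      qed
      then show "\<forall>i\<in>V c. v i = 0" using ns[OF j(1)] v unfolding singular_def by blast
    qed auto
    moreover have "card S = card {j\<in>J. pat j = z}"
      unfolding S_def by (intro card_image inj_on_subset[OF inj]) auto
    ultimately show ?thesis by (simp add: card_cartesian_product)
  qed
  have "J \<subseteq> (\<Union>z\<in>PiE spider_edges (\<lambda>_. Z). {j\<in>J. pat j = z})"
    using valZ by (auto simp: pat_def)
  then have "card J \<le> card (\<Union>z\<in>PiE spider_edges (\<lambda>_. Z). {j\<in>J. pat j = z})"
    using J finP by (intro card_mono) auto
  also have "\<dots> \<le> (\<Sum>z\<in>PiE spider_edges (\<lambda>_. Z). card {j\<in>J. pat j = z})"
    by (rule card_UN_le[OF finP])
  also have "\<dots> \<le> (\<Sum>z\<in>PiE spider_edges (\<lambda>_. Z). 2 ^ (card spider_edges * r) * \<delta> ^ card (V c))"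
    by (intro sum_mono group)
  also have "\<dots> = card Z ^ card spider_edges * (2 ^ (card spider_edges * r) * \<delta> ^ card (V c))"
    by (simp add: card_PiE)
  finally show ?thesis .
qed

section \<open>Copies of the subdivision as families of spiders\<close>

definition joint :: "(nat \<Rightarrow> 'k) \<Rightarrow> (nat \<Rightarrow> 'k) \<Rightarrow> bool \<times> nat \<Rightarrow> 'k" where
  "joint x y = (\<lambda>(h, m). if h then x m else y m)"

text \<open>The s paths ending at the j-th vertex of the larger index range form the j-th spider,
  with roots common to all j. T singular spiders would witness \<open>bad\<close>, and
  \<open>card_nonsingular\<close> bounds the others, so t is too large.\<close>

lemma copy_free:
  fixes \<mu> \<nu> :: "nat \<Rightarrow> nat \<Rightarrow> 'k"
  assumes f: "f \<in> polys"
    and nb: "\<not> bad True f" "\<not> bad False f"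
    and MN: "M \<inter> N = {}"
    and \<mu>: "\<mu> ` M \<subseteq> PiE {..<dm} (\<lambda>_. F)" "inj_on \<mu> M"
    and \<nu>: "\<nu> ` N \<subseteq> PiE {..<dn} (\<lambda>_. F)" "inj_on \<nu> N"
    and \<delta>: "\<And>c. \<delta> c = (card (V c) * d + 1) ^ card (V c)" "\<And>c. card F > \<delta> c"
    and t: "\<And>c. t \<ge> T + card Z ^ card spider_edges * (2 ^ (card spider_edges * r) * \<delta> c ^ card (V c))"
  shows "graph_free (M \<union> N, {{u, w} | u w. u \<in> M \<and> w \<in> N \<and> val f (joint (\<mu> u) (\<nu> w)) \<in> Z})
           (subdivision (2 * k + 1) (complete_bipartite s t))"
  unfolding graph_free_def contains_copy_def
proof
  let ?G = "(M \<union> N, {{u, w} | u w. u \<in> M \<and> w \<in> N \<and> val f (joint (\<mu> u) (\<nu> w)) \<in> Z})"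
  define L where "L = 2 * k + 1"
  let ?H = "subdivision L (complete_bipartite s t)"
  assume "\<exists>\<phi>. inj_on \<phi> (verts (subdivision (2 * k + 1) (complete_bipartite s t))) \<and>
    \<phi> ` verts (subdivision (2 * k + 1) (complete_bipartite s t)) \<subseteq> verts ?G \<and>
    (\<forall>e\<in>edges (subdivision (2 * k + 1) (complete_bipartite s t)). \<phi> ` e \<in> edges ?G)"
  then obtain \<phi> where \<phi>: "inj_on \<phi> (verts ?H)" "\<phi> ` verts ?H \<subseteq> verts ?G" "\<forall>e\<in>edges ?H. \<phi> ` e \<in> edges ?G"
    unfolding L_def by blast
  have L0: "L > 0" by (simp add: L_def)
  define pt where "pt i j p = subdiv_point L i (s + j) p" for i j p
  have ed: "{i, s + j} \<in> edges (complete_bipartite s t)" if "i < s" "j < t" for i j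
    unfolding complete_bipartite_def snd_conv mem_Collect_eq
    by (intro exI[of _ i] exI[of _ "s + j"]) (use that in auto)
  have ptv: "pt i j p \<in> verts ?H" if ij: "i < s" "j < t" and p: "p \<le> L" for i j p
    using ij p ed[OF ij] by (auto simp: pt_def subdiv_point_def subdivision_def complete_bipartite_def)
  have pte: "{pt i j p, pt i j (Suc p)} \<in> edges ?H" if ij: "i < s" "j < t" and p: "p < L" for i j p
    unfolding subdivision_def snd_conv mem_Collect_eq
    by (intro exI[of _ i] exI[of _ "s + j"] exI[of _ p]) (use ij p ed[OF ij] in \<open>auto simp: pt_def\<close>)
  have adj: "\<exists>u\<in>M. \<exists>w\<in>N. {\<phi> (pt i j p), \<phi> (pt i j (Suc p))} = {u, w} \<and> val f (joint (\<mu> u) (\<nu> w)) \<in> Z"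
    if ij: "i < s" "j < t" and p: "p < L" for i j p
    using \<phi>(3) pte[OF ij p] by fastforce
  have flip: "\<phi> (pt i j (Suc p)) \<in> M \<longleftrightarrow> \<phi> (pt i j p) \<notin> M" if ij: "i < s" "j < t" and p: "p < L" for i j p
    using adj[OF ij p] MN by (auto simp: doubleton_eq_iff)
  have par: "\<phi> (pt i j p) \<in> M \<longleftrightarrow> side (\<phi> (pt i j 0) \<in> M) p" if ij: "i < s" "j < t" and p: "p \<le> L" for i j p
    using p by (induction p) (use flip[OF ij] in \<open>auto simp: side_def\<close>)
  define c where "c = (\<phi> (pt 0 0 0) \<in> M)"
  have T1: "t > 0" using t[of True] T by linarith
  have pt0: "pt i j 0 = pt i 0 0" for i j by (simp add: pt_def subdiv_point_def)
  have ptL: "pt i j L = pt 0 j L" for i j using L0 by (simp add: pt_def subdiv_point_def)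
  \<comment> \<open>All roots lie on one side: the legs of a spider meet at its centre, and each
    changes side the same number L of times.\<close>
  have sideM: "\<phi> (pt i j p) \<in> M \<longleftrightarrow> side c p" if ij: "i < s" "j < t" and p: "p \<le> L" for i j p
  proof -
    have "side (\<phi> (pt i j 0) \<in> M) L = side (\<phi> (pt 0 j 0) \<in> M) L"
      using par[OF ij order_refl] par[of 0 j L] ij s ptL[of i j] by auto
    then have "(\<phi> (pt i j 0) \<in> M) = (\<phi> (pt 0 j 0) \<in> M)" by (auto simp: side_def)
    also have "\<dots> = c" unfolding c_def using pt0[of 0 j] by simp
    finally show ?thesis using par[OF ij p] by simp
  qed
  have inMN: "\<phi> (pt i j p) \<in> M \<union> N" if "i < s" "j < t" "p \<le> L" for i j p
    using \<phi>(2) ptv[OF that] by auto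
  define crd where "crd v = (if v \<in> M then \<mu> v else \<nu> v)" for v
  define Y where "Y j w = crd (\<phi> (pt (fst (fst w)) j (snd (fst w)))) (snd w)" for j w
  have node_pt: "pt (fst (node i p)) j (snd (node i p)) = pt i j p" for i j p
    using ptL[of i j] by (auto simp: node_def L_def)
  have crd_in: "crd (\<phi> (pt i j p)) \<in> PiE {..<dimn (side c p)} (\<lambda>_. F)" if ij: "i < s" "j < t" and p: "p \<le> L" for i j p
  proof (cases "\<phi> (pt i j p) \<in> M")
    case True
    then show ?thesis using \<mu>(1) sideM[OF that] by (auto simp: crd_def dimn_def)
  next
    case False
    then have "\<phi> (pt i j p) \<in> N" using inMN[OF that] by auto
    then show ?thesis using \<nu>(1) sideM[OF that] False by (auto simp: crd_def dimn_def)
  qed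
  have crd_inj: "pt i j p = pt i' j' p'"
    if ij: "i < s" "j < t" "p \<le> L" "i' < s" "j' < t" "p' \<le> L" and sd: "side c p = side c p'"
      and eq: "\<And>m. m < dimn (side c p) \<Longrightarrow> crd (\<phi> (pt i j p)) m = crd (\<phi> (pt i' j' p')) m" for i j p i' j' p'
  proof -
    have "crd (\<phi> (pt i j p)) = crd (\<phi> (pt i' j' p'))"
      by (rule PiE_ext[OF crd_in[OF ij(1-3)]]) (use crd_in[OF ij(4-6)] sd eq in auto)
    then have "\<phi> (pt i j p) = \<phi> (pt i' j' p')"
      using sideM[OF ij(1-3)] sideM[OF ij(4-6)] sd inMN[OF ij(1-3)] inMN[OF ij(4-6)] \<mu>(2) \<nu>(2)
      by (auto simp: crd_def inj_on_def split: if_splits)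
    then show ?thesis using \<phi>(1) ptv[OF ij(1-3)] ptv[OF ij(4-6)] by (auto simp: inj_on_def)
  qed
  have YF: "Y j w \<in> F" if j: "j < t" and w: "w \<in> R c \<union> V c" for j w
  proof -
    have "snd (fst w) \<le> L" "fst (fst w) < s" "snd w < dimn (side c (snd (fst w)))"
      using w s by (auto simp: coords_def inner_def L_def)
    then show ?thesis using PiE_mem[OF crd_in[of "fst (fst w)" j "snd (fst w)"]] j by (auto simp: Y_def)
  qed
  have root: "Y j w = Y 0 w" if "w \<in> R c" for j w
    using that pt0[of "fst (fst w)" j] by (auto simp: coords_def Y_def)
  have ept: "edge_pt c (Y j) (i, p) = (\<lambda>(h, m). crd (\<phi> (pt i j (if h = side c p then p else Suc p))) m)" for i j p
    by (auto simp: edge_pt_def Y_def node_pt fun_eq_iff)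
  have valZ: "val f (edge_pt c (Y j) e) \<in> Z" if j: "j < t" and e: "e \<in> spider_edges" for j e
  proof -
    obtain i p where ip: "e = (i, p)" "i < s" "p < L" using e by (auto simp: spider_edges_def L_def)
    obtain u w where uw: "u \<in> M" "w \<in> N" "{\<phi> (pt i j p), \<phi> (pt i j (Suc p))} = {u, w}" "val f (joint (\<mu> u) (\<nu> w)) \<in> Z"
      using adj[OF ip(2) j ip(3)] by blast
    have "w \<notin> M" using uw(2) MN by auto
    have sp: "\<phi> (pt i j p) \<in> M \<longleftrightarrow> side c p" using sideM[OF ip(2) j, of p] ip(3) by simp
    have "edge_pt c (Y j) e = joint (\<mu> u) (\<nu> w)"
      unfolding ip(1) ept joint_def
      using uw(1,3) sp \<open>w \<notin> M\<close> by (cases "side c p") (auto simp: fun_eq_iff crd_def doubleton_eq_iff)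
    then show ?thesis using uw(4) by simp
  qed
  have edge_eq: "(j, e) = (j', e')"
    if j: "j < t" "j' < t" and e: "e \<in> spider_edges" "e' \<in> spider_edges"
      and eq: "\<And>w. w \<in> W \<Longrightarrow> edge_pt c (Y j) e w = edge_pt c (Y j') e' w" for j j' e e'
  proof -
    obtain i p where ip: "e = (i, p)" "i < s" "p < L" using e by (auto simp: spider_edges_def L_def)
    obtain i' p' where ip': "e' = (i', p')" "i' < s" "p' < L" using e by (auto simp: spider_edges_def L_def)
    define P where "P h = (if h = side c p then p else Suc p)" for h
    define P' where "P' h = (if h = side c p' then p' else Suc p')" for h
    have sP: "side c (P h) = h" "side c (P' h) = h" "P h \<le> L" "P' h \<le> L" for h
      using ip(3) ip'(3) by (auto simp: P_def P'_def side_def)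
    have pteq: "pt i j (P h) = pt i' j' (P' h)" for h
    proof (rule crd_inj[OF ip(2) j(1) sP(3) ip'(2) j(2) sP(4)])
      show "side c (P h) = side c (P' h)" by (simp add: sP)
      fix m assume "m < dimn (side c (P h))"
      then have "(h, m) \<in> W" by (simp add: sP W_def)
      then show "crd (\<phi> (pt i j (P h))) m = crd (\<phi> (pt i' j' (P' h))) m"
        using eq[of "(h, m)"] unfolding ip(1) ip'(1) ept by (simp add: P_def P'_def)
    qed
    have PP: "P h = P' h" "P h < L \<Longrightarrow> i = i'" "P h > 0 \<Longrightarrow> j = j'" for h
      using subdiv_point_inj[OF pteq[of h, unfolded pt_def] ip(2) ip'(2) sP(3,4) L0] by auto
    have pp: "p = p'"
    proof (cases "side c p = side c p'")
      case True
      then show ?thesis using PP(1)[of "side c p"] by (simp add: P_def P'_def)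
    next
      case False
      then show ?thesis using PP(1)[of "side c p"] PP(1)[of "side c p'"] by (auto simp: P_def P'_def)
    qed
    \<comment> \<open>The lower end of an edge is not a centre and determines the leg; the upper end
      is not a root and determines the spider.\<close>
    have "i = i'" using PP(2)[of "side c p"] ip(3) by (simp add: P_def)
    moreover have "j = j'" using PP(3)[of "\<not> side c p"] by (simp add: P_def)
    ultimately show ?thesis using pp ip(1) ip'(1) by simp
  qed
  define Sg where "Sg = {j\<in>{..<t}. singular c f (Y j)}"
  have finS: "finite Sg" by (simp add: Sg_def)
  have "card Sg < T"
  proof (rule ccontr)
    assume "\<not> card Sg < T"
    then obtain S' where S': "S' \<subseteq> Sg" "card S' = T" "finite S'"
      by (metis obtain_subset_with_card_n not_less)
    obtain \<iota> where \<iota>: "bij_betw \<iota> {0..<T} S'" using ex_bij_betw_nat_finite[OF S'(3)] S'(2) by auto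
    have \<iota>S: "\<iota> j < t" "singular c f (Y (\<iota> j))" if "j < T" for j
      using bij_betwE[OF \<iota>] S'(1) that by (auto simp: Sg_def)
    have "bad c f"
      unfolding bad_def
    proof (intro exI[of _ "\<lambda>j. Y (\<iota> j)"] conjI allI impI ballI)
      show "Y (\<iota> j) w \<in> F" if "j < T" "w \<in> R c \<union> V c" for j w using YF \<iota>S that by blast
      show "Y (\<iota> j) w = Y (\<iota> 0) w" if "w \<in> R c" for j w using root[OF that] by metis
      show "val f (edge_pt c (Y (\<iota> (fst x))) (snd x)) \<in> Z" if "x \<in> slots" for x
        using that valZ \<iota>S by (auto simp: slots_def)
      show "singular c f (Y (\<iota> j))" if "j < T" for j using \<iota>S that by blast
      show "separated c (\<lambda>j. Y (\<iota> j))"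
        unfolding separated_def
      proof (intro ballI impI, rule ccontr)
        fix x y assume x: "x \<in> slots" and y: "y \<in> slots" and "x \<noteq> y"
          and "\<not> (\<exists>w\<in>W. edge_pt c (Y (\<iota> (fst x))) (snd x) w \<noteq> edge_pt c (Y (\<iota> (fst y))) (snd y) w)"
        then have "(\<iota> (fst x), snd x) = (\<iota> (fst y), snd y)"
          by (intro edge_eq) (auto simp: slots_def \<iota>S)
        moreover have "inj_on \<iota> {0..<T}" using \<iota> by (rule bij_betw_imp_inj_on)
        ultimately have "x = y" using x y by (auto simp: slots_def inj_on_def prod_eq_iff)
        then show False using \<open>x \<noteq> y\<close> by simp
      qed
    qed
    then show False using nb by (cases c) auto
  qed
  moreover have "card ({..<t} - Sg) \<le> card Z ^ card spider_edges * (2 ^ (card spider_edges * r) * \<delta> c ^ card (V c))"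
  proof (rule card_nonsingular[where Y = Y and u = "Y 0", OF f])
    show "inj_on (\<lambda>j. restrict (Y j) (V c)) ({..<t} - Sg)"
    proof (rule inj_onI)
      fix j j' assume j: "j \<in> {..<t} - Sg" "j' \<in> {..<t} - Sg" "restrict (Y j) (V c) = restrict (Y j') (V c)"
      \<comment> \<open>The centre is a free vertex that identifies its spider.\<close>
      have "pt 0 j L = pt 0 j' L"
      proof (rule crd_inj)
        fix m assume m: "m < dimn (side c L)"
        then have "((0, L), m) \<in> V c" by (auto simp: coords_def inner_def L_def)
        then have "Y j ((0, L), m) = Y j' ((0, L), m)" using fun_cong[OF j(3), of "((0, L), m)"] by simp
        then show "crd (\<phi> (pt 0 j L)) m = crd (\<phi> (pt 0 j' L)) m" by (simp add: Y_def)
      qed (use j s in auto)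
      then show "j = j'" using L0 by (simp add: pt_def subdiv_point_def)
    qed
    show "Y j w = Y 0 w" if "w \<in> R c" for j w using root[OF that] .
    show "\<delta> c = (card (V c) * d + 1) ^ card (V c)" by (rule \<delta>(1))
    show "\<delta> c < card F" by (rule \<delta>(2))
  qed (use YF valZ in \<open>auto simp: Sg_def\<close>)
  moreover have "card ({..<t} - Sg) = t - card Sg"
    using finS by (subst card_Diff_subset) (auto simp: Sg_def)
  ultimately show False using t[of c] by linarith
qed

text \<open>The case of one point and no derivatives, with the unit type as index: the value vector
  is uniform on F^r.\<close>

lemma card_val:
  assumes "x \<in> PiE {..<dm} (\<lambda>_. F)" "y \<in> PiE {..<dn} (\<lambda>_. F)"
  shows "card {f \<in> polys. val f (joint x y) \<in> Z} * card F ^ r = card Z * card (PF W d) ^ r"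
proof -
  have finZ: "finite Z" using Z by (rule finite_subset) (intro finite_PiE, auto)
  have xyF: "joint x y w \<in> F" if "w \<in> W" for w
    using assms that by (auto simp: joint_def W_def dimn_def dest: PiE_mem split: if_splits)
  have fib: "card {f \<in> polys. val f (joint x y) = z} * card F ^ r = card (PF W d) ^ r" if z: "z \<in> Z" for z
  proof -
    define C where "C = (\<lambda>\<rho>. {g \<in> PF W d. (\<forall>a\<in>{()}. g (joint x y) = z \<rho>) \<and> (\<forall>a\<in>({} :: unit set). lin g (joint x y) (joint x y) = 0)})"
    have zE: "z \<in> PiE {..<r} (\<lambda>_. F)" using z Z by blast
    have C: "card (C \<rho>) * card F ^ (card {()} + card ({} :: unit set)) = card (PF W d)" if \<rho>: "\<rho> < r" for \<rho>
      unfolding C_def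
    proof (rule card_constrained[where P = "\<lambda>_. joint x y" and v = "\<lambda>_. joint x y" and z = "\<lambda>_. z \<rho>"])
      show "z \<rho> \<in> F" using PiE_mem[OF zE] \<rho> by auto
    qed (use d xyF in auto)
    have "{f \<in> polys. val f (joint x y) = z} = PiE {..<r} C"
    proof (intro equalityI subsetI)
      fix f assume "f \<in> {f \<in> polys. val f (joint x y) = z}"
      then have f: "f \<in> polys" "val f (joint x y) = z" by auto
      have "f \<rho> (joint x y) = z \<rho>" if "\<rho> < r" for \<rho>
        using fun_cong[OF f(2), of \<rho>] that by (simp add: val_def)
      then show "f \<in> PiE {..<r} C" using f(1) by (auto simp: C_def PiE_iff)
    next
      fix f assume f: "f \<in> PiE {..<r} C"
      then have "val f (joint x y) = z"
        using zE by (auto simp: val_def C_def PiE_iff fun_eq_iff extensional_def)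
      then show "f \<in> {f \<in> polys. val f (joint x y) = z}" using f by (auto simp: C_def PiE_iff)
    qed
    then have "card {f \<in> polys. val f (joint x y) = z} * card F ^ r = (\<Prod>\<rho><r. card (C \<rho>) * card F)"
      by (simp add: card_PiE prod.distrib)
    also have "\<dots> = (\<Prod>\<rho><r. card (PF W d))" by (intro prod.cong refl) (use C in auto)
    finally show ?thesis by simp
  qed
  have "{f \<in> polys. val f (joint x y) \<in> Z} = (\<Union>z\<in>Z. {f \<in> polys. val f (joint x y) = z})" by auto
  then have "card {f \<in> polys. val f (joint x y) \<in> Z} = (\<Sum>z\<in>Z. card {f \<in> polys. val f (joint x y) = z})"
    using finZ by (simp only:) (intro card_UN_disjoint, auto)
  then have "card {f \<in> polys. val f (joint x y) \<in> Z} * card F ^ r = (\<Sum>z\<in>Z. card {f \<in> polys. val f (joint x y) = z} * card F ^ r)"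
    by (simp add: sum_distrib_right)
  also have "\<dots> = (\<Sum>z\<in>Z. card (PF W d) ^ r)" by (intro sum.cong refl fib)
  finally show ?thesis by simp
qed

text \<open>The mean number of edges is 2h. The bad families form a share of at most 1/(2|F|^r), so
  even with all possible edges each they contribute no more than h to the mean; some family that is
  not bad therefore reaches h.\<close>

lemma exists_good:
  assumes Mp: "Mp \<subseteq> PiE {..<dm} (\<lambda>_. F)" and Np: "Np \<subseteq> PiE {..<dn} (\<lambda>_. F)"
    and TT: "T = s * dn + r + 1"
    and C: "\<And>c. C c = (2 ^ card inner * card (V c)) ^ T * card Z ^ card slots"
    and Q: "card F \<ge> 2 * (C True + C False)" and Z1: "card Z \<ge> 1"
  obtains f where "f \<in> polys" "\<not> bad True f" "\<not> bad False f"
    "real (card {q \<in> Mp \<times> Np. val f (joint (fst q) (snd q)) \<in> Z}) \<ge>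
       1 / 2 * (real (card Mp) * real (card Np) * real (card Z) / real (card F) ^ r)"
proof -
  define P where "P = card (PF W d) ^ r"
  define Qr where "Qr = real (card F) ^ r"
  define B where "B = {f \<in> polys. bad True f \<or> bad False f}"
  define e where "e f = card {q \<in> Mp \<times> Np. val f (joint (fst q) (snd q)) \<in> Z}" for f
  define h where "h = 1 / 2 * (real (card Mp) * real (card Np) * real (card Z) / Qr)"
  have finMN: "finite (Mp \<times> Np)"
    using finite_subset[OF Mp finite_PiE] finite_subset[OF Np finite_PiE] by simp
  have F0: "card F > 0" using card_F_gt_1 by linarith
  have Qr0: "Qr > 0" using F0 by (simp add: Qr_def)
  have "(\<lambda>x. 0) \<in> PF W d" by (auto simp: PF_def intro: polyf.const)
  then have P0: "P > 0" using PF_bound(1)[OF finite_W, of d] by (auto simp: P_def card_gt_0_iff)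
  have cardP: "card polys = P" by (simp add: card_PiE P_def)
  have badc: "card {f \<in> polys. bad c f} * card F ^ (r + 1) \<le> C c * P" for c
  proof -
    \<comment> \<open>The roots have at most \<open>s * dn\<close> coordinates, so of the T saved
      factors r + 1 survive: r match the edge density and one absorbs the constant.\<close>
    have "card (R c) \<le> (\<Sum>w\<in>{..<s} \<times> {0 :: nat}. dn)"
      using dm_le_dn by (subst card_coords, simp, intro sum_mono) (simp add: dimn_def)
    then have "card (R c) \<le> s * dn" by (simp add: card_cartesian_product)
    then have "card F ^ card (R c) \<le> card F ^ (s * dn)" using F0 by (intro power_increasing) auto
    then have "card {f \<in> polys. bad c f} * card F ^ T \<le> C c * card F ^ (s * dn) * P"
      using card_bad[of c] unfolding C P_def
      by (meson mult_le_mono1 mult_le_mono2 order_trans)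
    then have "(card {f \<in> polys. bad c f} * card F ^ (r + 1)) * card F ^ (s * dn) \<le> (C c * P) * card F ^ (s * dn)"
      unfolding TT by (simp add: power_add mult_ac)
    then show ?thesis using F0 by simp
  qed
  have "card B \<le> card {f \<in> polys. bad True f} + card {f \<in> polys. bad False f}"
  proof -
    have "B = {f \<in> polys. bad True f} \<union> {f \<in> polys. bad False f}" by (auto simp: B_def)
    then show ?thesis by (simp add: card_Un_le)
  qed
  then have "card B * card F ^ (r + 1) \<le> (card {f \<in> polys. bad True f} + card {f \<in> polys. bad False f}) * card F ^ (r + 1)"
    by (intro mult_right_mono) auto
  also have "\<dots> \<le> (C True + C False) * P"
    using badc[of True] badc[of False] by (simp add: add_mult_distrib)
  finally have "2 * (card B * card F ^ (r + 1)) \<le> (2 * (C True + C False)) * P"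
    by (simp only: mult.assoc mult_le_mono2)
  also have "\<dots> \<le> card F * P" using Q by (intro mult_right_mono) auto
  finally have "(2 * (card B * card F ^ r)) * card F \<le> P * card F" by (simp add: mult_ac)
  then have "2 * (card B * card F ^ r) \<le> P" using F0 by simp
  then have "real (2 * (card B * card F ^ r)) \<le> real P" by linarith
  then have Bb: "2 * (real (card B) * Qr) \<le> real P" by (simp add: Qr_def)
  have sum_e: "(\<Sum>f\<in>polys. real (e f)) = 2 * h * real P"
  proof -
    have "(\<Sum>f\<in>polys. e f) = (\<Sum>f\<in>polys. \<Sum>q\<in>Mp \<times> Np. if val f (joint (fst q) (snd q)) \<in> Z then 1 else 0)"
      unfolding e_def using finMN by (intro sum.cong refl) (simp flip: sum.inter_filter)
    also have "\<dots> = (\<Sum>q\<in>Mp \<times> Np. \<Sum>f\<in>polys. if val f (joint (fst q) (snd q)) \<in> Z then 1 else 0)"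
      by (rule sum.swap)
    also have "\<dots> = (\<Sum>q\<in>Mp \<times> Np. card {f \<in> polys. val f (joint (fst q) (snd q)) \<in> Z})"
      by (intro sum.cong refl) (simp flip: sum.inter_filter)
    finally have "(\<Sum>f\<in>polys. e f) * card F ^ r = (\<Sum>q\<in>Mp \<times> Np. card {f \<in> polys. val f (joint (fst q) (snd q)) \<in> Z} * card F ^ r)"
      by (simp add: sum_distrib_right)
    also have "\<dots> = (\<Sum>q\<in>Mp \<times> Np. card Z * P)"
      unfolding P_def by (intro sum.cong refl card_val subsetD[OF Mp] subsetD[OF Np]) (simp_all add: mem_Times_iff)
    finally have "real ((\<Sum>f\<in>polys. e f) * card F ^ r) = real (card (Mp \<times> Np) * (card Z * P))" by simp
    then have "(\<Sum>f\<in>polys. real (e f)) * Qr = real (card Mp) * real (card Np) * real (card Z) * real P"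
      by (simp add: Qr_def card_cartesian_product)
    then show ?thesis using Qr0 by (simp add: h_def field_simps)
  qed
  have "\<exists>f\<in>polys - B. real (e f) \<ge> h"
  proof (rule ccontr)
    assume neg: "\<not> (\<exists>f\<in>polys - B. real (e f) \<ge> h)"
    have finB: "finite B" "B \<subseteq> polys" by (auto simp: B_def)
    have "real (card B) < real P"
    proof -
      have "Qr \<ge> 1" using F0 by (simp add: Qr_def)
      then have "real (card B) * 1 \<le> real (card B) * Qr" by (intro mult_left_mono) auto
      then show ?thesis using Bb P0 by linarith
    qed
    then have ne: "polys - B \<noteq> {}" using cardP finB by auto
    have "(\<Sum>f\<in>B. real (e f)) \<le> (\<Sum>f\<in>B. real (card Mp) * real (card Np))"
    proof (intro sum_mono)
      fix f
      have "e f \<le> card (Mp \<times> Np)" unfolding e_def using finMN by (intro card_mono) auto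
      then show "real (e f) \<le> real (card Mp) * real (card Np)"
        by (metis card_cartesian_product of_nat_le_iff of_nat_mult)
    qed
    also have "\<dots> = real (card B) * (real (card Mp) * real (card Np))" by simp
    also have "\<dots> \<le> (real P / (2 * Qr)) * (real (card Mp) * real (card Np))"
      using Bb Qr0 by (intro mult_right_mono) (auto simp: field_simps)
    also have "\<dots> \<le> (real P / (2 * Qr)) * (real (card Mp) * real (card Np)) * real (card Z)"
      using Z1 Qr0 mult_left_mono[of 1 "real (card Z)" "(real P / (2 * Qr)) * (real (card Mp) * real (card Np))"] by simp
    also have "\<dots> = h * real P" by (simp add: h_def)
    finally have 1: "(\<Sum>f\<in>B. real (e f)) \<le> h * real P" .
    have "(\<Sum>f\<in>polys - B. real (e f)) < (\<Sum>f\<in>polys - B. h)"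
      using ne neg by (intro sum_strict_mono) (auto simp: not_le)
    also have "\<dots> = real (card (polys - B)) * h" by simp
    also have "\<dots> \<le> real P * h"
    proof (intro mult_right_mono)
      show "real (card (polys - B)) \<le> real P" unfolding cardP[symmetric] by (simp add: card_mono)
      show "0 \<le> h" using Qr0 by (simp add: h_def)
    qed
    finally have 2: "(\<Sum>f\<in>polys - B. real (e f)) < real P * h" .
    have "(\<Sum>f\<in>polys. real (e f)) = (\<Sum>f\<in>polys - B. real (e f)) + (\<Sum>f\<in>B. real (e f))"
      by (rule sum.subset_diff[OF finB(2)]) simp
    then show False using 1 2 sum_e by (simp add: mult_ac)
  qed
  then obtain f where "f \<in> polys - B" "real (e f) \<ge> h" by blast
  then show ?thesis by (intro that[of f]) (auto simp: B_def e_def h_def Qr_def)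
qed

end

section \<open>Choice of the parameters and final assembly\<close>

lemma power_of_two_between:
  fixes q :: nat
  assumes "q \<ge> 2"
  obtains e where "e > 0" "q \<le> 2 ^ e" "2 ^ e < 2 * q"
proof -
  define e where "e = (LEAST e. q \<le> 2 ^ e)"
  have q: "q \<le> 2 ^ e"
    unfolding e_def by (rule LeastI[of _ q]) (simp add: less_imp_le)
  have e0: "e > 0" using q assms by (cases e) auto
  have "\<not> q \<le> 2 ^ (e - 1)"
    using not_less_Least[of "e - 1" "\<lambda>e. q \<le> 2 ^ e"] e0 by (simp add: e_def)
  then have "2 ^ e < 2 * q" using e0 by (cases e) auto
  with q e0 that show ?thesis by blast
qed

lemma card_bipartite_edges:
  assumes MN: "M \<inter> N = {}" and \<mu>: "bij_betw \<mu> M Mp" and \<nu>: "bij_betw \<nu> N Np"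
  shows "card {{u, w} | u w. u \<in> M \<and> w \<in> N \<and> P (\<mu> u) (\<nu> w)} = card {q \<in> Mp \<times> Np. P (fst q) (snd q)}"
proof -
  let ?A = "{q \<in> M \<times> N. P (\<mu> (fst q)) (\<nu> (snd q))}"
  have "{{u, w} | u w. u \<in> M \<and> w \<in> N \<and> P (\<mu> u) (\<nu> w)} = (\<lambda>(u, w). {u, w}) ` ?A" by force
  moreover have "inj_on (\<lambda>(u, w). {u, w}) ?A"
    using MN by (auto simp: inj_on_def doubleton_eq_iff)
  moreover have "bij_betw (map_prod \<mu> \<nu>) ?A {q \<in> Mp \<times> Np. P (fst q) (snd q)}"
    unfolding bij_betw_def
  proof
    show "inj_on (map_prod \<mu> \<nu>) ?A"
      by (rule inj_on_subset[OF map_prod_inj_on[OF bij_betw_imp_inj_on[OF \<mu>] bij_betw_imp_inj_on[OF \<nu>]]]) auto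
    show "map_prod \<mu> \<nu> ` ?A = {q \<in> Mp \<times> Np. P (fst q) (snd q)}"
      using bij_betw_imp_surj_on[OF \<mu>] bij_betw_imp_surj_on[OF \<nu>] by (auto simp: image_iff)
  qed
  ultimately show ?thesis by (simp add: card_image bij_betw_same_card)
qed

text \<open>Integrality makes l and \<alpha> l the multiples a and b of (2k + 1)s, and the bounds on
  \<alpha> = b/a become the assumptions \<open>ba\<close> and \<open>ratio\<close>.\<close>

lemma theorem5p9_parameters:
  fixes k s l :: nat and \<alpha> :: real
  assumes "s \<ge> 1" and "\<alpha> \<in> \<rat>"
    and \<alpha>: "\<alpha> \<in> {(real k * real s + 1) / (real k * real s + real s)..1}"
    and l: "l = (LEAST m::nat. 0 < m \<and> real m / ((2 * real k + 1) * real s) \<in> \<int>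
                \<and> \<alpha> * real m / ((2 * real k + 1) * real s) \<in> \<int>)"
  obtains a b where "l = (2 * k + 1) * s * a" "\<alpha> * real l = real ((2 * k + 1) * s * b)" "spider k s a b"
proof -
  define D where "D = (2 * k + 1) * s"
  have D0: "D > 0" using assms(1) by (simp add: D_def)
  have rD: "(2 * real k + 1) * real s = real D" by (simp add: D_def algebra_simps)
  have ks0: "real k * real s + real s > 0" using assms(1) by (simp add: add_nonneg_pos)
  have "(real k * real s + 1) / (real k * real s + real s) > 0"
    using ks0 by (simp add: add_nonneg_pos)
  then have \<alpha>0: "\<alpha> > 0" using \<alpha> by auto
  obtain x y :: int where xy: "y > 0" "\<alpha> = of_int x / of_int y"
    using Rats_cases'[OF assms(2)] by metis
  \<comment> \<open>A denominator of \<alpha> times D is a witness, so the least element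
    exists.\<close>
  have "0 < nat y * D \<and> real (nat y * D) / real D \<in> \<int> \<and> \<alpha> * real (nat y * D) / real D \<in> \<int>"
    using xy D0 by auto
  then have "0 < l \<and> real l / real D \<in> \<int> \<and> \<alpha> * real l / real D \<in> \<int>"
    unfolding l rD by (rule LeastI)
  then obtain a' b' :: int where ab': "0 < l" "real l / real D = of_int a'" "\<alpha> * real l / real D = of_int b'"
    by (auto elim!: Ints_cases)
  have "of_int a' > (0 :: real)" using ab'(1) D0 by (simp flip: ab'(2))
  then have a0: "a' > 0" by simp
  have "of_int b' > (0 :: real)" using ab'(1) D0 \<alpha>0 by (simp flip: ab'(3))
  then have b0: "b' > 0" by simp
  define a where "a = nat a'"
  define b where "b = nat b'"
  have la: "real l = real D * real a" using ab'(2) a0 D0 by (simp add: a_def field_simps)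
  then have l_eq: "l = D * a" by (metis of_nat_eq_iff of_nat_mult)
  have lb: "\<alpha> * real l = real D * real b" using ab'(3) b0 D0 by (simp add: b_def field_simps)
  then have \<alpha>ab: "\<alpha> * real a = real b" using la D0 by (simp add: mult_ac)
  have "spider k s a b"
  proof
    show "1 \<le> s" by fact
    show "1 \<le> a" using a0 by (simp add: a_def)
    have "real b \<le> 1 * real a" unfolding \<alpha>ab[symmetric] using \<alpha> by (intro mult_right_mono) auto
    then show "b \<le> a" by simp
    have "(real k * real s + 1) \<le> \<alpha> * (real k * real s + real s)"
      using \<alpha> ks0 by (simp add: pos_divide_le_eq)
    then have "real a * (real k * real s + 1) \<le> real a * (\<alpha> * (real k * real s + real s))"
      by (intro mult_left_mono) auto
    also have "\<dots> = real b * (real k * real s + real s)" by (simp flip: \<alpha>ab)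
    finally have "real (a * (k * s + 1)) \<le> real (b * ((k + 1) * s))" by (simp add: algebra_simps)
    then show "a * (k * s + 1) \<le> b * ((k + 1) * s)" by (simp only: of_nat_le_iff)
  qed
  then show ?thesis using that[of a b] l_eq lb by (simp add: D_def mult_ac)
qed

theorem theorem5p9:
  fixes k s l :: nat and \<alpha> :: real
  assumes "k \<ge> 2" and "s \<ge> 1"
    and "\<alpha> \<in> \<rat>"
    and "\<alpha> \<in> {(real k * real s + 1) / (real k * real s + real s)..1}"
    and "l = (LEAST m::nat. 0 < m \<and> real m / ((2 * real k + 1) * real s) \<in> \<int>
                \<and> \<alpha> * real m / ((2 * real k + 1) * real s) \<in> \<int>)"
  shows "\<exists>t0 q0 :: nat. \<forall>t \<ge> t0. \<forall>q :: nat. q \<ge> q0 \<longrightarrow> primepow q \<longrightarrow>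
    (\<exists>(G :: nat ugraph) M N.
       bipartite_graph G M N \<and>
       real (card M) = real q powr (\<alpha> * real l) \<and>
       card N = q ^ l \<and>
       graph_free G (subdivision (2 * k + 1) (complete_bipartite s t)) \<and>
       real (card (edges G)) \<ge>
         1 / 2 * real (card M) powr (1 - real k / (2 * real k + 1))
               * real (card N) powr (1 - real k / (2 * real k + 1) - 1 / ((2 * real k + 1) * real s)))"
proof -
  obtain a b where l: "l = (2 * k + 1) * s * a" "\<alpha> * real l = real ((2 * k + 1) * s * b)" and "spider k s a b"
    using theorem5p9_parameters[OF assms(2-5)] by blast
  then interpret spider k s a b by blast
  have l_dn: "l = dn" by (simp add: l(1) dn_def)
  have l_dm: "\<alpha> * real l = real dm" by (simp only: l(2) dm_def)
  define T where "T = s * dn + r + 1"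
  define E where "E = card spider_edges"
  define n where "n c = (\<Sum>w\<in>inner. dimn (side c (snd w)))" for c
  define d where "d = 2 * (T * E) + 2"
  define \<delta> where "\<delta> c = (n c * d + 1) ^ n c" for c
  define C where "C c = (2 ^ card inner * n c) ^ T * (2 ^ r) ^ (T * E)" for c
  \<comment> \<open>T accounts for singular spiders and the product for nonsingular ones, with
    \<open>card Z = 2 ^ r\<close>. Roots may lie in either part, so the thresholds for both values
    of c are added below.\<close>
  define t0 where "t0 c = T + (2 ^ r) ^ E * (2 ^ (E * r) * \<delta> c ^ n c)" for c
  show ?thesis
  proof (rule exI[of _ "t0 True + t0 False"], rule exI[of _ "2 * (C True + C False) + \<delta> True + \<delta> False + 2"],
      intro allI impI)
    fix t q :: nat
    assume t: "t0 True + t0 False \<le> t" and q: "2 * (C True + C False) + \<delta> True + \<delta> False + 2 \<le> q"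
    have q2: "q \<ge> 2" using q by linarith
    obtain e where e: "e > 0" "q \<le> 2 ^ e" "2 ^ e < 2 * q" using power_of_two_between[OF q2] by blast
    define F where "F = {x :: bit alg_closure. x ^ (2 ^ e) = x}"
    interpret finite_subfield F unfolding F_def by (rule finite_subfield_fixed_points[OF e(1)])
    have cF: "card F = 2 ^ e" unfolding F_def by (rule card_fixed_points_frobenius[OF e(1)])
    have cPiE: "card (PiE {..<m} (\<lambda>_. F)) = (2 ^ e) ^ m" for m by (simp add: card_PiE cF)
    have "(2::nat) \<le> 2 ^ e" using q2 e by linarith
    then have "2 ^ r \<le> card (PiE {..<r} (\<lambda>_. F))" unfolding cPiE by (intro power_mono) auto
    \<comment> \<open>Any 2^r value vectors serve: an edge then has probability 2^r / |F|^r, which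
      is at least q^(-r) because |F| < 2q.\<close>
    then obtain Z where Z': "Z \<subseteq> PiE {..<r} (\<lambda>_. F)" "card Z = 2 ^ r"
      using obtain_subset_with_card_n by metis
    interpret random_construction F k s a b T d Z
      by unfold_locales (auto simp: T_def d_def E_def Z')
    have cV: "card (V c) = n c" for c by (simp add: card_coords n_def)
    \<comment> \<open>The parts need exact powers of q as sizes, while |F| is only at least q;
      subsets of the point spaces are used.\<close>
    have "q ^ dm \<le> card (PiE {..<dm} (\<lambda>_. F))" unfolding cPiE using e by (intro power_mono) auto
    then obtain Mp where Mp: "Mp \<subseteq> PiE {..<dm} (\<lambda>_. F)" "card Mp = q ^ dm" "finite Mp"
      using obtain_subset_with_card_n by metis
    have "q ^ dn \<le> card (PiE {..<dn} (\<lambda>_. F))" unfolding cPiE using e by (intro power_mono) auto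
    then obtain Np where Np: "Np \<subseteq> PiE {..<dn} (\<lambda>_. F)" "card Np = q ^ dn" "finite Np"
      using obtain_subset_with_card_n by metis
    have slots: "card slots = T * E" by (simp add: slots_def card_cartesian_product E_def)
    obtain f where f: "f \<in> polys" "\<not> bad True f" "\<not> bad False f"
      "real (card {q \<in> Mp \<times> Np. val f (joint (fst q) (snd q)) \<in> Z}) \<ge>
       1 / 2 * (real (card Mp) * real (card Np) * real (card Z) / real (card F) ^ r)"
    proof (rule exists_good[OF Mp(1) Np(1), of C])
      show "T = s * dn + r + 1" by (rule T_def)
      show "C c = (2 ^ card inner * card (V c)) ^ T * card Z ^ card slots" for c
        by (simp add: C_def cV Z'(2) slots)
      show "2 * (C True + C False) \<le> card F" using q e unfolding cF by linarith
      show "1 \<le> card Z" by (simp add: Z'(2))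
    qed
    define M where "M = {0..<q ^ dm}"
    define N where "N = {q ^ dm..<q ^ dm + q ^ dn}"
    have MN: "M \<inter> N = {}" by (auto simp: M_def N_def)
    obtain \<mu> where \<mu>: "bij_betw \<mu> M Mp"
      using ex_bij_betw_nat_finite[OF Mp(3)] Mp(2) by (auto simp: M_def)
    have "card N = card Np" by (simp add: N_def Np)
    then obtain \<nu> where \<nu>: "bij_betw \<nu> N Np"
      using Np(3) finite_same_card_bij[of N Np] by (auto simp: N_def)
    define G where "G = (M \<union> N, {{u, w} | u w. u \<in> M \<and> w \<in> N \<and> val f (joint (\<mu> u) (\<nu> w)) \<in> Z})"
    have "bipartite_graph G M N"
      unfolding bipartite_graph_def simple_graph_def
    proof (intro conjI ballI)
      fix x assume "x \<in> edges G"
      then obtain u w where x: "x = {u, w}" "u \<in> M" "w \<in> N" by (auto simp: G_def)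
      then have "u \<noteq> w" using MN by auto
      with x show "x \<subseteq> verts G" "card x = 2" "\<exists>u\<in>M. \<exists>v\<in>N. x = {u, v}" by (auto simp: G_def)
    qed (auto simp: G_def M_def N_def)
    moreover have cM: "card M = q ^ dm" "card N = q ^ dn" by (auto simp: M_def N_def)
    moreover have "real (q ^ dm) = real q powr (\<alpha> * real l)"
      unfolding l_dm using q2 by (simp add: powr_realpow)
    moreover have "graph_free G (subdivision (2 * k + 1) (complete_bipartite s t))"
      unfolding G_def
    proof (rule copy_free[OF f(1) f(2,3) MN, where \<delta> = \<delta>])
      show "\<mu> ` M \<subseteq> PiE {..<dm} (\<lambda>_. F)" using Mp(1) bij_betw_imp_surj_on[OF \<mu>] by simp
      show "\<nu> ` N \<subseteq> PiE {..<dn} (\<lambda>_. F)" using Np(1) bij_betw_imp_surj_on[OF \<nu>] by simp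
      show "inj_on \<mu> M" "inj_on \<nu> N" using \<mu> \<nu> by (auto simp: bij_betw_def)
      show "\<delta> c = (card (V c) * d + 1) ^ card (V c)" for c by (simp add: \<delta>_def cV)
      show "\<delta> c < card F" for c unfolding cF using q e by (cases c) simp_all
      show "T + card Z ^ card spider_edges * (2 ^ (card spider_edges * r) * \<delta> c ^ card (V c)) \<le> t" for c
      proof -
        have "t0 c \<le> t" using t by (cases c) simp_all
        then show ?thesis by (simp add: t0_def Z'(2) cV E_def)
      qed
    qed
    moreover have "real (card (edges G)) \<ge>
         1 / 2 * real (q ^ dm) powr (1 - real k / (2 * real k + 1))
               * real (q ^ dn) powr (1 - real k / (2 * real k + 1) - 1 / ((2 * real k + 1) * real s))"
    proof -
      have q0: "real q > 0" using q2 by simp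
      have "real (card (edges G)) = real (card {q \<in> Mp \<times> Np. val f (joint (fst q) (snd q)) \<in> Z})"
        unfolding G_def snd_conv by (subst card_bipartite_edges[OF MN \<mu> \<nu>]) simp
      also have "\<dots> \<ge> 1 / 2 * (real (q ^ dm) * real (q ^ dn) * (2 ^ r / (2 ^ e) ^ r))"
        using f(4) by (simp add: Mp(2) Np(2) Z'(2) cF)
      finally have 1: "real (card (edges G)) \<ge> 1 / 2 * (real (q ^ dm) * real (q ^ dn) * (2 ^ r / (2 ^ e) ^ r))" .
      have "real (2 ^ e) \<le> real (2 * q)" using e(3) by (simp only: of_nat_le_iff less_imp_le)
      then have "(2 ^ e) ^ r \<le> (2 * real q) ^ r" by (intro power_mono) auto
      then have "1 / real q ^ r \<le> 2 ^ r / (2 ^ e) ^ r"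
        using q0 by (simp add: field_simps power_mult_distrib)
      then have 2: "real (q ^ dm) * real (q ^ dn) * (1 / real q ^ r) \<le> real (q ^ dm) * real (q ^ dn) * (2 ^ r / (2 ^ e) ^ r)"
        by (intro mult_left_mono) auto
      \<comment> \<open>The two fractions in the exponents add up to r by its definition.\<close>
      have expo: "real dm * (1 - real k / (2 * real k + 1)) + real dn * (1 - real k / (2 * real k + 1) - 1 / ((2 * real k + 1) * real s))
          = real dm + real dn - real r"
      proof -
        have nz: "2 * real k + 1 \<noteq> 0" "real s \<noteq> 0" using s by (auto simp: add_nonneg_eq_0_iff)
        have D: "real dm = (2 * real k + 1) * (real s * real b)" "real dn = (2 * real k + 1) * (real s * real a)"
          by (simp_all add: dm_def dn_def algebra_simps)
        have gen: "x * (z * y) * (v / x) = z * y * v" "x * (z * y) * (1 / (x * z)) = y" if "x \<noteq> 0" "z \<noteq> 0" for x y z v :: real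
          using that by simp_all
        have 1: "real dm * (real k / (2 * real k + 1)) = real s * real b * real k"
          "real dn * (real k / (2 * real k + 1)) = real s * real a * real k"
          "real dn * (1 / ((2 * real k + 1) * real s)) = real a"
          unfolding D by (rule gen[OF nz])+
        show ?thesis unfolding right_diff_distrib 1 by (simp add: r_def algebra_simps)
      qed
      have "real (q ^ dm) powr x = real q powr (real dm * x)" "real (q ^ dn) powr x = real q powr (real dn * x)" for x
        using q0 by (simp_all add: powr_powr flip: powr_realpow)
      then have "real (q ^ dm) powr (1 - real k / (2 * real k + 1))
               * real (q ^ dn) powr (1 - real k / (2 * real k + 1) - 1 / ((2 * real k + 1) * real s))
         = real q powr (real dm + real dn - real r)"
        by (simp only: expo flip: powr_add)
      also have "\<dots> = real (q ^ dm) * real (q ^ dn) * (1 / real q ^ r)"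
        using q0 by (simp add: powr_diff powr_add powr_realpow)
      finally show ?thesis using 1 2 by simp
    qed
    ultimately show "\<exists>(G :: nat ugraph) M N.
       bipartite_graph G M N \<and>
       real (card M) = real q powr (\<alpha> * real l) \<and>
       card N = q ^ l \<and>
       graph_free G (subdivision (2 * k + 1) (complete_bipartite s t)) \<and>
       real (card (edges G)) \<ge>
         1 / 2 * real (card M) powr (1 - real k / (2 * real k + 1))
               * real (card N) powr (1 - real k / (2 * real k + 1) - 1 / ((2 * real k + 1) * real s))"
      using l_dn by (intro exI[of _ G] exI[of _ M] exI[of _ N]) simp
  qed
qed

end
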